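(* Let $X$ be a Banach function space over the unit circle $\mathbb{T}$ and let $w$ be a weight on $\mathbb{T}$ such that the Riesz projection $P$ is bounded on the spaces $X$ and $X(w)$. If $a\in C+H^\infty$, then \[ \|T(a)\|_{\mathcal{B}(H[X(w)]),\mathrm{e}}=\|T(a)\|_{\mathcal{B}(H[X]),\mathrm{e}}. \]
   Context: All function spaces are complex and considered over the unit circle $\mathbb{T}=\{z\in\mathbb{C}:|z|=1\}$ with Lebesgue measure $m$ normalised so that $m(\mathbb{T})=1$; functions equal a.e. are identified. For a Banach space $\mathcal{X}$, let $\mathcal{B}(\mathcal{X})$ and $\mathcal{K}(\mathcal{X})$ denote the bounded linear and the compact linear operators on $\mathcal{X}$. The essential norm of $A\in\mathcal{B}(\mathcal{X})$ is $\|A\|_{\mathcal{B}(\mathcal{X}),\mathrm{e}}:=\inf\{\|A-K\|_{\mathcal{B}(\mathcal{X})}: K\in\mathcal{K}(\mathcal{X})\}$. Banach function spaces. Let $\mathcal{M}$ be the set of measurable complex-valued functions on $\mathbb{T}$ and $\mathcal{M}^+$ the set of measurable functions on $\mathbb{T}$ with values in $[0,\infty]$. A map $\rho:\mathcal{M}^+\to[0,\infty]$ is a Banach function norm if for all $f,g,f_n\in\mathcal{M}^+$ ($n\in\mathbb{N}$) and all constants $c\ge0$: (A1) $\rho(f)=0\Leftrightarrow f=0$ a.e., $\rho(cf)=c\rho(f)$, $\rho(f+g)\le\rho(f)+\rho(g)$; (A2) $0\le g\le f$ a.e. implies $\rho(g)\le\rho(f)$; (A3) $0\le f_n\uparrow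 f$ a.e. implies $\rho(f_n)\uparrow\rho(f)$; (A4) $\rho(1)<\infty$; (A5) $\int_{\mathbb{T}}f\,dm\le C_\rho\,\rho(f)$ with a constant $C_\rho\in(0,\infty)$ independent of $f$. The Banach function space determined by $\rho$ is $X=\{f\in\mathcal{M}:\rho(|f|)<\infty\}$ with norm $\|f\|_X:=\rho(|f|)$; it is a Banach space and $L^\infty\hookrightarrow X\hookrightarrow L^1$. A weight is a measurable function $w:\mathbb{T}\to[0,\infty]$ with $0<w<\infty$ a.e. The weighted space $X(w)$ consists of all measurable $f:\mathbb{T}\to\mathbb{C}$ with $fw\in X$, with norm $\|f\|_{X(w)}:=\|fw\|_X$. Riesz projection. For $f\in L^1$ and a.e. $t\in\mathbb{T}$, let $(Sf)(t):=\frac{1}{\pi i}\,\mathrm{p.v.}\int_{\mathbb{T}}\frac{f(\tau)}{\tau-t}\,d\tau$ (Cauchy principal value) and $Pf:=\frac12(f+Sf)$. That $P$ is bounded on a space $Y$ ($Y=X$ or $Y=X(w)$) means that $Y\subset L^1$ (so that $Pf$ is defined for $f\in Y$), $P$ maps $Y$ into $Y$, and $P$ is a bounded operator with respect to the norm of $Y$. For $f\in L^1$, $\widehat f(n)=\frac{1}{2\pi}\int_{-\pi}^{\pi}f(e^{i\theta})e^{-in\theta}\,d\theta$, $n\in\mathbb{Z}$. For such a space $Y\subset L^1$, the abstract Hardy space is $H[Y]:=\{f\in Y:\widehat f(n)=0\text{ for all }n<0\}$ with the norm of $Y$. It is known that if $P$ is bounded on $X(w)$, then $X(w)$ is itself a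 Banach function space, and that if $P$ is bounded on a Banach function space $Y$, then $P$ maps $Y$ onto $H[Y]$. For $a\in L^\infty$, the Toeplitz operator $T(a)\in\mathcal{B}(H[Y])$ is then defined by $T(a)f:=P(af)$, $f\in H[Y]$. $C$ is the space of continuous complex-valued functions on $\mathbb{T}$, $H^\infty:=\{f\in L^\infty:\widehat f(n)=0\text{ for all }n<0\}$, and $C+H^\infty:=\{f\in L^\infty:f=g+h,\ g\in C,\ h\in H^\infty\}$. *)

theory Defs
  imports "HOL-Analysis.Analysis"
begin

text \<open>
  Functions on the unit circle are total functions on \<open>complex\<close> of which only the values on
  \<open>sphere 0 1\<close> matter. Functions that agree almost everywhere are not identified by a quotient:
  a function space is a set of representatives together with a norm that vanishes exactly on the
  null functions, and the operations on it are required to be linear up to null sets.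
\<close>

definition circle_measure :: "complex measure" where
  "circle_measure =
     completion (distr (uniform_measure lborel {-pi..pi}) (restrict_space borel (sphere 0 1)) cis)"

subsection \<open>Banach function spaces\<close>

definition banach_function_norm :: "((complex \<Rightarrow> ennreal) \<Rightarrow> ennreal) \<Rightarrow> bool" where
  "banach_function_norm \<rho> \<longleftrightarrow>
     (\<forall>f \<in> borel_measurable circle_measure. \<rho> f = 0 \<longleftrightarrow> (AE z in circle_measure. f z = 0)) \<and>
     (\<forall>f \<in> borel_measurable circle_measure. \<forall>c::real. c \<ge> 0 \<longrightarrow>
        \<rho> (\<lambda>z. ennreal c * f z) = ennreal c * \<rho> f) \<and>
     (\<forall>f \<in> borel_measurable circle_measure. \<forall>g \<in> borel_measurable circle_measure.
        \<rho> (\<lambda>z. f z + g z) \<le> \<rho> f + \<rho> g) \<and>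
     (\<forall>f \<in> borel_measurable circle_measure. \<forall>g \<in> borel_measurable circle_measure.
        (AE z in circle_measure. g z \<le> f z) \<longrightarrow> \<rho> g \<le> \<rho> f) \<and>
     (\<forall>F f. (\<forall>n::nat. F n \<in> borel_measurable circle_measure) \<longrightarrow>
        f \<in> borel_measurable circle_measure \<longrightarrow>
        (AE z in circle_measure. incseq (\<lambda>n. F n z) \<and> (\<lambda>n. F n z) \<longlonglongrightarrow> f z) \<longrightarrow>
        incseq (\<lambda>n. \<rho> (F n)) \<and> (\<lambda>n. \<rho> (F n)) \<longlonglongrightarrow> \<rho> f) \<and>
     \<rho> (\<lambda>_. 1) < \<infinity> \<and>
     (\<exists>C::real. C > 0 \<and> (\<forall>f \<in> borel_measurable circle_measure.
        (\<integral>\<^sup>+z. f z \<partial>circle_measure) \<le> ennreal C * \<rho> f))"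

definition bf_norm :: "((complex \<Rightarrow> ennreal) \<Rightarrow> ennreal) \<Rightarrow> (complex \<Rightarrow> complex) \<Rightarrow> ennreal" where
  "bf_norm \<rho> f = \<rho> (\<lambda>z. ennreal (norm (f z)))"

definition bf_space :: "((complex \<Rightarrow> ennreal) \<Rightarrow> ennreal) \<Rightarrow> (complex \<Rightarrow> complex) set" where
  "bf_space \<rho> = {f \<in> borel_measurable circle_measure. bf_norm \<rho> f < \<infinity>}"

definition weight :: "(complex \<Rightarrow> ennreal) \<Rightarrow> bool" where
  "weight w \<longleftrightarrow>
     w \<in> borel_measurable circle_measure \<and> (AE z in circle_measure. 0 < w z \<and> w z < \<infinity>)"

text \<open>On the null set where \<open>w = \<infinity>\<close> the product takes the value 0.\<close>

definition weight_mult :: "(complex \<Rightarrow> ennreal) \<Rightarrow> (complex \<Rightarrow> complex) \<Rightarrow> complex \<Rightarrow> complex" where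
  "weight_mult w f = (\<lambda>z. f z * complex_of_real (enn2real (w z)))"

definition weighted_norm ::
  "((complex \<Rightarrow> ennreal) \<Rightarrow> ennreal) \<Rightarrow> (complex \<Rightarrow> ennreal) \<Rightarrow> (complex \<Rightarrow> complex) \<Rightarrow> ennreal" where
  "weighted_norm \<rho> w f = bf_norm \<rho> (weight_mult w f)"

definition weighted_space ::
  "((complex \<Rightarrow> ennreal) \<Rightarrow> ennreal) \<Rightarrow> (complex \<Rightarrow> ennreal) \<Rightarrow> (complex \<Rightarrow> complex) set" where
  "weighted_space \<rho> w = {f \<in> borel_measurable circle_measure. weight_mult w f \<in> bf_space \<rho>}"

definition L_one :: "(complex \<Rightarrow> complex) set" where
  "L_one = {f. integrable circle_measure f}"

definition L_infty :: "(complex \<Rightarrow> complex) set" where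
  "L_infty = {f \<in> borel_measurable circle_measure.
     \<exists>C::real. AE z in circle_measure. norm (f z) \<le> C}"

subsection \<open>Operators on a space \<open>Y\<close> with norm \<open>N\<close>\<close>

text \<open>
  If \<open>N\<close> vanishes exactly on the null functions, a bounded operator maps functions that agree
  almost everywhere to functions that agree almost everywhere, so it acts on the space of
  equivalence classes; conversely, every bounded linear operator there has such a representative.
\<close>

definition bounded_operator ::
  "(complex \<Rightarrow> complex) set \<Rightarrow> ((complex \<Rightarrow> complex) \<Rightarrow> ennreal) \<Rightarrow>
   ((complex \<Rightarrow> complex) \<Rightarrow> complex \<Rightarrow> complex) \<Rightarrow> bool" where
  "bounded_operator Y N A \<longleftrightarrow>
     (\<forall>f\<in>Y. A f \<in> Y) \<and>
     (\<forall>f\<in>Y. \<forall>g\<in>Y. AE z in circle_measure. A (\<lambda>x. f x + g x) z = A f z + A g z) \<and>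
     (\<forall>f\<in>Y. \<forall>c. AE z in circle_measure. A (\<lambda>x. c * f x) z = c * A f z) \<and>
     (\<exists>C::real. \<forall>f\<in>Y. N (A f) \<le> ennreal C * N f)"

definition compact_operator ::
  "(complex \<Rightarrow> complex) set \<Rightarrow> ((complex \<Rightarrow> complex) \<Rightarrow> ennreal) \<Rightarrow>
   ((complex \<Rightarrow> complex) \<Rightarrow> complex \<Rightarrow> complex) \<Rightarrow> bool" where
  "compact_operator Y N K \<longleftrightarrow>
     bounded_operator Y N K \<and>
     (\<forall>F. (\<forall>n::nat. F n \<in> Y \<and> N (F n) \<le> 1) \<longrightarrow>
        (\<exists>g\<in>Y. \<exists>r. strict_mono r \<and> (\<lambda>n. N (\<lambda>z. K (F (r n)) z - g z)) \<longlonglongrightarrow> 0))"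

definition operator_norm ::
  "(complex \<Rightarrow> complex) set \<Rightarrow> ((complex \<Rightarrow> complex) \<Rightarrow> ennreal) \<Rightarrow>
   ((complex \<Rightarrow> complex) \<Rightarrow> complex \<Rightarrow> complex) \<Rightarrow> ennreal" where
  "operator_norm Y N A = (SUP f \<in> {f \<in> Y. N f \<le> 1}. N (A f))"

definition essential_norm ::
  "(complex \<Rightarrow> complex) set \<Rightarrow> ((complex \<Rightarrow> complex) \<Rightarrow> ennreal) \<Rightarrow>
   ((complex \<Rightarrow> complex) \<Rightarrow> complex \<Rightarrow> complex) \<Rightarrow> ennreal" where
  "essential_norm Y N A =
     (INF K \<in> {K. compact_operator Y N K}. operator_norm Y N (\<lambda>f z. A f z - K f z))"

subsection \<open>Riesz projection, Hardy spaces and Toeplitz operators\<close>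

text \<open>
  The integral with respect to \<open>d\<tau>\<close> is parametrised by \<open>\<tau> = cis \<theta>\<close>, \<open>d\<tau> = \<i> * cis \<theta> * d\<theta>\<close>. For
  integrable \<open>f\<close> the limit exists for almost every \<open>t\<close>; elsewhere the value of \<open>Lim\<close> is unspecified.
\<close>

definition cauchy_singular :: "(complex \<Rightarrow> complex) \<Rightarrow> complex \<Rightarrow> complex" where
  "cauchy_singular f t =
     1 / (complex_of_real pi * \<i>) *
     Lim (at_right (0::real)) (\<lambda>\<epsilon>.
       set_lebesgue_integral lebesgue {\<theta> \<in> {-pi..pi}. dist (cis \<theta>) t > \<epsilon>}
         (\<lambda>\<theta>. f (cis \<theta>) / (cis \<theta> - t) * (\<i> * cis \<theta>)))"

definition riesz_projection :: "(complex \<Rightarrow> complex) \<Rightarrow> complex \<Rightarrow> complex" where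
  "riesz_projection f = (\<lambda>t. (f t + cauchy_singular f t) / 2)"

definition riesz_bounded_on ::
  "(complex \<Rightarrow> complex) set \<Rightarrow> ((complex \<Rightarrow> complex) \<Rightarrow> ennreal) \<Rightarrow> bool" where
  "riesz_bounded_on Y N \<longleftrightarrow> Y \<subseteq> L_one \<and> bounded_operator Y N riesz_projection"

definition fourier_coeff :: "(complex \<Rightarrow> complex) \<Rightarrow> int \<Rightarrow> complex" where
  "fourier_coeff f n =
     1 / complex_of_real (2 * pi) *
     set_lebesgue_integral lebesgue {-pi..pi} (\<lambda>\<theta>. f (cis \<theta>) * cis (- (of_int n * \<theta>)))"

definition hardy :: "(complex \<Rightarrow> complex) set \<Rightarrow> (complex \<Rightarrow> complex) set" where
  "hardy Y = {f \<in> Y. \<forall>n<0. fourier_coeff f n = 0}"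

definition toeplitz ::
  "(complex \<Rightarrow> complex) \<Rightarrow> (complex \<Rightarrow> complex) \<Rightarrow> complex \<Rightarrow> complex" where
  "toeplitz a f = riesz_projection (\<lambda>z. a z * f z)"

definition C_plus_H_infty :: "(complex \<Rightarrow> complex) set" where
  "C_plus_H_infty = {f \<in> L_infty. \<exists>g h. continuous_on (sphere 0 1) g \<and> h \<in> hardy L_infty \<and>
     (AE z in circle_measure. f z = g z + h z)}"

end

theory Submission
  imports Defs "HOL-Probability.Probability_Measure" "HOL-Real_Asymp.Real_Asymp"
begin

text \<open>
  Let \<open>W\<close> be the outer function with modulus \<open>w\<close>. Multiplication by \<open>W\<close> is an isometry from
  \<open>H[X(w)]\<close> onto \<open>H[X]\<close> that commutes with \<open>T(h)\<close> for bounded analytic \<open>h\<close>, and it commutes with the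
  backward shift \<open>T(cnj z)\<close> up to rank one. Every symbol \<open>a\<close> in \<open>C + H\<^sup>\<infinity>\<close> is uniformly close to
  some \<open>cnj z ^ n * h z\<close>, so the isometry carries \<open>T(a)\<close> to \<open>T(a)\<close> up to a finite rank
  operator and an operator of arbitrarily small norm.

  What has to be known about \<open>P\<close> is obtained from its definition as a principal value. If the
  principal value of \<open>f\<close> diverges at \<open>t\<close>, so does that of \<open>f + g\<close> for every \<open>g\<close> whose principal value
  exists, and the common value of \<open>Lim\<close> contradicts additivity of \<open>P\<close> unless the principal value of
  \<open>g\<close> vanishes; hence boundedness of \<open>P\<close> on the space forces existence almost everywhere. Comparing
  the truncated kernel at radius \<open>1 - r\<close> with the Cauchy kernel at \<open>r\<close>, the difference being bounded by
  the Poisson kernel, gives \<open>P f\<close> as a limit of Cauchy integrals, and in particular \<open>P f = f\<close> for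
  analytic \<open>f\<close>.

  The outer function is \<open>exp (2 * P u - c)\<close> with \<open>u = ln w\<close>; here the positive part of \<open>u\<close> lies in
  \<open>X\<close> and the negative part in \<open>X(w)\<close>, since \<open>w\<close> is in \<open>X\<close> and \<open>1 / w\<close> in \<open>X(w)\<close>.
\<close>

section \<open>Lebesgue measure on the circle\<close>

text \<open>Boundedness of \<open>P\<close> is an assumption about an expression built from
  \<open>Lim\<close>, which has some value everywhere, so existence of principal values has to be
  tested against functions whose principal value is known. In X the constant \<open>1\<close>
  serves, with principal value \<open>1 / 2\<close>. The indicator of \<open>{v \<le> n}\<close>,
  where \<open>v\<close> is the weight, lies in both spaces and inherits its principal value from X;
  since \<open>P f - z * P (cnj z * f)\<close> is the mean of \<open>f\<close>, the constants then
  lie in X(w) as well. The same identity bounds the mean in the norm of the space, where an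
  inclusion in L1 alone gives no estimate.

  Boundary limits are taken along sequences of radii that depend on the function, because they come
  from convergence in L1 of Poisson averages of the oscillation.

  In the comparison the small part of the symbol costs its supremum times the norms of
  \<open>P\<close> on both spaces. The compact operator used there depends on the approximation of
  the symbol, which an infimum over compact operators permits. Only one inequality is proved; the
  other is the same statement for \<open>1 / W\<close>.\<close>

abbreviation circle_measure_abbrev :: "complex measure" ("\<mu>") where
  "\<mu> \<equiv> circle_measure"

text \<open>Preimages under the two functions differ by a null set, and a complete measure measures
  every such modification.\<close>

lemma complete_measurable_AE:
  assumes f: "f \<in> borel_measurable (completion M)" and eq: "AE x in completion M. f x = g x"
  shows "g \<in> borel_measurable (completion M)"
proof (rule measurableI)
  fix A :: "'b set" assume A: "A \<in> sets borel"
  show "g -` A \<inter> space (completion M) \<in> sets (completion M)"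
  proof (rule completion.in_sets_AE)
    show "f -` A \<inter> space (completion M) \<in> sets (completion M)"
      using f A by (rule measurable_sets)
    show "AE x in completion M. x \<in> f -` A \<inter> space (completion M) \<longleftrightarrow> x \<in> g -` A \<inter> space (completion M)"
      using eq by eventually_elim auto
  qed auto
qed auto

lemma completion_ex_borel_measurable_complex:
  fixes f :: "'a \<Rightarrow> complex"
  assumes f: "f \<in> borel_measurable (completion M)"
  shows "\<exists>g\<in>borel_measurable M. AE x in M. f x = g x"
proof -
  have "(\<lambda>x. Re (f x)) \<in> borel_measurable (completion M)"
    "(\<lambda>x. Im (f x)) \<in> borel_measurable (completion M)"
    using f by measurable
  from this[THEN completion_ex_borel_measurable_real]
  obtain a b where [measurable]: "a \<in> borel_measurable M" "b \<in> borel_measurable M"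
    and ae: "AE x in M. Re (f x) = a x" "AE x in M. Im (f x) = b x" by blast
  show ?thesis
  proof
    show "(\<lambda>x. Complex (a x) (b x)) \<in> borel_measurable M"
      unfolding Complex_eq by measurable
    show "AE x in M. f x = Complex (a x) (b x)"
      using ae by eventually_elim (simp add: complex_eq_iff)
  qed
qed

text \<open>The measure before completion. Product measurability and Tonelli are applied to it, and
  results are carried to \<open>\<mu>\<close> through Borel representatives.\<close>

definition circle_borel :: "complex measure" where
  "circle_borel = distr (uniform_measure lborel {-pi..pi}) (restrict_space borel (sphere 0 1)) cis"

lemma circle_measure_eq: "\<mu> = completion circle_borel"
  by (simp add: circle_measure_def circle_borel_def)

lemma sets_circle_borel: "sets circle_borel = sets (restrict_space borel (sphere 0 1))"
  by (simp add: circle_borel_def)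

lemma space_circle_borel [simp]: "space circle_borel = sphere 0 1"
  by (simp add: circle_borel_def space_restrict_space)

lemma space_circle_measure [simp]: "space \<mu> = sphere 0 1"
  by (simp add: circle_measure_eq)

lemma measurable_cis_circle:
  "cis \<in> uniform_measure lborel {-pi..pi} \<rightarrow>\<^sub>M restrict_space borel (sphere 0 1)"
  by (intro measurable_restrict_space2) (auto simp: measurable_cong_sets[OF sets_uniform_measure refl]
      intro!: borel_measurable_continuous_onI continuous_intros)

lemma prob_space_circle_borel: "prob_space circle_borel"
  unfolding circle_borel_def
proof (rule prob_space.prob_space_distr)
  show "prob_space (uniform_measure lborel {- pi..pi})"
    by (rule prob_space_uniform_measure) auto
qed (rule measurable_cis_circle)

interpretation circle_borel: prob_space circle_borel
  by (rule prob_space_circle_borel)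

interpretation circle: prob_space \<mu>
  unfolding circle_measure_eq
proof (intro prob_spaceI)
  have "space circle_borel \<in> sets circle_borel" by (rule sets.top)
  then show "emeasure (completion circle_borel) (space (completion circle_borel)) = 1"
    using circle_borel.emeasure_space_1 by simp
qed

lemma measurable_circle_borel:
  "f \<in> measurable (restrict_space borel (sphere 0 1)) N \<Longrightarrow> f \<in> measurable circle_borel N"
  by (simp add: measurable_cong_sets[OF sets_circle_borel refl])

lemma borel_imp_circle_borel:
  "f \<in> borel_measurable borel \<Longrightarrow> f \<in> borel_measurable circle_borel"
  by (intro measurable_circle_borel measurable_restrict_space1) auto

lemma borel_imp_circle:
  "f \<in> borel_measurable borel \<Longrightarrow> f \<in> borel_measurable \<mu>"
  unfolding circle_measure_eq by (intro measurable_completion borel_imp_circle_borel)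

lemma continuous_imp_circle_borel:
  "continuous_on (sphere 0 1) f \<Longrightarrow> f \<in> borel_measurable circle_borel"
  by (intro measurable_circle_borel borel_measurable_continuous_on_restrict)

lemma continuous_imp_circle:
  "continuous_on (sphere 0 1) f \<Longrightarrow> f \<in> borel_measurable \<mu>"
  unfolding circle_measure_eq by (intro measurable_completion continuous_imp_circle_borel)

lemma circle_measurable_AE:
  "f \<in> borel_measurable \<mu> \<Longrightarrow> AE z in \<mu>. f z = g z \<Longrightarrow>
   g \<in> borel_measurable \<mu>"
  unfolding circle_measure_eq by (rule complete_measurable_AE)

lemma AE_circle_iff: "(AE z in \<mu>. Q z) \<longleftrightarrow> (AE z in circle_borel. Q z)"
  unfolding circle_measure_eq by (rule AE_completion_iff)

lemma AE_sphere: "AE z in \<mu>. z \<in> sphere 0 1"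
  by (rule AE_I2) simp

lemma circle_borel_representative:
  assumes "f \<in> borel_measurable \<mu>"
  obtains g :: "complex \<Rightarrow> complex" where "g \<in> borel_measurable circle_borel" "AE z in \<mu>. f z = g z"
  using completion_ex_borel_measurable_complex[OF assms[unfolded circle_measure_eq]]
  unfolding AE_circle_iff by blast

lemma AE_circle_cis:
  assumes "AE z in \<mu>. Q z"
  shows "AE \<theta> in lborel. \<theta> \<in> {-pi..pi} \<longrightarrow> Q (cis \<theta>)"
proof -
  have "AE \<theta> in uniform_measure lborel {-pi..pi}. Q (cis \<theta>)"
    using AE_distrD[OF measurable_cis_circle] assms
    unfolding AE_circle_iff circle_borel_def by blast
  then show ?thesis by (subst (asm) AE_uniform_measure) auto
qed

lemma nn_integral_circle_borel:
  assumes f: "f \<in> borel_measurable circle_borel"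
  shows "(\<integral>\<^sup>+z. f z \<partial>circle_borel) =
    (\<integral>\<^sup>+\<theta>. f (cis \<theta>) * indicator {-pi..pi} \<theta> \<partial>lborel) / ennreal (2 * pi)"
proof -
  have f': "f \<in> borel_measurable (restrict_space borel (sphere 0 1))"
    using f by (simp add: measurable_cong_sets[OF sets_circle_borel refl])
  have "(\<integral>\<^sup>+z. f z \<partial>circle_borel) = (\<integral>\<^sup>+\<theta>. f (cis \<theta>) \<partial>uniform_measure lborel {-pi..pi})"
    unfolding circle_borel_def by (rule nn_integral_distr[OF measurable_cis_circle]) (use f' in simp)
  also have "\<dots> = (\<integral>\<^sup>+\<theta>. f (cis \<theta>) * indicator {-pi..pi} \<theta> \<partial>lborel) / emeasure lborel {-pi..pi}"
    using measurable_compose[OF measurable_cis_circle f']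
    by (subst nn_integral_uniform_measure) (auto simp: measurable_cong_sets[OF sets_uniform_measure refl])
  finally show ?thesis by simp
qed

lemma circle_borel_integral:
  fixes f :: "complex \<Rightarrow> complex"
  assumes f: "integrable circle_borel f"
  shows "integrable lborel (\<lambda>\<theta>. indicator {-pi..pi} \<theta> *\<^sub>R f (cis \<theta>))"
    and "(\<integral>\<theta>. indicator {-pi..pi} \<theta> *\<^sub>R f (cis \<theta>) \<partial>lborel) = 2 * pi * (\<integral>z. f z \<partial>circle_borel)"
proof -
  have f': "f \<in> borel_measurable (restrict_space borel (sphere 0 1))"
    using borel_measurable_integrable[OF f] by (simp add: measurable_cong_sets[OF sets_circle_borel refl])
  have m: "(\<lambda>\<theta>. f (cis \<theta>)) \<in> borel_measurable borel"
    using measurable_compose[OF measurable_cis_circle f']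
    by (auto simp: measurable_cong_sets[OF sets_uniform_measure refl])
  have u: "uniform_measure lborel {-pi..pi} = density lborel (\<lambda>\<theta>. ennreal (indicator {-pi..pi} \<theta> / (2 * pi)))"
    unfolding uniform_measure_def
  proof (intro arg_cong2[where f=density] refl ext)
    fix \<theta> :: real
    show "indicator {-pi..pi} \<theta> / emeasure lborel {-pi..pi} = ennreal (indicator {-pi..pi} \<theta> / (2 * pi))"
      using divide_ennreal[of 1 "2 * pi"] by (cases "\<theta> \<in> {-pi..pi}") (simp_all del: ennreal_1 add: ennreal_1[symmetric])
  qed
  have i: "integrable (uniform_measure lborel {-pi..pi}) (\<lambda>\<theta>. f (cis \<theta>))"
    using f f' unfolding circle_borel_def by (subst (asm) integrable_distr_eq[OF measurable_cis_circle]) auto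
  then have i': "integrable lborel (\<lambda>\<theta>. (indicator {-pi..pi} \<theta> / (2 * pi)) *\<^sub>R f (cis \<theta>))"
    unfolding u using m by (subst (asm) integrable_density) auto
  from integrable_scaleR_right[OF this, of "2 * pi"]
  show "integrable lborel (\<lambda>\<theta>. indicator {-pi..pi} \<theta> *\<^sub>R f (cis \<theta>))" by simp
  have "(\<integral>z. f z \<partial>circle_borel) = (\<integral>\<theta>. f (cis \<theta>) \<partial>uniform_measure lborel {-pi..pi})"
    unfolding circle_borel_def by (rule integral_distr[OF measurable_cis_circle f'])
  also have "\<dots> = (\<integral>\<theta>. (indicator {-pi..pi} \<theta> / (2 * pi)) *\<^sub>R f (cis \<theta>) \<partial>lborel)"
    unfolding u using m by (subst integral_density) auto
  also have "\<dots> = (\<integral>\<theta>. (1 / (2 * pi)) *\<^sub>R (indicator {-pi..pi} \<theta> *\<^sub>R f (cis \<theta>)) \<partial>lborel)"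
    by simp
  also have "\<dots> = (1 / (2 * pi)) *\<^sub>R (\<integral>\<theta>. indicator {-pi..pi} \<theta> *\<^sub>R f (cis \<theta>) \<partial>lborel)"
    by (rule integral_scaleR_right)
  finally show "(\<integral>\<theta>. indicator {-pi..pi} \<theta> *\<^sub>R f (cis \<theta>) \<partial>lborel) = 2 * pi * (\<integral>z. f z \<partial>circle_borel)"
    by (simp add: scaleR_conv_of_real)
qed

text \<open>Bridge from the integrals over the angle in the definitions to \<open>\<mu>\<close>.
  Composition with \<open>cis\<close> is controlled for Borel functions, so the integral is computed
  for a Borel representative and carried back through both completions.\<close>

lemma set_integral_circle:
  fixes f :: "complex \<Rightarrow> complex"
  assumes f: "integrable \<mu> f"
  shows "set_integrable lebesgue {-pi..pi} (\<lambda>\<theta>. f (cis \<theta>))"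
    and "set_lebesgue_integral lebesgue {-pi..pi} (\<lambda>\<theta>. f (cis \<theta>)) = 2 * pi * (\<integral>z. f z \<partial>\<mu>)"
proof -
  obtain g where g[measurable]: "g \<in> borel_measurable circle_borel" and ae: "AE z in \<mu>. f z = g z"
    using circle_borel_representative[OF borel_measurable_integrable[OF f]] by blast
  have gm: "g \<in> borel_measurable \<mu>"
    unfolding circle_measure_eq by (rule measurable_completion) fact
  have "integrable \<mu> g"
    by (rule integrable_cong_AE_imp[OF f gm ae])
  then have ig: "integrable circle_borel g"
    unfolding circle_measure_eq by (simp add: integrable_completion)
  have ig_eq: "(\<integral>z. f z \<partial>\<mu>) = (\<integral>z. g z \<partial>circle_borel)"
    using integral_cong_AE[OF _ gm ae] f g unfolding circle_measure_eq
    by (simp add: integral_completion)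
  have ae': "AE \<theta> in lebesgue. indicator {-pi..pi} \<theta> *\<^sub>R g (cis \<theta>) = indicator {-pi..pi} \<theta> *\<^sub>R f (cis \<theta>)"
    by (rule AE_completion) (use AE_circle_cis[OF ae] in eventually_elim, auto simp: indicator_def)
  have il: "integrable lborel (\<lambda>\<theta>. indicator {-pi..pi} \<theta> *\<^sub>R g (cis \<theta>))"
    by (rule circle_borel_integral(1)[OF ig])
  then have il': "integrable lebesgue (\<lambda>\<theta>. indicator {-pi..pi} \<theta> *\<^sub>R g (cis \<theta>))"
    using integrable_completion[OF borel_measurable_integrable[OF il]] by blast
  have mf: "(\<lambda>\<theta>. indicator {-pi..pi} \<theta> *\<^sub>R f (cis \<theta>)) \<in> borel_measurable lebesgue"
    using complete_measurable_AE[OF borel_measurable_integrable[OF il'] ae'] .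
  show "set_integrable lebesgue {-pi..pi} (\<lambda>\<theta>. f (cis \<theta>))"
    unfolding set_integrable_def by (rule integrable_cong_AE_imp[OF il' mf ae'])
  have "set_lebesgue_integral lebesgue {-pi..pi} (\<lambda>\<theta>. f (cis \<theta>)) =
      (\<integral>\<theta>. indicator {-pi..pi} \<theta> *\<^sub>R g (cis \<theta>) \<partial>lebesgue)"
    unfolding set_lebesgue_integral_def
    by (rule integral_cong_AE[OF borel_measurable_integrable[OF il'] mf ae', symmetric])
  also have "\<dots> = (\<integral>\<theta>. indicator {-pi..pi} \<theta> *\<^sub>R g (cis \<theta>) \<partial>lborel)"
    by (rule integral_completion[OF borel_measurable_integrable[OF il]])
  finally show "set_lebesgue_integral lebesgue {-pi..pi} (\<lambda>\<theta>. f (cis \<theta>)) = 2 * pi * (\<integral>z. f z \<partial>\<mu>)"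
    by (simp add: circle_borel_integral(2)[OF ig] ig_eq)
qed

lemma fourier_coeff_circle:
  assumes f: "f \<in> L_one"
  shows "fourier_coeff f n = (\<integral>z. f z * (cnj z powi n) \<partial>\<mu>)"
proof -
  have int: "integrable \<mu> (\<lambda>z. f z * (cnj z powi n))"
  proof (rule Bochner_Integration.integrable_bound)
    show "integrable \<mu> f" using f by (simp add: L_one_def)
    have "(\<lambda>z. cnj z powi n) \<in> borel_measurable \<mu>"
      by (rule continuous_imp_circle) (auto intro!: continuous_intros)
    then show "(\<lambda>z. f z * cnj z powi n) \<in> borel_measurable \<mu>"
      using f by (auto simp: L_one_def)
    show "AE z in \<mu>. norm (f z * cnj z powi n) \<le> norm (f z)"
      by (rule AE_I2) (auto simp: norm_mult norm_power_int)
  qed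
  have "cnj (cis \<theta>) powi n = cis (- (of_int n * \<theta>))" for \<theta>
    unfolding cis_cnj cis_power_int by simp
  then show ?thesis
    unfolding fourier_coeff_def using set_integral_circle(2)[OF int] by simp
qed

lemma nn_integral_circle: "nn_integral \<mu> f = nn_integral circle_borel f"
  unfolding circle_measure_eq by (rule nn_integral_completion)

section \<open>Reflections and the Cauchy kernel\<close>

lemma circle_borel_ident [measurable]:
  "(\<lambda>z. z) \<in> borel_measurable circle_borel"
  "(\<lambda>p. fst p) \<in> borel_measurable (circle_borel \<Otimes>\<^sub>M circle_borel)"
  "(\<lambda>p. snd p) \<in> borel_measurable (circle_borel \<Otimes>\<^sub>M circle_borel)"
proof -
  show *: "(\<lambda>z. z) \<in> borel_measurable circle_borel"
    by (rule borel_imp_circle_borel) simp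
  show "(\<lambda>p. fst p) \<in> borel_measurable (circle_borel \<Otimes>\<^sub>M circle_borel)"
    "(\<lambda>p. snd p) \<in> borel_measurable (circle_borel \<Otimes>\<^sub>M circle_borel)"
    using measurable_compose[OF measurable_fst *] measurable_compose[OF measurable_snd *] by auto
qed

lemma nn_integral_periodic:
  fixes F :: "real \<Rightarrow> ennreal"
  assumes [measurable]: "F \<in> borel_measurable borel" and per: "\<And>x. F (x + 2 * pi) = F x"
    and \<gamma>: "0 \<le> \<gamma>" "\<gamma> \<le> 2 * pi"
  shows "(\<integral>\<^sup>+x. F x * indicator {\<gamma> - pi..\<gamma> + pi} x \<partial>lborel) = (\<integral>\<^sup>+x. F x * indicator {-pi..pi} x \<partial>lborel)"
proof -
  have "(\<integral>\<^sup>+x. F x * indicator {\<gamma> - pi..\<gamma> + pi} x \<partial>lborel) =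
      (\<integral>\<^sup>+x. F x * indicator {\<gamma> - pi..pi} x + F x * indicator {pi<..\<gamma> + pi} x \<partial>lborel)"
    using \<gamma> by (intro nn_integral_cong) (auto simp: indicator_def)
  also have "\<dots> = (\<integral>\<^sup>+x. F x * indicator {\<gamma> - pi..pi} x \<partial>lborel) +
      (\<integral>\<^sup>+x. F x * indicator {pi<..\<gamma> + pi} x \<partial>lborel)"
    by (rule nn_integral_add) auto
  also have "(\<integral>\<^sup>+x. F x * indicator {pi<..\<gamma> + pi} x \<partial>lborel) =
     (\<integral>\<^sup>+x. F (2 * pi + 1 * x) * indicator {pi<..\<gamma> + pi} (2 * pi + 1 * x) \<partial>lborel)"
    by (subst nn_integral_real_affine[where c=1 and t="2 * pi"]) auto
  also have "\<dots> = (\<integral>\<^sup>+x. F x * indicator {- pi<..\<gamma> - pi} x \<partial>lborel)"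
  proof (rule nn_integral_cong)
    fix x
    have "F (2 * pi + 1 * x) = F x" using per[of x] by (simp add: add.commute)
    moreover have "(indicator {pi<..\<gamma> + pi} (2 * pi + 1 * x) :: ennreal) = indicator {- pi<..\<gamma> - pi} x"
      by (auto simp: indicator_def)
    ultimately show "F (2 * pi + 1 * x) * indicator {pi<..\<gamma> + pi} (2 * pi + 1 * x) = F x * indicator {- pi<..\<gamma> - pi} x"
      by simp
  qed
  also have "(\<integral>\<^sup>+x. F x * indicator {\<gamma> - pi..pi} x \<partial>lborel) + \<dots> =
      (\<integral>\<^sup>+x. F x * indicator {\<gamma> - pi..pi} x + F x * indicator {- pi<..\<gamma> - pi} x \<partial>lborel)"
    by (rule nn_integral_add[symmetric]) auto
  also have "\<dots> = (\<integral>\<^sup>+x. F x * indicator {-pi..pi} x \<partial>lborel)"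
  proof (rule nn_integral_cong_AE)
    \<comment> \<open>The two pieces may both contain \<open>\<gamma> - pi\<close> and both miss
      \<open>-pi\<close>.\<close>
    show "AE x in lborel. F x * indicator {\<gamma> - pi..pi} x + F x * indicator {- pi<..\<gamma> - pi} x = F x * indicator {-pi..pi} x"
      using AE_lborel_singleton[of "-pi"] AE_lborel_singleton[of "\<gamma>-pi"]
    proof eventually_elim
      case (elim x)
      consider "x < -pi" | "-pi < x \<and> x < \<gamma> - pi" | "\<gamma> - pi < x \<and> x \<le> pi" | "pi < x"
        using elim by linarith
      then show ?case using \<gamma> by cases (auto simp: indicator_def)
    qed
  qed
  finally show ?thesis .
qed

lemma measurable_circle_reflect:
  assumes c: "norm c = 1"
  shows "(\<lambda>z. c * cnj z) \<in> circle_borel \<rightarrow>\<^sub>M circle_borel"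
proof -
  have "(\<lambda>z. c * cnj z) \<in> circle_borel \<rightarrow>\<^sub>M restrict_space borel (sphere 0 1)"
  proof (rule measurable_restrict_space2)
    show "(\<lambda>z. c * cnj z) \<in> borel_measurable circle_borel"
      by (rule continuous_imp_circle_borel) (intro continuous_intros)
  qed (use c in \<open>auto simp: norm_mult\<close>)
  then show ?thesis by (simp add: measurable_cong_sets[OF refl sets_circle_borel])
qed

text \<open>In the angle this is \<open>\<theta> \<mapsto> \<gamma> - \<theta>\<close>, so a single
  substitution covers conjugation (\<open>c = 1\<close>) and, by composing two reflections, all
  rotations.\<close>

lemma nn_integral_circle_reflect:
  assumes f: "f \<in> borel_measurable circle_borel" and c: "norm c = 1"
  shows "(\<integral>\<^sup>+z. f (c * cnj z) \<partial>circle_borel) = (\<integral>\<^sup>+z. f z \<partial>circle_borel)"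
proof -
  define \<gamma> where "\<gamma> = Arg2pi c"
  have \<gamma>: "0 \<le> \<gamma>" "\<gamma> \<le> 2 * pi" "c = cis \<gamma>"
    using Arg2pi[of c] c by (auto simp: \<gamma>_def cis_conv_exp mult.commute is_Arg_def)
  have f': "f \<in> borel_measurable (restrict_space borel (sphere 0 1))"
    using f by (simp add: measurable_cong_sets[OF sets_circle_borel refl])
  have cis_m: "cis \<in> borel \<rightarrow>\<^sub>M restrict_space borel (sphere 0 1)"
    by (intro measurable_restrict_space2) (auto intro!: borel_measurable_continuous_onI continuous_intros)
  have m: "(\<lambda>\<theta>. f (cis \<theta>)) \<in> borel_measurable borel"
    using measurable_compose[OF cis_m f'] .
  note r = measurable_circle_reflect[OF c]
  have "(\<integral>\<^sup>+z. f (c * cnj z) \<partial>circle_borel) =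
      (\<integral>\<^sup>+\<theta>. f (c * cnj (cis \<theta>)) * indicator {-pi..pi} \<theta> \<partial>lborel) / ennreal (2 * pi)"
    by (rule nn_integral_circle_borel) (rule measurable_compose[OF r f])
  also have "(\<integral>\<^sup>+\<theta>. f (c * cnj (cis \<theta>)) * indicator {-pi..pi} \<theta> \<partial>lborel) =
      (\<integral>\<^sup>+\<theta>. f (cis (\<gamma> + -1 * \<theta>)) * indicator {\<gamma> - pi..\<gamma> + pi} (\<gamma> + -1 * \<theta>) \<partial>lborel)"
    by (intro nn_integral_cong arg_cong2[where f="(*)"]) (auto simp: \<gamma>(3) cis_cnj cis_mult indicator_def)
  also have "\<dots> = (\<integral>\<^sup>+\<theta>. f (cis \<theta>) * indicator {\<gamma> - pi..\<gamma> + pi} \<theta> \<partial>lborel)"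
    using m by (subst (2) nn_integral_real_affine[where c="-1" and t="\<gamma>"]) auto
  also have "\<dots> = (\<integral>\<^sup>+\<theta>. f (cis \<theta>) * indicator {-pi..pi} \<theta> \<partial>lborel)"
    by (rule nn_integral_periodic) (use m \<gamma> in \<open>auto simp: cis_mult[symmetric]\<close>)
  finally show ?thesis by (simp add: nn_integral_circle_borel[OF f])
qed

lemma integral_circle_reflect:
  fixes f :: "complex \<Rightarrow> complex"
  assumes f: "f \<in> borel_measurable circle_borel" and c: "norm c = 1"
  shows "(\<integral>z. f (c * cnj z) \<partial>\<mu>) = (\<integral>z. f z \<partial>\<mu>)"
proof -
  note r = measurable_circle_reflect[OF c]
  have "distr circle_borel circle_borel (\<lambda>z. c * cnj z) = circle_borel"
  proof (rule measure_eqI)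
    fix A assume "A \<in> sets (distr circle_borel circle_borel (\<lambda>z. c * cnj z))"
    then have A: "A \<in> sets circle_borel" by simp
    have "emeasure (distr circle_borel circle_borel (\<lambda>z. c * cnj z)) A =
       (\<integral>\<^sup>+z. indicator A z \<partial>distr circle_borel circle_borel (\<lambda>z. c * cnj z))"
      using A by simp
    also have "\<dots> = (\<integral>\<^sup>+z. indicator A (c * cnj z) \<partial>circle_borel)"
      using A by (subst nn_integral_distr[OF r]) auto
    also have "\<dots> = emeasure circle_borel A"
      using A by (subst nn_integral_circle_reflect[OF _ c]) auto
    finally show "emeasure (distr circle_borel circle_borel (\<lambda>z. c * cnj z)) A = emeasure circle_borel A" .
  qed simp
  then have "(\<integral>z. f z \<partial>circle_borel) = (\<integral>z. f (c * cnj z) \<partial>circle_borel)"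
    using integral_distr[OF r f] by simp
  moreover have "(\<lambda>z. f (c * cnj z)) \<in> borel_measurable circle_borel"
    by (rule measurable_compose[OF r f])
  ultimately show ?thesis
    using f by (simp add: circle_measure_eq integral_completion)
qed

text \<open>Reflecting with \<open>1\<close> and with a \<open>c\<close> such that
  \<open>c ^ n = -1\<close> shows that the integral equals both the conjugate moment and its
  negative.\<close>

lemma integral_circle_power:
  assumes n: "n \<ge> 1"
  shows "(\<integral>z. z ^ n \<partial>\<mu>) = 0"
proof -
  have *: "(\<integral>z. z ^ n \<partial>\<mu>) = c ^ n * (\<integral>z. cnj z ^ n \<partial>\<mu>)" if "norm c = 1" for c
    using integral_circle_reflect[of "\<lambda>z. z ^ n" c] that by (simp add: power_mult_distrib)
  define c where "c = cis (pi / n)"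
  have "c ^ n = -1"
    using n by (simp add: c_def Complex.DeMoivre)
  then show ?thesis
    using *[of c] *[of 1] by (simp add: c_def) 
qed

lemma integrable_mult_bounded:
  fixes f g :: "'a \<Rightarrow> complex"
  assumes f: "integrable M f" and g: "g \<in> borel_measurable M" "AE z in M. norm (g z) \<le> C"
  shows "integrable M (\<lambda>z. f z * g z)"
proof (rule Bochner_Integration.integrable_bound)
  show "integrable M (\<lambda>z. C * norm (f z))" using f by auto
  show "(\<lambda>z. f z * g z) \<in> borel_measurable M" using f g by auto
  show "AE z in M. norm (f z * g z) \<le> norm (C * norm (f z))"
    using g(2)
  proof eventually_elim
    case (elim z)
    have "norm (f z) * norm (g z) \<le> norm (f z) * C" using elim by (intro mult_left_mono) auto
    also have "\<dots> \<le> norm (C * norm (f z))" by (simp add: mult.commute abs_ge_self del: abs_mult)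
    finally show ?case by (simp only: norm_mult)
  qed
qed

lemma integrable_mult_continuous:
  fixes f g :: "complex \<Rightarrow> complex"
  assumes f: "integrable \<mu> f" and g: "continuous_on (sphere 0 1) g"
  shows "integrable \<mu> (\<lambda>z. f z * g z)"
proof -
  have "compact (g ` sphere 0 1)" by (intro compact_continuous_image g) auto
  then obtain C where "\<And>z. z \<in> sphere 0 1 \<Longrightarrow> norm (g z) \<le> C"
    by (meson compact_imp_bounded bounded_iff imageI)
  then have "AE z in \<mu>. norm (g z) \<le> C"
    by (intro AE_I2) (auto simp del: mem_sphere)
  then show ?thesis
    by (rule integrable_mult_bounded[OF f continuous_imp_circle[OF g]])
qed

lemma one_minus_nonzero:
  fixes q :: complex assumes "norm q < 1" shows "1 - q \<noteq> 0" "1 - norm q \<le> norm (1 - q)"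
proof -
  show "1 - norm q \<le> norm (1 - q)" using norm_triangle_ineq2[of 1 q] by simp
  then show "1 - q \<noteq> 0" using assms by auto
qed

text \<open>Only the analytic or only the coanalytic part is seen, depending on \<open>e\<close>.\<close>

lemma integral_geometric:
  fixes f e :: "complex \<Rightarrow> complex"
  assumes f: "integrable \<mu> f" and q: "norm q < 1"
    and e: "continuous_on (sphere 0 1) e" "\<And>z. norm z = 1 \<Longrightarrow> norm (e z) = 1"
  shows "(\<lambda>n. q ^ n * (\<integral>z. f z * e z ^ n \<partial>\<mu>)) sums (\<integral>z. f z / (1 - q * e z) \<partial>\<mu>)"
proof -
  have int: "integrable \<mu> (\<lambda>z. f z * (q * e z) ^ n)" for n
    by (intro integrable_mult_continuous f continuous_intros e)
  have "(\<lambda>N. \<integral>z. f z * (\<Sum>n<N. (q * e z) ^ n) \<partial>\<mu>) \<longlonglongrightarrow> (\<integral>z. f z / (1 - q * e z) \<partial>\<mu>)"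
  proof (rule integral_dominated_convergence[where w="\<lambda>z. norm (f z) * (2 / (1 - norm q))"])
    have ne: "1 - q * e z \<noteq> 0" if "z \<in> sphere 0 1" for z
      using one_minus_nonzero(1)[of "q * e z"] that q e(2)[of z] by (auto simp: norm_mult)
    have "continuous_on (sphere 0 1) (\<lambda>z. 1 / (1 - q * e z))"
      by (intro continuous_intros e) (use ne in auto)
    from integrable_mult_continuous[OF f this]
    show "(\<lambda>z. f z / (1 - q * e z)) \<in> borel_measurable \<mu>" by (auto simp: field_simps)
    show "(\<lambda>z. f z * (\<Sum>n<N. (q * e z) ^ n)) \<in> borel_measurable \<mu>" for N
      by (intro borel_measurable_integrable integrable_mult_continuous f continuous_intros e)
    show "integrable \<mu> (\<lambda>z. norm (f z) * (2 / (1 - norm q)))" using f by auto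
    show "AE z in \<mu>. (\<lambda>N. f z * (\<Sum>n<N. (q * e z) ^ n)) \<longlonglongrightarrow> f z / (1 - q * e z)"
    proof (rule AE_I2)
      fix z assume z: "z \<in> space \<mu>"
      then have "norm (q * e z) < 1" using q e(2)[of z] by (simp add: norm_mult)
      from geometric_sums[OF this] have "(\<lambda>N. \<Sum>n<N. (q * e z) ^ n) \<longlonglongrightarrow> 1 / (1 - q * e z)"
        by (simp add: sums_def)
      from tendsto_mult_left[OF this, of "f z"]
      show "(\<lambda>N. f z * (\<Sum>n<N. (q * e z) ^ n)) \<longlonglongrightarrow> f z / (1 - q * e z)" by simp
    qed
    show "AE z in \<mu>. norm (f z * (\<Sum>n<N. (q * e z) ^ n)) \<le> norm (f z) * (2 / (1 - norm q))" for N
    proof (rule AE_I2)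
      fix z assume z: "z \<in> space \<mu>"
      then have nq: "norm (q * e z) = norm q" using e(2)[of z] by (simp add: norm_mult)
      have "norm (\<Sum>n<N. (q * e z) ^ n) \<le> (\<Sum>n<N. norm q ^ n)"
        by (rule order.trans[OF norm_sum]) (simp add: norm_power nq)
      also have "\<dots> \<le> 1 / (1 - norm q)"
        using q sum_le_suminf[OF summable_geometric[of "norm q"], of "{..<N}"] suminf_geometric[of "norm q"] by auto
      also have "\<dots> \<le> 2 / (1 - norm q)" using q by (intro divide_right_mono) auto
      finally show "norm (f z * (\<Sum>n<N. (q * e z) ^ n)) \<le> norm (f z) * (2 / (1 - norm q))"
        by (simp only: norm_mult) (rule mult_left_mono, auto)
    qed
  qed
  also have "(\<lambda>N. \<integral>z. f z * (\<Sum>n<N. (q * e z) ^ n) \<partial>\<mu>) =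
      (\<lambda>N. \<Sum>n<N. q ^ n * (\<integral>z. f z * e z ^ n \<partial>\<mu>))"
  proof
    fix N
    have "(\<integral>z. f z * (\<Sum>n<N. (q * e z) ^ n) \<partial>\<mu>) = (\<integral>z. (\<Sum>n<N. f z * (q * e z) ^ n) \<partial>\<mu>)"
      by (simp add: sum_distrib_left)
    also have "\<dots> = (\<Sum>n<N. \<integral>z. f z * (q * e z) ^ n \<partial>\<mu>)"
      by (rule Bochner_Integration.integral_sum) (rule int)
    also have "\<dots> = (\<Sum>n<N. q ^ n * (\<integral>z. f z * e z ^ n \<partial>\<mu>))"
      by (simp add: power_mult_distrib mult.left_commute[of _ "q ^ _"])
    finally show "(\<integral>z. f z * (\<Sum>n<N. (q * e z) ^ n) \<partial>\<mu>) = (\<Sum>n<N. q ^ n * (\<integral>z. f z * e z ^ n \<partial>\<mu>))" .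
  qed
  finally show ?thesis by (simp add: sums_def)
qed

text \<open>Only the constant term of the geometric series survives integration; conjugation gives
  the second kernel.\<close>

lemma integral_cauchy_kernel:
  assumes q: "norm q < 1"
  shows "(\<integral>z. 1 / (1 - q * z) \<partial>\<mu>) = 1" "(\<integral>z. 1 / (1 - q * cnj z) \<partial>\<mu>) = 1"
proof -
  have "(\<lambda>n. q ^ n * (\<integral>z. 1 * z ^ n \<partial>\<mu>)) sums (\<integral>z. 1 / (1 - q * z) \<partial>\<mu>)" if "norm q < 1" for q
    by (rule integral_geometric) (use that in \<open>auto intro!: continuous_intros\<close>)
  moreover have "q ^ n * (\<integral>z. 1 * z ^ n \<partial>\<mu>) = (if n = 0 then 1 else 0)" for n q
    using integral_circle_power[of n] circle.prob_space by simp
  ultimately have *: "(\<integral>z. 1 / (1 - q * z) \<partial>\<mu>) = 1" if "norm q < 1" for q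
    using that sums_unique2[OF _ sums_single[of 0 "\<lambda>_. 1::complex"]] by fastforce
  show "(\<integral>z. 1 / (1 - q * z) \<partial>\<mu>) = 1" using * q .
  have "(\<integral>z. 1 / (1 - q * cnj z) \<partial>\<mu>) = cnj (\<integral>z. 1 / (1 - cnj q * z) \<partial>\<mu>)"
    by (simp flip: Bochner_Integration.integral_cnj)
  then show "(\<integral>z. 1 / (1 - q * cnj z) \<partial>\<mu>) = 1" using *[of "cnj q"] q by simp
qed

section \<open>The Poisson kernel\<close>

lemma emeasure_circle_borel [simp]: "emeasure circle_borel (sphere 0 1) = 1"
  using circle_borel.emeasure_space_1 by simp

lemma borel_measurable_cnj [measurable]: "cnj \<in> borel_measurable borel"
  by (intro borel_measurable_continuous_onI continuous_intros)

text \<open>The argument is the quotient \<open>s = t * cnj y\<close> of the point of evaluation and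
  the point of integration, so that every kernel below is a function of one point of the
  circle.\<close>

definition poisson :: "real \<Rightarrow> complex \<Rightarrow> real" where
  "poisson r s = (1 - r\<^sup>2) / (cmod (1 - of_real r * s))\<^sup>2"

lemma poisson_measurable [measurable]: "poisson r \<in> borel_measurable borel"
  unfolding poisson_def[abs_def] by measurable

context
  fixes r :: real
  assumes r: "0 \<le> r" "r < 1"
begin

lemma poisson_nonneg: "0 \<le> poisson r s"
  using r by (auto simp: poisson_def power_le_one)

lemma norm_radius: "norm (s::complex) = 1 \<Longrightarrow> norm (of_real r * s) < 1"
  using r by (simp add: norm_mult)

lemma cauchy_denominator: "norm (s::complex) = 1 \<Longrightarrow> 1 - r \<le> norm (1 - of_real r * s)"
  using one_minus_nonzero(2)[OF norm_radius[of s]] r by (simp add: norm_mult)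

text \<open>Splits the kernel into its analytic and its coanalytic part; the constant belongs to
  both and is subtracted once. This is the link between Poisson and Cauchy integrals.\<close>

lemma poisson_cauchy:
  assumes s: "norm s = 1"
  shows "of_real (poisson r s) = 1 / (1 - of_real r * s) + 1 / (1 - of_real r * cnj s) - 1"
proof -
  have ss: "s * cnj s = 1" using s by (simp add: complex_norm_square[symmetric])
  have ne: "1 - of_real r * s \<noteq> 0" "1 - of_real r * cnj s \<noteq> 0"
    using one_minus_nonzero(1)[OF norm_radius[OF s]] one_minus_nonzero(1)[OF norm_radius[of "cnj s"]] s by auto
  have frac: "(B + A - A * B) / (A * B) = 1 / A + 1 / B - 1" if "A \<noteq> 0" "B \<noteq> 0" for A B :: complex
    using that by (simp add: field_simps)
  have "of_real ((cmod (1 - of_real r * s))\<^sup>2) = (1 - of_real r * s) * (1 - of_real r * cnj s)"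
    by (simp only: complex_norm_square) simp
  then have "of_real (poisson r s) = (1 - of_real r ^ 2) / ((1 - of_real r * s) * (1 - of_real r * cnj s))"
    by (simp add: poisson_def)
  also have "1 - of_real r ^ 2 = (1 - of_real r * cnj s) + (1 - of_real r * s) - (1 - of_real r * s) * (1 - of_real r * cnj s)"
    using ss by (simp add: algebra_simps power2_eq_square)
  also have "\<dots> / ((1 - of_real r * s) * (1 - of_real r * cnj s)) = 1 / (1 - of_real r * s) + 1 / (1 - of_real r * cnj s) - 1"
    using frac[OF ne] .
  finally show ?thesis .
qed

lemma poisson_Re:
  assumes s: "norm s = 1"
  shows "poisson r s = 2 * Re (1 / (1 - of_real r * s)) - 1"
proof -
  have "1 / (1 - of_real r * cnj s) = cnj (1 / (1 - of_real r * s))" by simp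
  from arg_cong[OF this, of Re]
  have "Re (1 / (1 - of_real r * cnj s)) = Re (1 / (1 - of_real r * s))" by (simp only: complex_cnj cnj.simps)
  then show ?thesis
    using arg_cong[OF poisson_cauchy[OF s], of Re] by (simp only: plus_complex.simps minus_complex.simps Re_complex_of_real one_complex.simps)
qed

lemma poisson_le: "norm s = 1 \<Longrightarrow> poisson r s \<le> (1 - r\<^sup>2) / (1 - r)\<^sup>2"
  unfolding poisson_def using cauchy_denominator[of s] r
  by (intro divide_left_mono power_mono mult_pos_pos) (auto simp: power_le_one)

lemma continuous_poisson:
  assumes t: "norm t = 1"
  shows "continuous_on (sphere 0 1) (\<lambda>y. poisson r (t * cnj y))"
proof -
  have ne: "(cmod (1 - of_real r * (t * cnj z)))\<^sup>2 \<noteq> 0" if "z \<in> sphere 0 1" for z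
  proof -
    have "1 - r \<le> norm (1 - of_real r * (t * cnj z))"
      using that t by (intro cauchy_denominator) (simp add: norm_mult)
    then have "cmod (1 - of_real r * (t * cnj z)) \<noteq> 0" using r by linarith
    then show ?thesis by (rule power_not_zero)
  qed
  show ?thesis
    unfolding poisson_def by (intro continuous_intros ballI ne)
qed

lemma integrable_poisson:
  assumes t: "norm t = 1"
  shows "integrable \<mu> (\<lambda>y. poisson r (t * cnj y))"
  using t continuous_imp_circle[OF continuous_poisson[OF t]] poisson_nonneg
  by (intro circle.integrable_const_bound[where B="(1 - r\<^sup>2) / (1 - r)\<^sup>2"] AE_I2)
     (auto intro!: poisson_le simp: norm_mult)

lemma integral_poisson:
  assumes t: "norm t = 1"
  shows "(\<integral>y. poisson r (t * cnj y) \<partial>\<mu>) = 1"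
proof -
  have c: "continuous_on (sphere 0 1) (\<lambda>z. 1 / (1 - of_real r * (t * cnj z)))"
    using one_minus_nonzero(1)[OF norm_radius[of "t * cnj z" for z]] t
    by (intro continuous_intros) (auto simp: norm_mult)
  have i: "integrable \<mu> (\<lambda>z. 1 / (1 - of_real r * (t * cnj z)))"
    using integrable_mult_continuous[OF _ c, of "\<lambda>_. 1"] by simp
  have "(\<integral>y. poisson r (t * cnj y) \<partial>\<mu>) =
      (\<integral>y. 2 * Re (1 / (1 - of_real r * (t * cnj y))) - 1 \<partial>\<mu>)"
    using t by (intro Bochner_Integration.integral_cong refl poisson_Re) (simp add: norm_mult)
  also have "\<dots> = 2 * Re (\<integral>y. 1 / (1 - of_real r * (t * cnj y)) \<partial>\<mu>) - 1"
    using i integrable_Re[OF i] circle.prob_space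
    by (subst Bochner_Integration.integral_diff) (auto simp del: Re_divide_numeral)
  also have "(\<integral>y. 1 / (1 - of_real r * (t * cnj y)) \<partial>\<mu>) = 1"
    using integral_cauchy_kernel(2)[of "of_real r * t"] norm_radius[OF t] by (simp add: mult.assoc)
  finally show ?thesis by simp
qed

lemma nn_integral_poisson:
  assumes t: "norm t = 1"
  shows "(\<integral>\<^sup>+y. poisson r (t * cnj y) \<partial>circle_borel) = 1"
  using nn_integral_eq_integral[OF integrable_poisson[OF t] AE_I2[OF poisson_nonneg]]
  by (simp add: integral_poisson[OF t] nn_integral_circle)

lemma poisson_commute:
  "norm t = 1 \<Longrightarrow> norm z = 1 \<Longrightarrow> poisson r (t * cnj z) = poisson r (z * cnj t)"
proof -
  assume "norm t = 1" "norm z = 1"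
  have "cmod (1 - of_real r * (t * cnj z)) = cmod (cnj (1 - of_real r * (t * cnj z)))"
    by (simp only: complex_mod_cnj)
  then show ?thesis by (simp add: poisson_def mult.commute)
qed

text \<open>With \<open>d = sqrt (1 - r\<^sup>2)\<close> one has
  \<open>cmod (1 - s) \<le> d + (cmod (1 - s))\<^sup>2 / d\<close>, and \<open>cmod (1 - s)\<close>
  is at most twice the modulus in the denominator of the kernel. Integrated over the circle, the
  bound is \<open>5 * d\<close>, so the kernel concentrates at \<open>1\<close> as \<open>r\<close>
  tends to \<open>1\<close>.\<close>

lemma poisson_moment:
  assumes s: "norm s = 1"
  shows "poisson r s * cmod (1 - s) \<le> poisson r s * sqrt (1 - r\<^sup>2) + 4 * sqrt (1 - r\<^sup>2)"
proof -
  define d where "d = sqrt (1 - r\<^sup>2)"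
  have d: "d > 0" "d\<^sup>2 = 1 - r\<^sup>2"
    using r by (auto simp: d_def power_less_one_iff power_le_one)
  have D: "norm (1 - of_real r * s) > 0" using cauchy_denominator[OF s] r by linarith
  have "norm (1 - s) \<le> norm (1 - of_real r * s) + norm (of_real (1 - r) * s)"
    by (rule order.trans[OF _ norm_triangle_ineq4]) (simp add: algebra_simps norm_minus_commute)
  also have "norm (of_real (1 - r) * s) \<le> norm (1 - of_real r * s)"
    using cauchy_denominator[OF s] s r by (simp only: norm_mult norm_of_real) simp
  finally have "norm (1 - s) \<le> 2 * norm (1 - of_real r * s)" by simp
  then have "(norm (1 - s))\<^sup>2 \<le> (2 * norm (1 - of_real r * s))\<^sup>2" by (intro power_mono) auto
  then have "poisson r s * (norm (1 - s))\<^sup>2 \<le> poisson r s * (2 * norm (1 - of_real r * s))\<^sup>2"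
    by (intro mult_left_mono poisson_nonneg)
  also have "\<dots> = 4 * d\<^sup>2"
    using D d by (simp add: poisson_def power_mult_distrib)
  finally have *: "poisson r s * (norm (1 - s))\<^sup>2 / d \<le> 4 * d"
    using d(1) by (simp add: divide_le_eq power2_eq_square mult.assoc)
  have "norm (1 - s) * d \<le> d\<^sup>2 + (norm (1 - s))\<^sup>2"
    using sum_squares_bound[of "norm (1 - s)" d] mult_nonneg_nonneg[OF norm_ge_zero[of "1 - s"] less_imp_le[OF d(1)]]
    by linarith
  then have "norm (1 - s) \<le> d + (norm (1 - s))\<^sup>2 / d"
    using d(1) by (simp add: field_simps power2_eq_square)
  then have "poisson r s * norm (1 - s) \<le> poisson r s * (d + (norm (1 - s))\<^sup>2 / d)"
    by (intro mult_left_mono poisson_nonneg)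
  also have "\<dots> \<le> poisson r s * d + 4 * d" using * by (simp add: algebra_simps)
  finally show ?thesis by (simp add: d_def)
qed

text \<open>With truncation radius \<open>1 - r\<close>, the difference of the truncated singular kernel and the
  Cauchy kernel at radius \<open>r\<close> is of the size of the Poisson kernel.\<close>

lemma truncated_kernel_bound:
  assumes s: "norm s = 1"
  shows "norm (indicator {s. cmod (1 - s) > 1 - r} s / (1 - s) - 1 / (1 - of_real r * s)) \<le> 8 * poisson r s"
proof -
  define e where "e = 1 - r"
  define D where "D = norm (1 - of_real r * s)"
  have e: "e > 0" and De: "e \<le> D" and D: "D > 0" using r cauchy_denominator[OF s] by (auto simp: e_def D_def)
  \<comment> \<open>The numerator \<open>1 - r\<^sup>2\<close> is at least \<open>e\<close>. Both
    cases below come down to \<open>2 * e / D\<^sup>2\<close>: far from \<open>1\<close> because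
    \<open>cmod (1 - s)\<close> exceeds \<open>D / 2\<close>, near \<open>1\<close> because
    \<open>D \<le> 2 * e\<close>. The constant \<open>8\<close> leaves room.\<close>
  have "e / D\<^sup>2 \<le> poisson r s"
    unfolding poisson_def D_def[symmetric] using r
    by (intro divide_right_mono) (auto simp: e_def power2_eq_square mult_left_le)
  then have p: "8 * e / D\<^sup>2 \<le> 8 * poisson r s" by linarith
  have eq: "1 - of_real r * s = (1 - s) + of_real e * s" by (simp add: e_def algebra_simps)
  have D2: "D \<le> norm (1 - s) + e"
    unfolding D_def eq using s e by (intro order.trans[OF norm_triangle_ineq]) (simp add: norm_mult)
  show ?thesis
  proof (cases "cmod (1 - s) > e")
    case True
    then have ne: "1 - s \<noteq> 0" using e by auto
    have neD: "1 - of_real r * s \<noteq> 0" using D by (auto simp: D_def)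
    have "1 / (1 - s) - 1 / (1 - of_real r * s) = of_real e * s / ((1 - s) * (1 - of_real r * s))"
      using ne neD by (simp add: divide_simps) (simp add: e_def algebra_simps)
    then have "norm (1 / (1 - s) - 1 / (1 - of_real r * s)) = e / (norm (1 - s) * D)"
      using s e by (simp add: norm_divide norm_mult D_def)
    also have "\<dots> \<le> e / ((D / 2) * D)"
      using D2 True e D by (intro divide_left_mono mult_right_mono mult_pos_pos) auto
    also have "\<dots> \<le> 8 * e / D\<^sup>2" using e D by (simp add: power2_eq_square divide_simps)
    finally show ?thesis using True p by (simp add: e_def)
  next
    case False
    then have "D \<le> 2 * e" using D2 by simp
    have "norm (1 / (1 - of_real r * s)) = 1 / D" by (simp add: norm_divide D_def)
    also have "\<dots> = D / D\<^sup>2" using D by (simp add: power2_eq_square)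
    also have "\<dots> \<le> 8 * e / D\<^sup>2" using \<open>D \<le> 2 * e\<close> e by (intro divide_right_mono) auto
    finally show ?thesis using False p by (simp add: e_def)
  qed
qed

text \<open>On the arc of radius \<open>1 - r\<close> the denominator of the kernel is at most
  \<open>(2 * (1 - r))\<^sup>2\<close>. As the kernel has integral one, this bounds the measure of
  the arc.\<close>

lemma poisson_lower:
  assumes s: "norm s = 1" and "cmod (1 - s) \<le> 1 - r"
  shows "1 / (4 * (1 - r)) \<le> poisson r s"
proof -
  define e where "e = 1 - r"
  define D where "D = norm (1 - of_real r * s)"
  have e: "e > 0" and De: "e \<le> D" and D: "D > 0" using r cauchy_denominator[OF s] by (auto simp: e_def D_def)
  have eq: "1 - of_real r * s = (1 - s) + of_real e * s" by (simp add: e_def algebra_simps)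
  have "D \<le> norm (1 - s) + e"
    unfolding D_def eq using s e by (intro order.trans[OF norm_triangle_ineq]) (simp add: norm_mult)
  then have "D \<le> 2 * e" using assms(2) by (simp add: e_def)
  have "1 / (4 * e) = e / (2 * e)\<^sup>2" using e by (simp add: power2_eq_square)
  also have "\<dots> \<le> e / D\<^sup>2"
    using \<open>D \<le> 2 * e\<close> D e by (intro divide_left_mono power_mono) auto
  also have "e / D\<^sup>2 \<le> poisson r s"
    unfolding poisson_def D_def[symmetric] using r
    by (intro divide_right_mono) (auto simp: e_def power2_eq_square mult_left_le)
  finally show ?thesis by (simp add: e_def)
qed

end


section \<open>Convergence in L1 of Poisson averages of the oscillation\<close>

text \<open>A Lebesgue point condition with Poisson averages. The modulus stands inside the
  integral, so the quantity controls every kernel dominated by the Poisson kernel, in particular the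
  difference of the truncated kernel and the Cauchy kernel.\<close>

definition poisson_osc :: "real \<Rightarrow> (complex \<Rightarrow> complex) \<Rightarrow> complex \<Rightarrow> ennreal" where
  "poisson_osc r f t = (\<integral>\<^sup>+y. poisson r (t * cnj y) * norm (f y - f t) \<partial>circle_borel)"

definition radius :: "nat \<Rightarrow> real" where
  "radius j = 1 - 1 / (real j + 2)"

lemma radius: "0 \<le> radius j" "radius j < 1"
  by (auto simp: radius_def)

lemma radius_tendsto: "radius \<longlonglongrightarrow> 1"
  unfolding radius_def by real_asymp

lemma poisson_pair_measurable [measurable]:
  "(\<lambda>p. poisson r (fst p * cnj (snd p))) \<in> borel_measurable (circle_borel \<Otimes>\<^sub>M circle_borel)"
  "(\<lambda>p. poisson r (snd p * cnj (fst p))) \<in> borel_measurable (circle_borel \<Otimes>\<^sub>M circle_borel)"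
proof -
  have "(\<lambda>p. fst p * cnj (snd p)) \<in> borel_measurable (circle_borel \<Otimes>\<^sub>M circle_borel)"
    "(\<lambda>p. snd p * cnj (fst p)) \<in> borel_measurable (circle_borel \<Otimes>\<^sub>M circle_borel)"
    by (intro borel_measurable_times measurable_compose[OF circle_borel_ident(2) borel_measurable_cnj]
        measurable_compose[OF circle_borel_ident(3) borel_measurable_cnj] circle_borel_ident)+
  from this[THEN measurable_compose, OF poisson_measurable]
  show "(\<lambda>p. poisson r (fst p * cnj (snd p))) \<in> borel_measurable (circle_borel \<Otimes>\<^sub>M circle_borel)"
    "(\<lambda>p. poisson r (snd p * cnj (fst p))) \<in> borel_measurable (circle_borel \<Otimes>\<^sub>M circle_borel)" .
qed

lemma poisson_rotated_measurable [measurable]: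
  "(\<lambda>y. poisson r (t * cnj y)) \<in> borel_measurable circle_borel"
  "(\<lambda>y. poisson r (y * cnj t)) \<in> borel_measurable circle_borel"
  by (intro borel_imp_circle_borel; measurable)+

lemma measurable_pair_circle:
  "f \<in> borel_measurable circle_borel \<Longrightarrow> (\<lambda>p. f (fst p)) \<in> borel_measurable (circle_borel \<Otimes>\<^sub>M circle_borel)"
  "f \<in> borel_measurable circle_borel \<Longrightarrow> (\<lambda>p. f (snd p)) \<in> borel_measurable (circle_borel \<Otimes>\<^sub>M circle_borel)"
  by (rule measurable_compose[OF measurable_fst], assumption, rule measurable_compose[OF measurable_snd], assumption)

interpretation circle_pair: pair_sigma_finite circle_borel circle_borel
  by unfold_locales

lemma poisson_osc_measurable [measurable]:
  assumes [measurable]: "f \<in> borel_measurable circle_borel"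
  shows "poisson_osc r f \<in> borel_measurable circle_borel"
proof -
  note [measurable] = measurable_pair_circle[OF assms]
  have "(\<lambda>p. ennreal (poisson r (fst p * cnj (snd p)) * norm (f (snd p) - f (fst p)))) \<in> borel_measurable (circle_borel \<Otimes>\<^sub>M circle_borel)"
    by measurable
  then show ?thesis
    unfolding poisson_osc_def[abs_def]
    by (intro circle_borel.borel_measurable_nn_integral) (simp add: case_prod_beta')
qed

text \<open>Tonelli; the kernel is symmetric in its two points and has integral one in
  either.\<close>

lemma nn_integral_poisson_convolution:
  assumes r: "0 \<le> r" "r < 1" and [measurable]: "h \<in> borel_measurable circle_borel"
  shows "(\<integral>\<^sup>+t. (\<integral>\<^sup>+y. ennreal (poisson r (t * cnj y)) * h y \<partial>circle_borel) \<partial>circle_borel) =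
    (\<integral>\<^sup>+y. h y \<partial>circle_borel)"
proof -
  have "(\<integral>\<^sup>+t. (\<integral>\<^sup>+y. ennreal (poisson r (t * cnj y)) * h y \<partial>circle_borel) \<partial>circle_borel) =
    (\<integral>\<^sup>+y. (\<integral>\<^sup>+t. ennreal (poisson r (t * cnj y)) * h y \<partial>circle_borel) \<partial>circle_borel)"
  proof (rule circle_pair.Fubini')
    note [measurable] = measurable_pair_circle[OF assms(3)]
    have "(\<lambda>p. ennreal (poisson r (snd p * cnj (fst p))) * h (fst p)) \<in> borel_measurable (circle_borel \<Otimes>\<^sub>M circle_borel)"
      by measurable
    then show "(\<lambda>(y, t). ennreal (poisson r (t * cnj y)) * h y) \<in> borel_measurable (circle_borel \<Otimes>\<^sub>M circle_borel)"
      by (simp add: case_prod_beta')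
  qed
  also have "\<dots> = (\<integral>\<^sup>+y. h y \<partial>circle_borel)"
  proof (rule nn_integral_cong)
    fix y assume y: "y \<in> space circle_borel"
    have "(\<integral>\<^sup>+t. ennreal (poisson r (t * cnj y)) * h y \<partial>circle_borel) =
       (\<integral>\<^sup>+t. ennreal (poisson r (y * cnj t)) * h y \<partial>circle_borel)"
      using y by (intro nn_integral_cong) (simp add: poisson_commute[OF r])
    also have "\<dots> = (\<integral>\<^sup>+t. ennreal (poisson r (y * cnj t)) \<partial>circle_borel) * h y"
      by (rule nn_integral_multc) measurable
    finally show "(\<integral>\<^sup>+t. ennreal (poisson r (t * cnj y)) * h y \<partial>circle_borel) = h y"
      using y nn_integral_poisson[OF r] by simp
  qed
  finally show ?thesis .
qed

lemma poisson_convolution_measurable [measurable]: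
  assumes "h \<in> borel_measurable circle_borel"
  shows "(\<lambda>t. \<integral>\<^sup>+y. ennreal (poisson r (t * cnj y)) * h y \<partial>circle_borel) \<in> borel_measurable circle_borel"
proof -
  note [measurable] = measurable_pair_circle[OF assms]
  have "(\<lambda>p. ennreal (poisson r (fst p * cnj (snd p))) * h (snd p)) \<in> borel_measurable (circle_borel \<Otimes>\<^sub>M circle_borel)"
    by measurable
  then show ?thesis
    by (intro circle_borel.borel_measurable_nn_integral) (simp add: case_prod_beta')
qed

text \<open>The error \<open>f - g\<close> enters once at \<open>y\<close>, where Poisson averaging
  preserves its L1 norm, and once at \<open>t\<close>, where the kernel integrates to one; hence the
  factor \<open>2\<close>.\<close>

lemma nn_integral_poisson_osc_triangle:
  assumes r: "0 \<le> r" "r < 1"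
    and [measurable]: "f \<in> borel_measurable circle_borel" "g \<in> borel_measurable circle_borel"
  shows "(\<integral>\<^sup>+t. poisson_osc r f t \<partial>circle_borel) \<le>
    (\<integral>\<^sup>+t. poisson_osc r g t \<partial>circle_borel) + 2 * (\<integral>\<^sup>+t. norm (f t - g t) \<partial>circle_borel)"
proof -
  let ?h = "\<lambda>t. ennreal (norm (f t - g t))"
  have "(\<integral>\<^sup>+t. poisson_osc r f t \<partial>circle_borel) \<le> (\<integral>\<^sup>+t. poisson_osc r g t +
      ((\<integral>\<^sup>+y. ennreal (poisson r (t * cnj y)) * ?h y \<partial>circle_borel) + ?h t) \<partial>circle_borel)"
  proof (rule nn_integral_mono)
    fix t assume t: "t \<in> space circle_borel"
    have "poisson_osc r f t \<le> (\<integral>\<^sup>+y. ennreal (poisson r (t * cnj y) * norm (g y - g t)) +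
        (ennreal (poisson r (t * cnj y)) * ?h y + ennreal (poisson r (t * cnj y)) * ?h t) \<partial>circle_borel)"
      unfolding poisson_osc_def
    proof (rule nn_integral_mono)
      fix y
      have "norm (f y - f t) \<le> norm (g y - g t) + norm (f y - g y) + norm (f t - g t)"
        using norm_triangle_ineq4[of "(g y - g t) + (f y - g y)" "f t - g t"] norm_triangle_ineq[of "g y - g t" "f y - g y"]
        by (simp add: algebra_simps)
      then have "poisson r (t * cnj y) * norm (f y - f t) \<le>
         poisson r (t * cnj y) * norm (g y - g t) + (poisson r (t * cnj y) * norm (f y - g y) + poisson r (t * cnj y) * norm (f t - g t))"
        using mult_left_mono[OF _ poisson_nonneg[OF r, of "t * cnj y"]] by (fastforce simp: algebra_simps)
      then show "ennreal (poisson r (t * cnj y) * norm (f y - f t)) \<le> ennreal (poisson r (t * cnj y) * norm (g y - g t)) +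
        (ennreal (poisson r (t * cnj y)) * ?h y + ennreal (poisson r (t * cnj y)) * ?h t)"
        using poisson_nonneg[OF r, of "t * cnj y"]
        by (simp add: ennreal_mult[symmetric] ennreal_plus[symmetric] del: ennreal_plus)
    qed
    also have "\<dots> = poisson_osc r g t + ((\<integral>\<^sup>+y. ennreal (poisson r (t * cnj y)) * ?h y \<partial>circle_borel) +
        (\<integral>\<^sup>+y. ennreal (poisson r (t * cnj y)) \<partial>circle_borel) * ?h t)"
      unfolding poisson_osc_def by (simp add: nn_integral_add nn_integral_multc)
    finally show "poisson_osc r f t \<le> poisson_osc r g t +
      ((\<integral>\<^sup>+y. ennreal (poisson r (t * cnj y)) * ?h y \<partial>circle_borel) + ?h t)"
      using t nn_integral_poisson[OF r] by simp
  qed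
  also have "\<dots> = (\<integral>\<^sup>+t. poisson_osc r g t \<partial>circle_borel) +
      ((\<integral>\<^sup>+t. (\<integral>\<^sup>+y. ennreal (poisson r (t * cnj y)) * ?h y \<partial>circle_borel) \<partial>circle_borel) + (\<integral>\<^sup>+t. ?h t \<partial>circle_borel))"
    by (simp add: nn_integral_add)
  also have "\<dots> = (\<integral>\<^sup>+t. poisson_osc r g t \<partial>circle_borel) + 2 * (\<integral>\<^sup>+t. norm (f t - g t) \<partial>circle_borel)"
    by (subst nn_integral_poisson_convolution[OF r]) (auto simp: mult_2)
  finally show ?thesis .
qed

lemma ennreal_tendsto_zeroI:
  assumes "\<And>e::real. e > 0 \<Longrightarrow> \<forall>\<^sub>F n in F. x n \<le> ennreal e"
  shows "(x \<longlongrightarrow> (0::ennreal)) F"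
proof (rule order_tendstoI)
  fix a :: ennreal assume "0 < a"
  then obtain b where b: "0 < b" "b < a" using dense by blast
  then obtain e where e: "b = ennreal e" "e > 0"
    by (cases b rule: ennreal_cases) auto
  show "\<forall>\<^sub>F n in F. x n < a"
    using assms[OF e(2)] by eventually_elim (use b e in auto)
qed auto

text \<open>The class is linear, closed under limits in L1 and contains the Lipschitz functions;
  from this it is shown to contain all integrable functions.\<close>

definition poisson_limit :: "(complex \<Rightarrow> complex) \<Rightarrow> bool" where
  "poisson_limit f \<longleftrightarrow> f \<in> borel_measurable circle_borel \<and>
     (\<lambda>j. \<integral>\<^sup>+t. poisson_osc (radius j) f t \<partial>circle_borel) \<longlonglongrightarrow> 0"

lemma poisson_limit_close:
  assumes [measurable]: "f \<in> borel_measurable circle_borel"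
    and close: "\<And>e::real. e > 0 \<Longrightarrow> \<exists>g. poisson_limit g \<and> (\<integral>\<^sup>+t. norm (f t - g t) \<partial>circle_borel) \<le> ennreal e"
  shows "poisson_limit f"
  unfolding poisson_limit_def
proof (intro conjI ennreal_tendsto_zeroI)
  fix e :: real assume "e > 0"
  then obtain g where [measurable]: "g \<in> borel_measurable circle_borel"
    and lim: "(\<lambda>j. \<integral>\<^sup>+t. poisson_osc (radius j) g t \<partial>circle_borel) \<longlonglongrightarrow> 0"
    and g: "(\<integral>\<^sup>+t. norm (f t - g t) \<partial>circle_borel) \<le> ennreal (e / 4)"
    using close[of "e / 4"] by (auto simp: poisson_limit_def)
  have "\<forall>\<^sub>F j in sequentially. (\<integral>\<^sup>+t. poisson_osc (radius j) g t \<partial>circle_borel) < ennreal (e / 2)"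
    using order_tendstoD(2)[OF lim] \<open>e > 0\<close> by simp
  then show "\<forall>\<^sub>F j in sequentially. (\<integral>\<^sup>+t. poisson_osc (radius j) f t \<partial>circle_borel) \<le> ennreal e"
  proof eventually_elim
    case (elim j)
    have "(\<integral>\<^sup>+t. poisson_osc (radius j) f t \<partial>circle_borel) \<le> ennreal (e / 2) + 2 * ennreal (e / 4)"
      using nn_integral_poisson_osc_triangle[OF radius, of f g j] elim g
      by (meson add_mono dual_order.trans less_imp_le mult_left_mono zero_le \<open>f \<in> borel_measurable circle_borel\<close> \<open>g \<in> borel_measurable circle_borel\<close>)
    also have "\<dots> = ennreal (e / 2) + ennreal 2 * ennreal (e / 4)" by simp
    also have "\<dots> = ennreal e"
      using \<open>e > 0\<close> by (simp only: ennreal_mult[symmetric] ennreal_plus[symmetric]) simp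
    finally show ?case .
  qed
qed measurable

lemma poisson_limit_sequence:
  assumes s: "\<And>n. poisson_limit (s n)" and [measurable]: "f \<in> borel_measurable circle_borel"
    and lim: "\<And>z. z \<in> sphere 0 1 \<Longrightarrow> (\<lambda>n. s n z) \<longlonglongrightarrow> f z"
    and bound: "\<And>n z. z \<in> sphere 0 1 \<Longrightarrow> norm (s n z) \<le> w z"
    and w: "w \<in> borel_measurable circle_borel" "(\<integral>\<^sup>+z. ennreal (w z) \<partial>circle_borel) < \<infinity>"
  shows "poisson_limit f"
proof (rule poisson_limit_close)
  have [measurable]: "s n \<in> borel_measurable circle_borel" for n
    using s[of n] by (simp add: poisson_limit_def)
  have "(\<lambda>n. \<integral>\<^sup>+z. norm (f z - s n z) \<partial>circle_borel) \<longlonglongrightarrow> 0"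
    by (rule nn_integral_dominated_convergence_norm[where w=w]) (use w lim bound in auto)
  note lim = order_tendstoD(2)[OF this]
  show "\<exists>g. poisson_limit g \<and> (\<integral>\<^sup>+t. norm (f t - g t) \<partial>circle_borel) \<le> ennreal e" if "e > 0" for e
  proof -
    have "0 < ennreal e" using that by simp
    from eventually_happens'[OF _ lim[OF this]]
    obtain n where "(\<integral>\<^sup>+z. norm (f z - s n z) \<partial>circle_borel) < ennreal e" by auto
    then show ?thesis using s[of n] by (blast intro: less_imp_le)
  qed
qed fact

text \<open>By rotation \<open>norm (f y - f t)\<close> is at most \<open>L\<close> times
  \<open>cmod (1 - s)\<close> with \<open>s = t * cnj y\<close>, so \<open>poisson_moment\<close>
  applies uniformly in \<open>t\<close>. The constant \<open>5\<close> is the unit mass of the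
  kernel plus the remainder \<open>4\<close>.\<close>

lemma poisson_limit_lipschitz:
  assumes f: "L-lipschitz_on (sphere 0 1) f"
  shows "poisson_limit f"
  unfolding poisson_limit_def
proof
  show "f \<in> borel_measurable circle_borel"
    using lipschitz_on_continuous_on[OF f] by (rule continuous_imp_circle_borel)
  have L: "L \<ge> 0" using f by (rule lipschitz_on_nonneg)
  have bound: "(\<integral>\<^sup>+t. poisson_osc r f t \<partial>circle_borel) \<le> ennreal (L * (5 * sqrt (1 - r\<^sup>2)))" if r: "0 \<le> r" "r < 1" for r
  proof -
    define d where "d = sqrt (1 - r\<^sup>2)"
    have d: "d \<ge> 0" using r by (auto simp: d_def power_le_one)
    have "poisson_osc r f t \<le> ennreal (L * (5 * d))" if t: "norm t = 1" for t
    proof -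
      have "poisson_osc r f t \<le> (\<integral>\<^sup>+y. ennreal (L * d) * ennreal (poisson r (t * cnj y)) + ennreal (L * (4 * d)) \<partial>circle_borel)"
        unfolding poisson_osc_def
      proof (rule nn_integral_mono)
        fix y assume "y \<in> space circle_borel"
        then have y: "norm y = 1" by simp
        have "norm (y - t) = norm (y - t) * norm (cnj y)" using y by simp
        also have "\<dots> = norm (y * cnj y - t * cnj y)" by (simp only: norm_mult[symmetric] left_diff_distrib)
        also have "y * cnj y = 1" using y by (simp add: complex_norm_square[symmetric])
        finally have "norm (f y - f t) \<le> L * norm (1 - t * cnj y)"
          using lipschitz_onD[OF f, of y t] y t by (simp add: dist_norm)
        then have "poisson r (t * cnj y) * norm (f y - f t) \<le> poisson r (t * cnj y) * (L * norm (1 - t * cnj y))"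
          by (intro mult_left_mono poisson_nonneg[OF r])
        also have "\<dots> = L * (poisson r (t * cnj y) * norm (1 - t * cnj y))" by simp
        also have "\<dots> \<le> L * (poisson r (t * cnj y) * d + 4 * d)"
          unfolding d_def using L t y by (intro mult_left_mono poisson_moment[OF r]) (auto simp: norm_mult)
        finally have "poisson r (t * cnj y) * norm (f y - f t) \<le> L * d * poisson r (t * cnj y) + L * (4 * d)"
          by (simp add: algebra_simps)
        then show "ennreal (poisson r (t * cnj y) * norm (f y - f t)) \<le> ennreal (L * d) * ennreal (poisson r (t * cnj y)) + ennreal (L * (4 * d))"
          using L d poisson_nonneg[OF r, of "t * cnj y"]
          by (simp add: ennreal_mult[symmetric] ennreal_plus[symmetric] del: ennreal_plus)
      qed
      also have "\<dots> = ennreal (L * d) * (\<integral>\<^sup>+y. ennreal (poisson r (t * cnj y)) \<partial>circle_borel) + ennreal (L * (4 * d))"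
        using circle_borel.emeasure_space_1 by (simp add: nn_integral_add nn_integral_cmult)
      also have "\<dots> = ennreal (L * (5 * d))"
        using L d t nn_integral_poisson[OF r t] by (simp add: ennreal_plus[symmetric] algebra_simps del: ennreal_plus)
      finally show ?thesis .
    qed
    then have "(\<integral>\<^sup>+t. poisson_osc r f t \<partial>circle_borel) \<le> (\<integral>\<^sup>+t. ennreal (L * (5 * d)) \<partial>circle_borel)"
      by (intro nn_integral_mono) auto
    then show ?thesis using circle_borel.emeasure_space_1 by (simp add: d_def)
  qed
  have "(\<lambda>j. ennreal (L * (5 * sqrt (1 - (radius j)\<^sup>2)))) \<longlonglongrightarrow> ennreal (L * (5 * sqrt (1 - 1\<^sup>2)))"
    by (intro tendsto_intros radius_tendsto)
  then have "(\<lambda>j. ennreal (L * (5 * sqrt (1 - (radius j)\<^sup>2)))) \<longlonglongrightarrow> 0" by simp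
  then show "(\<lambda>j. \<integral>\<^sup>+t. poisson_osc (radius j) f t \<partial>circle_borel) \<longlonglongrightarrow> 0"
    by (rule tendsto_sandwich[OF _ _ tendsto_const, rotated 2]) (use bound[OF radius] in auto)
qed

lemma poisson_limit_add:
  assumes "poisson_limit f" "poisson_limit g"
  shows "poisson_limit (\<lambda>z. f z + g z)"
proof -
  have [measurable]: "f \<in> borel_measurable circle_borel" "g \<in> borel_measurable circle_borel"
    using assms by (auto simp: poisson_limit_def)
  have bound: "(\<integral>\<^sup>+t. poisson_osc r (\<lambda>z. f z + g z) t \<partial>circle_borel) \<le>
     (\<integral>\<^sup>+t. poisson_osc r f t \<partial>circle_borel) + (\<integral>\<^sup>+t. poisson_osc r g t \<partial>circle_borel)" if r: "0 \<le> r" "r < 1" for r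
  proof -
    have "poisson_osc r (\<lambda>z. f z + g z) t \<le> poisson_osc r f t + poisson_osc r g t" for t
    proof -
      have "poisson_osc r (\<lambda>z. f z + g z) t \<le> (\<integral>\<^sup>+y. ennreal (poisson r (t * cnj y) * norm (f y - f t)) +
          ennreal (poisson r (t * cnj y) * norm (g y - g t)) \<partial>circle_borel)"
        unfolding poisson_osc_def
      proof (rule nn_integral_mono)
        fix y
        have "norm (f y + g y - (f t + g t)) \<le> norm (f y - f t) + norm (g y - g t)"
          using norm_triangle_ineq[of "f y - f t" "g y - g t"] by (simp add: algebra_simps)
        from mult_left_mono[OF this poisson_nonneg[OF r, of "t * cnj y"]]
        show "ennreal (poisson r (t * cnj y) * norm (f y + g y - (f t + g t))) \<le>
          ennreal (poisson r (t * cnj y) * norm (f y - f t)) + ennreal (poisson r (t * cnj y) * norm (g y - g t))"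
          using poisson_nonneg[OF r, of "t * cnj y"]
          by (simp add: ennreal_plus[symmetric] distrib_left del: ennreal_plus)
      qed
      also have "\<dots> = poisson_osc r f t + poisson_osc r g t"
        unfolding poisson_osc_def by (rule nn_integral_add) measurable
      finally show ?thesis .
    qed
    then have "(\<integral>\<^sup>+t. poisson_osc r (\<lambda>z. f z + g z) t \<partial>circle_borel) \<le>
      (\<integral>\<^sup>+t. poisson_osc r f t + poisson_osc r g t \<partial>circle_borel)" by (intro nn_integral_mono)
    then show ?thesis by (subst (asm) nn_integral_add) measurable
  qed
  have "(\<lambda>j. (\<integral>\<^sup>+t. poisson_osc (radius j) f t \<partial>circle_borel) + (\<integral>\<^sup>+t. poisson_osc (radius j) g t \<partial>circle_borel)) \<longlonglongrightarrow> 0 + 0"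
    using assms by (intro tendsto_add) (auto simp: poisson_limit_def)
  note lim = this[unfolded add_0_right]
  have "(\<lambda>j. \<integral>\<^sup>+t. poisson_osc (radius j) (\<lambda>z. f z + g z) t \<partial>circle_borel) \<longlonglongrightarrow> 0"
    by (rule tendsto_sandwich[OF _ _ tendsto_const lim]) (use bound[OF radius] in auto)
  then show ?thesis by (simp add: poisson_limit_def)
qed

lemma poisson_limit_cmult:
  assumes "poisson_limit f"
  shows "poisson_limit (\<lambda>z. c * f z)"
proof -
  have [measurable]: "f \<in> borel_measurable circle_borel"
    using assms by (auto simp: poisson_limit_def)
  have 1: "poisson_osc r (\<lambda>z. c * f z) t = ennreal (norm c) * poisson_osc r f t" for r t
  proof -
    have "poisson_osc r (\<lambda>z. c * f z) t = (\<integral>\<^sup>+y. ennreal (norm c) * ennreal (poisson r (t * cnj y) * norm (f y - f t)) \<partial>circle_borel)"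
      unfolding poisson_osc_def
      by (intro nn_integral_cong) (simp add: right_diff_distrib[symmetric] norm_mult ennreal_mult'[symmetric] mult.left_commute)
    also have "\<dots> = ennreal (norm c) * poisson_osc r f t"
      unfolding poisson_osc_def by (rule nn_integral_cmult) measurable
    finally show ?thesis .
  qed
  have "(\<lambda>j. ennreal (norm c) * (\<integral>\<^sup>+t. poisson_osc (radius j) f t \<partial>circle_borel)) \<longlonglongrightarrow> ennreal (norm c) * 0"
    using assms by (intro ennreal_tendsto_cmult) (auto simp: poisson_limit_def)
  then show ?thesis by (simp add: poisson_limit_def 1 nn_integral_cmult)
qed

lemma poisson_limit_const: "poisson_limit (\<lambda>_. c)"
  by (rule poisson_limit_lipschitz[OF lipschitz_on_constant])

lemma indicator_circle_borel [measurable]: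
  "A \<in> sets borel \<Longrightarrow> (indicator A :: complex \<Rightarrow> 'a::real_normed_algebra_1) \<in> borel_measurable circle_borel"
  by (intro borel_imp_circle_borel borel_measurable_indicator)

text \<open>A Dynkin argument: the closed sets are a generator stable under intersection, and the
  indicator of a nonempty closed set is the limit of Lipschitz functions of the distance to
  it.\<close>

lemma poisson_limit_indicator:
  assumes "A \<in> sets borel"
  shows "poisson_limit (indicator A)"
proof -
  have "sets borel = sigma_sets UNIV {S::complex set. closed S}"
    by (subst borel_eq_closed) (simp add: sets_measure_of)
  then have A: "A \<in> sigma_sets UNIV {S. closed S}" using assms by simp
  have "Int_stable {S::complex set. closed S}" by (auto simp: Int_stable_def)
  moreover have "{S::complex set. closed S} \<subseteq> Pow UNIV" by simp
  ultimately show ?thesis using A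
  proof (induction rule: sigma_sets_induct_disjoint)
    case (basic F)
    then have F: "closed F" by simp
    show ?case
    \<comment> \<open>\<open>infdist\<close> to the empty set is zero by convention, so the
      functions used below would converge to \<open>1\<close> instead of the indicator.\<close>
    proof (cases "F = {}")
      case True then show ?thesis using poisson_limit_const[of 0] by simp
    next
      case False
      have "poisson_limit (\<lambda>z. of_real (max 0 (1 - real n * infdist z F)))" for n
      proof (rule poisson_limit_lipschitz[OF lipschitz_onI])
        fix x y :: complex
        have "\<bar>max 0 (1 - real n * infdist x F) - max 0 (1 - real n * infdist y F)\<bar> \<le> \<bar>real n * infdist x F - real n * infdist y F\<bar>"
          by linarith
        also have "\<dots> = real n * \<bar>infdist x F - infdist y F\<bar>"
          by (simp add: right_diff_distrib[symmetric] abs_mult)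
        also have "\<dots> \<le> real n * dist x y"
          by (intro mult_left_mono) (auto simp: infdist_triangle_abs)
        finally show "dist (complex_of_real (max 0 (1 - real n * infdist x F))) (of_real (max 0 (1 - real n * infdist y F))) \<le> real n * dist x y"
          by (simp only: dist_of_real dist_real_def)
      qed auto
      then show ?thesis
      proof (rule poisson_limit_sequence[where w="\<lambda>_. 1"])
        show "(indicator F :: complex \<Rightarrow> complex) \<in> borel_measurable circle_borel" by (rule indicator_circle_borel[OF borel_closed[OF F]])
        fix z :: complex
        show "(\<lambda>n. complex_of_real (max 0 (1 - real n * infdist z F))) \<longlonglongrightarrow> indicator F z"
        proof (cases "z \<in> F")
          case True then show ?thesis by (simp add: infdist_zero)
        next
          case nz: False
          then have pos: "infdist z F > 0"
            using infdist_pos_not_in_closed[OF F \<open>F \<noteq> {}\<close>] by simp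
          obtain N where N: "1 / infdist z F \<le> real N" using real_arch_simple by blast
          have "complex_of_real (max 0 (1 - real n * infdist z F)) = 0" if "n \<ge> N" for n
          proof -
            have "1 / infdist z F \<le> real n" using N that by linarith
            then show ?thesis using pos by (simp add: field_simps max_def)
          qed
          then have "(\<lambda>n. complex_of_real (max 0 (1 - real n * infdist z F))) \<longlonglongrightarrow> 0"
            by (intro tendsto_eventually) (auto simp: eventually_sequentially)
          then show ?thesis using nz by simp
        qed
        show "norm (complex_of_real (max 0 (1 - real n * infdist z F))) \<le> 1" for n
          using infdist_nonneg[of z F] by (auto simp: max_def)
      qed auto
    qed
  next
    case empty then show ?case using poisson_limit_const[of 0] by simp
  next
    case (compl A)
    have "(\<lambda>z. 1 + (-1) * indicator A z) = (indicator (UNIV - A) :: complex \<Rightarrow> complex)"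
      by (auto simp: indicator_def)
    then show ?case
      using poisson_limit_add[OF poisson_limit_const[of 1] poisson_limit_cmult[OF compl(2), of "-1"]] by simp
  next
    case (union A)
    have A: "A i \<in> sets borel" for i
      using union(2) by (subst borel_eq_closed) (auto simp: sets_measure_of)
    have "poisson_limit (indicator (\<Union>i<n. A i))" for n
    proof (induction n)
      case 0 then show ?case using poisson_limit_const[of 0] by simp
    next
      case (Suc n)
      have "(\<Union>i<n. A i) \<inter> A n = {}"
        using disjoint_family_onD[OF union(1), of _ n] by fastforce
      then have "(\<lambda>z. indicator (\<Union>i<n. A i) z + indicator (A n) z) = (indicator (\<Union>i<Suc n. A i) :: complex \<Rightarrow> complex)"
        by (intro ext) (auto simp: indicator_def lessThan_Suc)
      then show ?case using poisson_limit_add[OF Suc union(3)[of n]] by simp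
    qed
    then show ?case
    proof (rule poisson_limit_sequence[where w="\<lambda>_. 1"])
      show "(indicator (\<Union> (range A)) :: complex \<Rightarrow> complex) \<in> borel_measurable circle_borel" by (rule indicator_circle_borel) (use A in auto)
      show "(\<lambda>n. indicator (\<Union>i<n. A i) z :: complex) \<longlonglongrightarrow> indicator (\<Union> (range A)) z" for z
        by (rule LIMSEQ_indicator_UN)
    qed (auto simp: indicator_def)
  qed
qed

lemma poisson_limit_integrable:
  assumes "integrable circle_borel f"
  shows "poisson_limit f"
  using assms
proof (induction rule: integrable_induct)
  case (base A c)
  obtain B where B: "B \<in> sets borel" "A = sphere 0 1 \<inter> B"
    using base(1) by (auto simp: sets_circle_borel sets_restrict_space)
  have "poisson_limit (\<lambda>z. c * indicator B z)"
    by (intro poisson_limit_cmult poisson_limit_indicator B)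
  then show ?case
  proof (rule poisson_limit_sequence[where w="\<lambda>_. norm c"])
    show "(\<lambda>x. indicator A x *\<^sub>R c) \<in> borel_measurable circle_borel" using base by measurable
    show "(\<lambda>n. c * indicator B z) \<longlonglongrightarrow> indicator A z *\<^sub>R c" if "z \<in> sphere 0 1" for z
      using that B by (auto simp: indicator_def)
    show "norm (c * indicator B z) \<le> norm c" for z by (auto simp: indicator_def)
    show "(\<integral>\<^sup>+z. ennreal (norm c) \<partial>circle_borel) < \<infinity>"
      by simp
  qed auto
next
  case (add f g) then show ?case by (simp add: poisson_limit_add)
next
  case (lim f s)
  show ?case
  proof (rule poisson_limit_sequence[where w="\<lambda>z. 2 * norm (f z)"])
    show "(\<integral>\<^sup>+z. ennreal (2 * norm (f z)) \<partial>circle_borel) < \<infinity>"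
      using integrable_norm[OF lim.hyps(4)] by (simp add: integrable_iff_bounded ennreal_mult nn_integral_cmult ennreal_mult_less_top)
  qed (use lim.IH lim.hyps in auto)
qed

text \<open>Convergence in L1 gives convergence almost everywhere along a subsequence of the radii.
  The subsequence is extracted for real integrable functions, hence the detour through
  \<open>enn2real\<close> and the finiteness of the oscillation almost everywhere.\<close>

lemma poisson_osc_AE:
  assumes f: "f \<in> L_one"
  shows "\<exists>k. strict_mono k \<and> (AE t in \<mu>.
    (\<lambda>j. \<integral>\<^sup>+y. ennreal (poisson (radius (k j)) (t * cnj y) * norm (f y - f t)) \<partial>\<mu>) \<longlonglongrightarrow> 0)"
proof -
  have f': "f \<in> borel_measurable \<mu>" "integrable \<mu> f" using f by (auto simp: L_one_def)
  obtain g where g[measurable]: "g \<in> borel_measurable circle_borel" and ae: "AE z in \<mu>. f z = g z"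
    using circle_borel_representative[OF f'(1)] by blast
  have gm: "g \<in> borel_measurable \<mu>"
    unfolding circle_measure_eq by (rule measurable_completion) fact
  have "integrable \<mu> g"
    by (rule integrable_cong_AE_imp[OF f'(2) gm ae])
  then have ig: "integrable circle_borel g"
    unfolding circle_measure_eq by (simp add: integrable_completion)
  let ?O = "\<lambda>j. \<integral>\<^sup>+t. poisson_osc (radius j) g t \<partial>circle_borel"
  have lim: "?O \<longlonglongrightarrow> 0"
    using poisson_limit_integrable[OF ig] by (simp add: poisson_limit_def)
  \<comment> \<open>Comparison with the zero function shows that the oscillation has a finite
    integral.\<close>
  have "(\<integral>\<^sup>+t. poisson_osc (radius j) (\<lambda>_. 0) t \<partial>circle_borel) = 0" for j
    by (simp add: poisson_osc_def)
  then have "?O j \<le> 2 * (\<integral>\<^sup>+t. norm (g t) \<partial>circle_borel)" for j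
    using nn_integral_poisson_osc_triangle[OF radius g, of "\<lambda>_. 0" j] by simp
  moreover have "2 * (\<integral>\<^sup>+t. norm (g t) \<partial>circle_borel) < \<infinity>"
    using ig by (simp add: integrable_iff_bounded ennreal_mult_less_top)
  ultimately have fin: "?O j < \<infinity>" for j by (metis le_less_trans)
  have finAE: "AE t in circle_borel. poisson_osc (radius j) g t \<noteq> \<infinity>" for j
    by (rule nn_integral_noteq_infinite) (use fin[of j] in auto)
  have eqO: "(\<integral>\<^sup>+t. ennreal (enn2real (poisson_osc (radius j) g t)) \<partial>circle_borel) = ?O j" for j
    by (rule nn_integral_cong_AE) (use finAE[of j] in eventually_elim, simp add: less_top)
  let ?u = "\<lambda>j t. enn2real (poisson_osc (radius j) g t)"
  have iu: "integrable circle_borel (?u j)" for j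
    using fin[of j] eqO[of j] by (intro integrableI_nonneg) auto
  have "(\<integral>t. norm (?u j t) \<partial>circle_borel) = enn2real (?O j)" for j
    using eqO[of j] by (subst integral_eq_nn_integral) auto
  moreover have "(\<lambda>j. enn2real (?O j)) \<longlonglongrightarrow> 0"
    using tendsto_enn2real[of _ 0, OF lim[folded ennreal_0]] by simp
  ultimately obtain k where k: "strict_mono k" "AE t in circle_borel. (\<lambda>j. ?u (k j) t) \<longlonglongrightarrow> 0"
    using tendsto_L1_AE_subseq[of circle_borel ?u, OF iu] by auto
  have all: "AE t in circle_borel. \<forall>j. poisson_osc (radius j) g t \<noteq> \<infinity>"
    using finAE by (simp add: AE_all_countable)
  have "AE t in \<mu>.
    (\<lambda>j. \<integral>\<^sup>+y. ennreal (poisson (radius (k j)) (t * cnj y) * norm (f y - f t)) \<partial>\<mu>) \<longlonglongrightarrow> 0"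
    using k(2)[folded AE_circle_iff] all[folded AE_circle_iff] ae
  proof eventually_elim
    case (elim t)
    have "(\<integral>\<^sup>+y. ennreal (poisson r (t * cnj y) * norm (f y - f t)) \<partial>\<mu>) = poisson_osc r g t" for r
    proof -
      have "(\<integral>\<^sup>+y. ennreal (poisson r (t * cnj y) * norm (f y - f t)) \<partial>\<mu>) =
        (\<integral>\<^sup>+y. ennreal (poisson r (t * cnj y) * norm (g y - g t)) \<partial>\<mu>)"
        by (rule nn_integral_cong_AE) (use ae in eventually_elim, use elim(3) in simp)
      then show ?thesis by (simp add: poisson_osc_def nn_integral_circle)
    qed
    moreover have "(\<lambda>j. ennreal (?u (k j) t)) \<longlonglongrightarrow> ennreal 0"
      by (rule tendsto_ennrealI) (rule elim(1))
    moreover have "ennreal (?u (k j) t) = poisson_osc (radius (k j)) g t" for j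
      using elim(2) by (simp add: less_top)
    ultimately show ?case by simp
  qed
  then show ?thesis using k(1) by blast
qed

section \<open>Principal values\<close>

text \<open>With \<open>s = t * cnj y\<close> the singular kernel \<open>y / (y - t)\<close> is
  \<open>1 / (1 - s)\<close>, and the distance of \<open>y\<close> from \<open>t\<close> is
  \<open>cmod (1 - s)\<close>.\<close>

definition truncated_kernel :: "real \<Rightarrow> complex \<Rightarrow> complex" where
  "truncated_kernel \<epsilon> s = indicator {s. cmod (1 - s) > \<epsilon>} s / (1 - s)"

definition truncated_cauchy :: "real \<Rightarrow> (complex \<Rightarrow> complex) \<Rightarrow> complex \<Rightarrow> complex" where
  "truncated_cauchy \<epsilon> f t = (\<integral>y. f y * truncated_kernel \<epsilon> (t * cnj y) \<partial>\<mu>)"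

definition cauchy_integral :: "real \<Rightarrow> (complex \<Rightarrow> complex) \<Rightarrow> complex \<Rightarrow> complex" where
  "cauchy_integral r f t = (\<integral>y. f y / (1 - of_real r * (t * cnj y)) \<partial>\<mu>)"

definition poisson_integral :: "real \<Rightarrow> (complex \<Rightarrow> complex) \<Rightarrow> complex \<Rightarrow> complex" where
  "poisson_integral r f t = (\<integral>y. f y * of_real (poisson r (t * cnj y)) \<partial>\<mu>)"

text \<open>Normalised by \<open>\<mu>\<close> and freed of the factor of the Cauchy integral:
  \<open>l\<close> is half of \<open>cauchy_singular f t\<close>, and \<open>P f\<close> is
  \<open>f / 2 + l\<close>.\<close>

definition has_pv :: "(complex \<Rightarrow> complex) \<Rightarrow> complex \<Rightarrow> complex \<Rightarrow> bool" where
  "has_pv f t l \<longleftrightarrow> ((\<lambda>\<epsilon>. truncated_cauchy \<epsilon> f t) \<longlongrightarrow> l) (at_right 0)"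

definition pv_exists :: "(complex \<Rightarrow> complex) \<Rightarrow> bool" where
  "pv_exists f \<longleftrightarrow> f \<in> L_one \<and> (AE t in \<mu>. \<exists>l. has_pv f t l)"

lemma L_oneD: "f \<in> L_one \<Longrightarrow> integrable \<mu> f" "f \<in> L_one \<Longrightarrow> f \<in> borel_measurable \<mu>"
  by (auto simp: L_one_def)

lemma truncated_kernel_measurable [measurable]: "truncated_kernel \<epsilon> \<in> borel_measurable borel"
  unfolding truncated_kernel_def[abs_def] by measurable

lemma truncated_kernel_circle: "(\<lambda>y. truncated_kernel \<epsilon> (t * cnj y)) \<in> borel_measurable circle_borel"
  by (intro borel_imp_circle_borel) measurable

lemma norm_truncated_kernel: "\<epsilon> > 0 \<Longrightarrow> norm (truncated_kernel \<epsilon> s) \<le> 1 / \<epsilon>"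
  by (auto simp: truncated_kernel_def norm_divide indicator_def frac_le)

lemma integrable_truncated:
  assumes "f \<in> L_one" "\<epsilon> > 0"
  shows "integrable \<mu> (\<lambda>y. f y * truncated_kernel \<epsilon> (t * cnj y))"
  using assms norm_truncated_kernel[of \<epsilon>] truncated_kernel_circle
  by (intro integrable_mult_bounded[where C="1 / \<epsilon>"]) (auto simp: L_one_def circle_measure_eq intro: measurable_completion)

lemma one_minus_cnj:
  assumes "norm t = 1" "norm y = 1"
  shows "1 - t * cnj y = (y - t) * cnj y" "cmod (1 - t * cnj y) = dist y t"
proof -
  have "y * cnj y = 1" using assms by (simp add: complex_norm_square[symmetric])
  then show *: "1 - t * cnj y = (y - t) * cnj y" by (simp add: algebra_simps)
  show "cmod (1 - t * cnj y) = dist y t"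
    unfolding * using assms by (simp add: norm_mult dist_norm)
qed

text \<open>The factor \<open>2 * pi\<close> comes from the normalisation of \<open>\<mu>\<close>
  and \<open>\<i>\<close> from the differential. It stays under \<open>Lim\<close>, because
  \<open>Lim\<close> of a divergent expression cannot be rescaled.\<close>

lemma cauchy_singular_eq:
  assumes f: "f \<in> L_one" and t: "norm t = 1"
  shows "cauchy_singular f t = 1 / (of_real pi * \<i>) *
    Lim (at_right 0) (\<lambda>\<epsilon>. (2 * pi * \<i>) * truncated_cauchy \<epsilon> f t)"
proof -
  have "set_lebesgue_integral lebesgue {\<theta> \<in> {-pi..pi}. dist (cis \<theta>) t > \<epsilon>}
         (\<lambda>\<theta>. f (cis \<theta>) / (cis \<theta> - t) * (\<i> * cis \<theta>)) = (2 * pi * \<i>) * truncated_cauchy \<epsilon> f t" if e: "\<epsilon> > 0" for \<epsilon>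
  proof -
    have "set_lebesgue_integral lebesgue {\<theta> \<in> {-pi..pi}. dist (cis \<theta>) t > \<epsilon>}
         (\<lambda>\<theta>. f (cis \<theta>) / (cis \<theta> - t) * (\<i> * cis \<theta>)) =
       set_lebesgue_integral lebesgue {-pi..pi} (\<lambda>\<theta>. \<i> * (f (cis \<theta>) * truncated_kernel \<epsilon> (t * cnj (cis \<theta>))))"
      unfolding set_lebesgue_integral_def
    proof (rule Bochner_Integration.integral_cong[OF refl])
      fix \<theta>
      note o = one_minus_cnj[OF t, of "cis \<theta>"]
      have "cis \<theta> * cnj (cis \<theta>) = 1" by (simp add: complex_norm_square[symmetric])
      then have "inverse (cnj (cis \<theta>)) = cis \<theta>" by (metis inverse_unique mult.commute)
      then have "1 / (1 - t * cnj (cis \<theta>)) = cis \<theta> / (cis \<theta> - t)"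
        using o(1) by (simp add: divide_inverse)
      moreover have "truncated_kernel \<epsilon> (t * cnj (cis \<theta>)) =
          (if dist (cis \<theta>) t > \<epsilon> then 1 / (1 - t * cnj (cis \<theta>)) else 0)"
        using o(2) by (simp add: truncated_kernel_def)
      ultimately show "indicator {\<theta> \<in> {- pi..pi}. \<epsilon> < dist (cis \<theta>) t} \<theta> *\<^sub>R (f (cis \<theta>) / (cis \<theta> - t) * (\<i> * cis \<theta>)) =
         indicator {- pi..pi} \<theta> *\<^sub>R (\<i> * (f (cis \<theta>) * truncated_kernel \<epsilon> (t * cnj (cis \<theta>))))"
        by (auto simp: indicator_def)
    qed
    also have "\<dots> = 2 * pi * (\<integral>z. \<i> * (f z * truncated_kernel \<epsilon> (t * cnj z)) \<partial>\<mu>)"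
      by (intro set_integral_circle(2) integrable_mult_right integrable_truncated f e)
    finally show ?thesis by (simp add: truncated_cauchy_def)
  qed
  then have "Lim (at_right 0) (\<lambda>\<epsilon>. set_lebesgue_integral lebesgue {\<theta> \<in> {-pi..pi}. dist (cis \<theta>) t > \<epsilon>}
         (\<lambda>\<theta>. f (cis \<theta>) / (cis \<theta> - t) * (\<i> * cis \<theta>))) = Lim (at_right 0) (\<lambda>\<epsilon>. (2 * pi * \<i>) * truncated_cauchy \<epsilon> f t)"
    by (intro Lim_cong refl) (auto simp: eventually_at_right_less eventually_at_filter)
  then show ?thesis by (simp add: cauchy_singular_def)
qed

lemma cauchy_singular_pv:
  assumes f: "f \<in> L_one" and t: "norm t = 1" and l: "has_pv f t l"
  shows "cauchy_singular f t = 2 * l"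
proof -
  have "((\<lambda>\<epsilon>. (2 * pi * \<i>) * truncated_cauchy \<epsilon> f t) \<longlongrightarrow> (2 * pi * \<i>) * l) (at_right 0)"
    using l unfolding has_pv_def by (rule tendsto_mult_left)
  then have "Lim (at_right 0) (\<lambda>\<epsilon>. (2 * pi * \<i>) * truncated_cauchy \<epsilon> f t) = (2 * pi * \<i>) * l"
    by (rule tendsto_Lim[OF trivial_limit_at_right_real])
  then show ?thesis unfolding cauchy_singular_eq[OF f t] by simp
qed

lemma riesz_pv:
  "f \<in> L_one \<Longrightarrow> norm t = 1 \<Longrightarrow> has_pv f t l \<Longrightarrow> riesz_projection f t = f t / 2 + l"
  by (simp add: riesz_projection_def cauchy_singular_pv)

text \<open>Where the principal value does not exist, \<open>Lim\<close> is the same junk value for all functions.\<close>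

lemma cauchy_singular_no_pv:
  assumes f: "f \<in> L_one" and t: "norm t = 1" and no: "\<nexists>l. has_pv f t l"
  shows "cauchy_singular f t = 1 / (of_real pi * \<i>) * (THE l. False)"
proof -
  have "\<not> ((\<lambda>\<epsilon>. (2 * pi * \<i>) * truncated_cauchy \<epsilon> f t) \<longlongrightarrow> l) (at_right 0)" for l
  proof
    assume "((\<lambda>\<epsilon>. (2 * pi * \<i>) * truncated_cauchy \<epsilon> f t) \<longlongrightarrow> l) (at_right 0)"
    from tendsto_mult_left[OF this, of "1 / (2 * pi * \<i>)"]
    have "has_pv f t (1 / (2 * pi * \<i>) * l)" by (simp add: has_pv_def)
    then show False using no by blast
  qed
  then have "(\<lambda>l. ((\<lambda>\<epsilon>. (2 * pi * \<i>) * truncated_cauchy \<epsilon> f t) \<longlongrightarrow> l) (at_right 0)) = (\<lambda>l. False)" by blast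
  then show ?thesis unfolding cauchy_singular_eq[OF f t] t2_space_class.Lim_def by (simp only:)
qed

lemma has_pv_add:
  assumes "f \<in> L_one" "g \<in> L_one" "has_pv f t l" "has_pv g t l'"
  shows "has_pv (\<lambda>z. f z + g z) t (l + l')"
proof -
  have "\<forall>\<^sub>F \<epsilon> in at_right 0. truncated_cauchy \<epsilon> f t + truncated_cauchy \<epsilon> g t = truncated_cauchy \<epsilon> (\<lambda>z. f z + g z) t"
    unfolding truncated_cauchy_def using assms(1,2)
    by (auto simp: eventually_at_filter distrib_right integrable_truncated)
  then show ?thesis
    using tendsto_add[OF assms(3,4)[unfolded has_pv_def]] unfolding has_pv_def
    by (rule Lim_transform_eventually[rotated])
qed

lemma has_pv_cmult:
  assumes "has_pv f t l" shows "has_pv (\<lambda>z. c * f z) t (c * l)"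
  using tendsto_mult_left[OF assms[unfolded has_pv_def], of c]
  by (simp add: has_pv_def truncated_cauchy_def mult.assoc)

lemma L_one_add: "f \<in> L_one \<Longrightarrow> g \<in> L_one \<Longrightarrow> (\<lambda>z. f z + g z) \<in> L_one"
  and L_one_cmult: "f \<in> L_one \<Longrightarrow> (\<lambda>z. c * f z) \<in> L_one"
  and L_one_const: "(\<lambda>_. c) \<in> L_one"
  by (auto simp: L_one_def)

lemma pv_exists_add:
  assumes "pv_exists f" "pv_exists g"
  shows "pv_exists (\<lambda>z. f z + g z)"
    and "AE t in \<mu>. riesz_projection (\<lambda>z. f z + g z) t = riesz_projection f t + riesz_projection g t"
proof -
  have L: "f \<in> L_one" "g \<in> L_one" "(\<lambda>z. f z + g z) \<in> L_one"
    using assms by (auto simp: pv_exists_def L_one_add)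
  have ae: "AE t in \<mu>. (\<exists>l. has_pv f t l) \<and> (\<exists>l. has_pv g t l)"
    using assms by (auto simp: pv_exists_def)
  have "AE t in \<mu>. \<exists>l. has_pv (\<lambda>z. f z + g z) t l"
    using ae by eventually_elim (use has_pv_add[OF L(1,2)] in blast)
  then show "pv_exists (\<lambda>z. f z + g z)" using L by (simp add: pv_exists_def)
  show "AE t in \<mu>. riesz_projection (\<lambda>z. f z + g z) t = riesz_projection f t + riesz_projection g t"
    using ae AE_sphere
  proof eventually_elim
    case (elim t)
    then obtain l l' where l: "has_pv f t l" "has_pv g t l'" by blast
    have "norm t = 1" using elim by simp
    then show ?case
      using riesz_pv[OF L(1) _ l(1)] riesz_pv[OF L(2) _ l(2)] riesz_pv[OF L(3) _ has_pv_add[OF L(1,2) l]]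
      by (simp add: add_divide_distrib)
  qed
qed

lemma pv_exists_cmult:
  assumes "pv_exists f"
  shows "pv_exists (\<lambda>z. c * f z)"
    and "AE t in \<mu>. riesz_projection (\<lambda>z. c * f z) t = c * riesz_projection f t"
proof -
  have L: "f \<in> L_one" "(\<lambda>z. c * f z) \<in> L_one"
    using assms by (auto simp: pv_exists_def L_one_cmult)
  have ae: "AE t in \<mu>. \<exists>l. has_pv f t l"
    using assms by (auto simp: pv_exists_def)
  have "AE t in \<mu>. \<exists>l. has_pv (\<lambda>z. c * f z) t l"
    using ae by eventually_elim (use has_pv_cmult in blast)
  then show "pv_exists (\<lambda>z. c * f z)" using L by (simp add: pv_exists_def)
  show "AE t in \<mu>. riesz_projection (\<lambda>z. c * f z) t = c * riesz_projection f t"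
    using ae AE_sphere
  proof eventually_elim
    case (elim t)
    then obtain l where l: "has_pv f t l" by blast
    have "norm t = 1" using elim by simp
    then show ?case
      using riesz_pv[OF L(1) _ l] riesz_pv[OF L(2) _ has_pv_cmult[OF l]] by (simp add: distrib_left)
  qed
qed

lemma truncated_cauchy_cong:
  assumes f: "f \<in> L_one" and g: "g \<in> L_one" and ae: "AE z in \<mu>. f z = g z" and e: "\<epsilon> > 0"
  shows "truncated_cauchy \<epsilon> f t = truncated_cauchy \<epsilon> g t"
  unfolding truncated_cauchy_def
  by (rule integral_cong_AE) (use integrable_truncated[OF f e] integrable_truncated[OF g e] ae in auto)

text \<open>The truncated integrals coincide at every radius, so \<open>Lim\<close> returns the same
  value whether or not the limit exists.\<close>

lemma riesz_cong:
  assumes f: "f \<in> L_one" and g: "g \<in> L_one" and ae: "AE z in \<mu>. f z = g z"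
  shows "AE z in \<mu>. riesz_projection f z = riesz_projection g z"
  using ae AE_sphere
proof eventually_elim
  case (elim t)
  have "Lim (at_right 0) (\<lambda>\<epsilon>. (2 * pi * \<i>) * truncated_cauchy \<epsilon> f t) = Lim (at_right 0) (\<lambda>\<epsilon>. (2 * pi * \<i>) * truncated_cauchy \<epsilon> g t)"
    using truncated_cauchy_cong[OF f g ae]
    by (intro Lim_cong refl) (auto simp: eventually_at_filter)
  then have "cauchy_singular f t = cauchy_singular g t"
    using elim cauchy_singular_eq[OF f] cauchy_singular_eq[OF g] by simp
  then show ?case using elim by (simp add: riesz_projection_def)
qed

text \<open>Adding a function whose principal value exists cannot repair divergence of the integral.\<close>

lemma pv_dichotomy:
  assumes f: "f \<in> L_one" and g: "pv_exists g"
    and add: "AE z in \<mu>. riesz_projection (\<lambda>z. f z + g z) z = riesz_projection f z + riesz_projection g z"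
  shows "AE t in \<mu>. (\<exists>l. has_pv f t l) \<or> has_pv g t 0"
proof -
  have gL: "g \<in> L_one" and gpv: "AE t in \<mu>. \<exists>l. has_pv g t l" using g by (auto simp: pv_exists_def)
  show ?thesis using gpv add AE_sphere
  proof eventually_elim
    case (elim t)
    then obtain l where l: "has_pv g t l" by blast
    have t: "norm t = 1" using elim by simp
    show ?case
    proof (cases "\<exists>l. has_pv f t l")
      case False
      have "\<nexists>l. has_pv (\<lambda>z. f z + g z) t l"
      proof
        assume "\<exists>l. has_pv (\<lambda>z. f z + g z) t l"
        then obtain l' where l': "has_pv (\<lambda>z. f z + g z) t l'" by blast
        have "has_pv (\<lambda>z. (f z + g z) + (-1) * g z) t (l' + (-1) * l)"
          by (intro has_pv_add L_one_add L_one_cmult has_pv_cmult f gL l l')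
        then show False using False by auto
      qed
      then have "cauchy_singular (\<lambda>z. f z + g z) t = cauchy_singular f t"
        using cauchy_singular_no_pv[OF f t] cauchy_singular_no_pv[OF L_one_add[OF f gL] t] False by simp
      then have "cauchy_singular g t = 0" using elim(2) by (simp add: riesz_projection_def field_simps)
      then show ?thesis using cauchy_singular_pv[OF gL t l] l by simp
    qed auto
  qed
qed

section \<open>The principal value of constants and the commutator with \<open>cnj z\<close>\<close>

lemma sets_circle_near:
  "{y \<in> sphere 0 1. cmod (1 - t * cnj y) \<le> \<epsilon>} \<in> sets \<mu>"
proof -
  have "(\<lambda>y. cmod (1 - t * cnj y)) \<in> borel_measurable \<mu>"
    by (rule continuous_imp_circle) (intro continuous_intros)
  then have "{y \<in> space \<mu>. cmod (1 - t * cnj y) \<le> \<epsilon>} \<in> sets \<mu>" by measurable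
  then show ?thesis by simp
qed

text \<open>Markov's inequality for the Poisson kernel, which is at least
  \<open>1 / (4 * (1 - r))\<close> on the arc and has integral one.\<close>

lemma measure_circle_near_le:
  assumes r: "0 \<le> r" "r < 1" and t: "norm t = 1"
  shows "measure \<mu> {y \<in> sphere 0 1. cmod (1 - t * cnj y) \<le> 1 - r} \<le> 4 * (1 - r)"
proof -
  let ?A = "{y \<in> sphere 0 1. cmod (1 - t * cnj y) \<le> 1 - r}"
  have A: "?A \<in> sets \<mu>" by (rule sets_circle_near)
  have "measure \<mu> ?A = (\<integral>y. indicator ?A y \<partial>\<mu>)"
    using sets.sets_into_space[OF A] by (simp add: Int_absorb2)
  also have "\<dots> \<le> (\<integral>y. 4 * (1 - r) * poisson r (t * cnj y) \<partial>\<mu>)"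
  proof (rule integral_mono_AE)
    show "integrable \<mu> (indicator ?A :: complex \<Rightarrow> real)"
      using A by (simp add: circle.emeasure_finite less_top[symmetric])
    show "integrable \<mu> (\<lambda>y. 4 * (1 - r) * poisson r (t * cnj y))"
      by (intro integrable_mult_right integrable_poisson r t)
    show "AE y in \<mu>. indicator ?A y \<le> 4 * (1 - r) * poisson r (t * cnj y)"
    proof (rule AE_I2)
      fix y assume "y \<in> space \<mu>"
      then have n: "norm (t * cnj y) = 1" using t by (simp add: norm_mult)
      show "indicator ?A y \<le> 4 * (1 - r) * poisson r (t * cnj y)"
      proof (cases "y \<in> ?A")
        case True
        then have "1 / (4 * (1 - r)) \<le> poisson r (t * cnj y)" using poisson_lower[OF r n] by simp
        then have "1 \<le> 4 * (1 - r) * poisson r (t * cnj y)"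
          using r by (subst (asm) pos_divide_le_eq) (auto simp: mult.commute)
        then show ?thesis using True by simp
      next
        case False
        then show ?thesis using r poisson_nonneg[OF r, of "t * cnj y"] by simp
      qed
    qed
  qed
  also have "\<dots> = 4 * (1 - r)" using integral_poisson[OF r t] by simp
  finally show ?thesis .
qed

lemma truncated_kernel_cnj: "truncated_kernel \<epsilon> (cnj s) = cnj (truncated_kernel \<epsilon> s)"
proof -
  have "cmod (1 - cnj s) = cmod (1 - s)" by (metis complex_cnj_diff complex_cnj_one complex_mod_cnj)
  then show ?thesis by (simp add: truncated_kernel_def indicator_def)
qed

text \<open>On the circle without the point \<open>1\<close>, the function
  \<open>1 / (1 - s)\<close> has real part \<open>1 / 2\<close>.\<close>

lemma truncated_kernel_sum:
  assumes "norm s = 1" "\<epsilon> > 0"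
  shows "truncated_kernel \<epsilon> s + truncated_kernel \<epsilon> (cnj s) = of_real (indicator {s. cmod (1 - s) > \<epsilon>} s)"
proof (cases "cmod (1 - s) > \<epsilon>")
  case True
  then have "s \<noteq> 1" using assms by auto
  then have ne: "1 - s \<noteq> 0" "1 - cnj s \<noteq> 0" by auto
  have "s * cnj s = 1" using assms by (simp add: complex_norm_square[symmetric])
  then have "1 / (1 - s) + 1 / (1 - cnj s) = 1"
  proof -
    assume "s * cnj s = 1"
    then have eq: "(1 - s) * (1 - cnj s) = (1 - cnj s) + (1 - s)" by (simp add: algebra_simps)
    have "1 / (1 - s) + 1 / (1 - cnj s) = (1 * (1 - cnj s) + 1 * (1 - s)) / ((1 - s) * (1 - cnj s))"
      using ne by (rule add_frac_eq)
    also have "\<dots> = 1"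
      unfolding mult_1 eq[symmetric] using ne by (intro divide_self) simp
    finally show ?thesis .
  qed
  moreover have "cmod (1 - cnj s) = cmod (1 - s)" by (metis complex_cnj_diff complex_cnj_one complex_mod_cnj)
  ultimately show ?thesis using True by (simp add: truncated_kernel_def)
next
  case False
  moreover have "cmod (1 - cnj s) = cmod (1 - s)" by (metis complex_cnj_diff complex_cnj_one complex_mod_cnj)
  ultimately show ?thesis by (simp add: truncated_kernel_def)
qed

text \<open>The reflection \<open>y \<mapsto> t\<^sup>2 * cnj y\<close> fixes \<open>t\<close> and conjugates the kernel.\<close>

lemma truncated_cauchy_one:
  assumes t: "norm t = 1" and e: "0 < \<epsilon>" "\<epsilon> \<le> 1"
  shows "norm (truncated_cauchy \<epsilon> (\<lambda>_. 1) t - 1 / 2) \<le> 2 * \<epsilon>"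
proof -
  let ?K = "\<lambda>y. truncated_kernel \<epsilon> (t * cnj y)"
  let ?A = "{y \<in> sphere 0 1. cmod (1 - t * cnj y) \<le> \<epsilon>}"
  have A: "?A \<in> sets \<mu>" by (rule sets_circle_near)
  have tt: "t * cnj t = 1" using t by (simp add: complex_norm_square[symmetric])
  have i: "integrable \<mu> ?K"
    using integrable_truncated[OF L_one_const e(1), of 1 t] by simp
  have "(\<integral>y. ?K (t\<^sup>2 * cnj y) \<partial>\<mu>) = (\<integral>y. ?K y \<partial>\<mu>)"
    by (rule integral_circle_reflect[OF truncated_kernel_circle]) (simp add: norm_power t)
  moreover have "?K (t\<^sup>2 * cnj y) = truncated_kernel \<epsilon> (cnj (t * cnj y))" for y
  proof -
    have "t * cnj (t\<^sup>2 * cnj y) = (t * cnj t) * (cnj t * y)"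
      by (simp add: power2_eq_square)
    then have "t * cnj (t\<^sup>2 * cnj y) = cnj (t * cnj y)" using tt by simp
    then show ?thesis by (simp only:)
  qed
  ultimately have "(\<integral>y. truncated_kernel \<epsilon> (cnj (t * cnj y)) \<partial>\<mu>) = (\<integral>y. ?K y \<partial>\<mu>)" by simp
  moreover have "integrable \<mu> (\<lambda>y. truncated_kernel \<epsilon> (cnj (t * cnj y)))"
    unfolding truncated_kernel_cnj using i by (rule integrable_cnj)
  \<comment> \<open>The kernel and its reflected copy have the same integral and add up to one off
    the arc, so twice the integral is one minus the measure of the arc.\<close>
  ultimately have "2 * truncated_cauchy \<epsilon> (\<lambda>_. 1) t = (\<integral>y. ?K y + truncated_kernel \<epsilon> (cnj (t * cnj y)) \<partial>\<mu>)"
    using i by (simp add: truncated_cauchy_def)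
  also have "\<dots> = (\<integral>y. of_real (1 - indicator ?A y) \<partial>\<mu>)"
  proof (rule Bochner_Integration.integral_cong[OF refl])
    fix y assume "y \<in> space \<mu>"
    then have "norm y = 1" "norm (t * cnj y) = 1" using t by (auto simp: norm_mult)
    then show "?K y + truncated_kernel \<epsilon> (cnj (t * cnj y)) = of_real (1 - indicator ?A y)"
      using truncated_kernel_sum[of "t * cnj y" \<epsilon>] e by (auto simp: indicator_def)
  qed
  also have "\<dots> = of_real (\<integral>y. 1 - indicator ?A y \<partial>\<mu>)"
    by (rule integral_complex_of_real)
  also have "(\<integral>y. 1 - indicator ?A y \<partial>\<mu>) = 1 - measure \<mu> ?A"
  proof -
    have "(\<integral>y. indicator ?A y \<partial>\<mu>) = measure \<mu> ?A"
      using sets.sets_into_space[OF A] by (simp add: Int_absorb2)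
    moreover have "integrable \<mu> (indicator ?A :: complex \<Rightarrow> real)"
      using A by (simp add: less_top[symmetric])
    ultimately show ?thesis
      using circle.prob_space by (simp only: Bochner_Integration.integral_diff integrable_const lebesgue_integral_const scaleR_one circle.integrable_const)
  qed
  finally have "truncated_cauchy \<epsilon> (\<lambda>_. 1) t - 1 / 2 = - of_real (measure \<mu> ?A / 2)"
    by (simp add: field_simps)
  then have "norm (truncated_cauchy \<epsilon> (\<lambda>_. 1) t - 1 / 2) = measure \<mu> ?A / 2"
    by (simp only: norm_minus_cancel norm_of_real) simp
  also have "\<dots> \<le> 2 * \<epsilon>"
    using measure_circle_near_le[of "1 - \<epsilon>" t] e t by simp
  finally show ?thesis .
qed

lemma has_pv_one:
  assumes t: "norm t = 1"
  shows "has_pv (\<lambda>_. 1) t (1 / 2)"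
  unfolding has_pv_def
proof (rule LIM_zero_cancel, rule Lim_null_comparison)
  have "\<forall>\<^sub>F \<epsilon> in at_right 0. \<epsilon> \<in> {0<..<1::real}" by (rule eventually_at_right_real) simp
  then show "\<forall>\<^sub>F \<epsilon> in at_right 0. norm (truncated_cauchy \<epsilon> (\<lambda>_. 1) t - 1 / 2) \<le> 2 * \<epsilon>"
    by eventually_elim (use truncated_cauchy_one[OF t] in \<open>fastforce\<close>)
  show "((\<lambda>\<epsilon>::real. 2 * \<epsilon>) \<longlongrightarrow> 0) (at_right 0)" by (auto intro!: tendsto_eq_intros)
qed

lemma AE_circle_noteq:
  assumes t: "norm t = 1" shows "AE y in \<mu>. y \<noteq> t"
proof -
  have S: "{t} \<in> sets \<mu>"
    unfolding circle_measure_eq using t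
    by (intro sets_completionI_sets) (auto simp: sets_circle_borel sets_restrict_space intro!: image_eqI[of _ _ "{t}"])
  have "measure \<mu> {t} \<le> 4 * e" if "0 < e" "e \<le> 1" for e
  proof -
    have "measure \<mu> {t} \<le> measure \<mu> {y \<in> sphere 0 1. cmod (1 - t * cnj y) \<le> 1 - (1 - e)}"
    proof (rule circle.finite_measure_mono)
      have "t * cnj t = 1" using t by (simp add: complex_norm_square[symmetric])
      then show "{t} \<subseteq> {y \<in> sphere 0 1. cmod (1 - t * cnj y) \<le> 1 - (1 - e)}" using t that by simp
      show "{y \<in> sphere 0 1. cmod (1 - t * cnj y) \<le> 1 - (1 - e)} \<in> sets \<mu>"
        by (rule sets_circle_near)
    qed
    then show ?thesis using measure_circle_near_le[of "1 - e" t] that t by simp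
  qed
  \<comment> \<open>If the measure were positive, this choice of \<open>e\<close> would bound it by
    half of itself.\<close>
  from this[of "measure \<mu> {t} / 8"] have "measure \<mu> {t} = 0"
    using measure_nonneg[of \<mu> "{t}"] circle.prob_le_1[of "{t}"] by linarith
  then have "{t} \<in> null_sets \<mu>"
    using S by (simp add: null_sets_def circle.emeasure_eq_measure)
  then show ?thesis by (rule AE_not_in[THEN eventually_mono]) simp
qed

text \<open>Passing from \<open>f\<close> to \<open>t * cnj z * f\<close> multiplies the kernel by
  \<open>1 - t * cnj y\<close>, which cancels the singularity; what is left is the integral of
  \<open>f\<close> off a shrinking arc. The difference converges even where the two principal values
  do not.\<close>

lemma truncated_cauchy_shift:
  assumes f: "f \<in> L_one" and t: "norm t = 1"
  shows "((\<lambda>\<epsilon>. truncated_cauchy \<epsilon> f t - t * truncated_cauchy \<epsilon> (\<lambda>z. cnj z * f z) t) \<longlongrightarrow>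
    (\<integral>z. f z \<partial>\<mu>)) (at_right 0)"
proof (rule tendsto_at_right_sequentially[of 0 1])
  fix S :: "nat \<Rightarrow> real" assume S: "\<And>n. 0 < S n" "S \<longlonglongrightarrow> 0"
  have fi: "integrable \<mu> f" using f by (simp add: L_one_def)
  have gi: "(\<lambda>z. cnj z * f z) \<in> L_one"
    using integrable_mult_continuous[OF fi, of cnj] by (simp add: L_one_def continuous_intros mult.commute)
  have eq: "truncated_cauchy e f t - t * truncated_cauchy e (\<lambda>z. cnj z * f z) t =
     (\<integral>y. f y * indicator {s. cmod (1 - s) > e} (t * cnj y) \<partial>\<mu>)" if e: "e > 0" for e
  proof -
    have "truncated_cauchy e f t - t * truncated_cauchy e (\<lambda>z. cnj z * f z) t =
      (\<integral>y. f y * truncated_kernel e (t * cnj y) - t * ((cnj y * f y) * truncated_kernel e (t * cnj y)) \<partial>\<mu>)"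
      unfolding truncated_cauchy_def
      using integrable_truncated[OF f e, of t] integrable_truncated[OF gi e, of t]
      by simp
    also have "\<dots> = (\<integral>y. f y * indicator {s. cmod (1 - s) > e} (t * cnj y) \<partial>\<mu>)"
    proof (rule Bochner_Integration.integral_cong[OF refl])
      fix y
      have "f y * truncated_kernel e (t * cnj y) - t * ((cnj y * f y) * truncated_kernel e (t * cnj y)) =
        f y * ((1 - t * cnj y) * truncated_kernel e (t * cnj y))" by (simp add: algebra_simps)
      also have "(1 - t * cnj y) * truncated_kernel e (t * cnj y) = indicator {s. cmod (1 - s) > e} (t * cnj y)"
        using e by (auto simp: truncated_kernel_def indicator_def)
      finally show "f y * truncated_kernel e (t * cnj y) - t * ((cnj y * f y) * truncated_kernel e (t * cnj y)) =
        f y * indicator {s. cmod (1 - s) > e} (t * cnj y)" .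
    qed
    finally show ?thesis .
  qed
  have "(\<lambda>n. \<integral>y. f y * indicator {s. cmod (1 - s) > S n} (t * cnj y) \<partial>\<mu>) \<longlonglongrightarrow> (\<integral>z. f z \<partial>\<mu>)"
  proof (rule integral_dominated_convergence[where w="\<lambda>z. norm (f z)"])
    have "(\<lambda>y. indicator {s. cmod (1 - s) > S n} (t * cnj y) :: complex) \<in> borel_measurable \<mu>" for n
      by (intro borel_imp_circle) measurable
    then show "(\<lambda>y. f y * indicator {s. cmod (1 - s) > S n} (t * cnj y)) \<in> borel_measurable \<mu>" for n
      using fi by (intro borel_measurable_times) auto
    show "AE y in \<mu>. (\<lambda>n. f y * indicator {s. cmod (1 - s) > S n} (t * cnj y)) \<longlonglongrightarrow> f y"
      using AE_circle_noteq[OF t] AE_sphere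
    proof eventually_elim
      case (elim y)
      then have "cmod (1 - t * cnj y) > 0" using one_minus_cnj[OF t, of y] by simp
      from order_tendstoD(2)[OF S(2) this]
      have "\<forall>\<^sub>F n in sequentially. f y * indicator {s. cmod (1 - s) > S n} (t * cnj y) = f y"
        by eventually_elim simp
      then show ?case by (rule tendsto_eventually)
    qed
    show "AE y in \<mu>. norm (f y * indicator {s. cmod (1 - s) > S n} (t * cnj y)) \<le> norm (f y)" for n
      by (rule AE_I2) (auto simp: indicator_def)
  qed (use fi in auto)
  then show "(\<lambda>n. truncated_cauchy (S n) f t - t * truncated_cauchy (S n) (\<lambda>z. cnj z * f z) t) \<longlonglongrightarrow> (\<integral>z. f z \<partial>\<mu>)"
    by (simp add: eq S)
qed simp

lemma L_one_cnj_mult: "f \<in> L_one \<Longrightarrow> (\<lambda>z. cnj z * f z) \<in> L_one"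
  using integrable_mult_continuous[of f cnj] by (simp add: L_one_def continuous_intros mult.commute)

lemma has_pv_shift:
  assumes f: "f \<in> L_one" and t: "norm t = 1" and l: "has_pv f t l"
  shows "has_pv (\<lambda>z. cnj z * f z) t (cnj t * (l - (\<integral>z. f z \<partial>\<mu>)))"
proof -
  have tt: "cnj t * t = 1" using t by (metis complex_norm_square mult.commute of_real_1 power_one)
  have "((\<lambda>\<epsilon>. cnj t * (truncated_cauchy \<epsilon> f t - (truncated_cauchy \<epsilon> f t - t * truncated_cauchy \<epsilon> (\<lambda>z. cnj z * f z) t))) \<longlongrightarrow>
    cnj t * (l - (\<integral>z. f z \<partial>\<mu>))) (at_right 0)"
    using l[unfolded has_pv_def] by (intro tendsto_intros truncated_cauchy_shift f t)
  moreover have "cnj t * (a - (a - t * b)) = b" for a b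
    using tt by (simp add: mult.assoc[symmetric])
  ultimately show ?thesis unfolding has_pv_def by (simp only:)
qed

text \<open>The second claim is the commutator of \<open>P\<close> with multiplication by
  \<open>cnj z\<close>. It supplies the constants in the weighted space, the bound on the mean, and
  the identification of \<open>T(cnj z)\<close> with the backward shift.\<close>

lemma pv_exists_shift:
  assumes f: "pv_exists f"
  shows "pv_exists (\<lambda>z. cnj z * f z)"
    and "AE t in \<mu>. riesz_projection f t - t * riesz_projection (\<lambda>z. cnj z * f z) t = (\<integral>z. f z \<partial>\<mu>)"
proof -
  have L: "f \<in> L_one" "(\<lambda>z. cnj z * f z) \<in> L_one"
    using f by (auto simp: pv_exists_def L_one_cnj_mult)
  have ae: "AE t in \<mu>. \<exists>l. has_pv f t l"
    using f by (auto simp: pv_exists_def)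
  have "AE t in \<mu>. \<exists>l. has_pv (\<lambda>z. cnj z * f z) t l"
    using ae AE_sphere by eventually_elim (use has_pv_shift[OF L(1)] in auto)
  then show "pv_exists (\<lambda>z. cnj z * f z)" using L by (simp add: pv_exists_def)
  show "AE t in \<mu>. riesz_projection f t - t * riesz_projection (\<lambda>z. cnj z * f z) t = (\<integral>z. f z \<partial>\<mu>)"
    using ae AE_sphere
  proof eventually_elim
    case (elim t)
    then obtain l where l: "has_pv f t l" by blast
    have t: "norm t = 1" using elim by simp
    have tt: "t * cnj t = 1" using t by (simp add: complex_norm_square[symmetric])
    have "t * (cnj t * f t / 2 + cnj t * (l - c)) = f t / 2 + (l - c)" for c
      using tt by (simp add: distrib_left mult.assoc[symmetric])
    then show ?case
      using riesz_pv[OF L(1) t l] riesz_pv[OF L(2) t has_pv_shift[OF L(1) t l]] by simp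
  qed
qed

section \<open>Boundary limits of Poisson and Cauchy integrals\<close>

text \<open>After subtraction of \<open>f t\<close> times the total mass, domination of
  \<open>b\<close> by the Poisson kernel becomes a bound by the oscillation. It is applied to the
  Poisson kernel with \<open>C = 1\<close> and to the difference of the truncated kernel and the
  Cauchy kernel with \<open>C = 8\<close>.\<close>

lemma poisson_osc_integral:
  assumes f: "f \<in> L_one" and r: "0 \<le> r" "r < 1" and t: "norm t = 1"
    and b: "(\<lambda>y. b (t * cnj y)) \<in> borel_measurable \<mu>"
    and bound: "\<And>s. norm s = 1 \<Longrightarrow> norm (b s) \<le> C * poisson r s" and C: "C \<ge> 0"
  shows "ennreal (norm ((\<integral>y. f y * b (t * cnj y) \<partial>\<mu>) - f t * (\<integral>y. b (t * cnj y) \<partial>\<mu>)))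
    \<le> ennreal C * (\<integral>\<^sup>+y. ennreal (poisson r (t * cnj y) * norm (f y - f t)) \<partial>\<mu>)"
proof -
  have fi: "integrable \<mu> f" using f by (simp add: L_one_def)
  have bb: "AE y in \<mu>. norm (b (t * cnj y)) \<le> C * ((1 - r\<^sup>2) / (1 - r)\<^sup>2)"
  proof (rule AE_I2)
    fix y assume "y \<in> space \<mu>"
    then have n: "norm (t * cnj y) = 1" using t by (simp add: norm_mult)
    show "norm (b (t * cnj y)) \<le> C * ((1 - r\<^sup>2) / (1 - r)\<^sup>2)"
      using bound[OF n] mult_left_mono[OF poisson_le[OF r n] C] by linarith
  qed
  have i: "integrable \<mu> (\<lambda>y. g y * b (t * cnj y))" if "integrable \<mu> g" for g
    by (rule integrable_mult_bounded[OF that b bb])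
  have "(\<integral>y. f y * b (t * cnj y) \<partial>\<mu>) - f t * (\<integral>y. b (t * cnj y) \<partial>\<mu>) =
      (\<integral>y. f y * b (t * cnj y) - f t * b (t * cnj y) \<partial>\<mu>)"
    using i[OF fi] i[of "\<lambda>_. f t"] by simp
  also have "\<dots> = (\<integral>y. (f y - f t) * b (t * cnj y) \<partial>\<mu>)" by (simp add: left_diff_distrib)
  finally have "ennreal (norm ((\<integral>y. f y * b (t * cnj y) \<partial>\<mu>) - f t * (\<integral>y. b (t * cnj y) \<partial>\<mu>)))
     \<le> (\<integral>\<^sup>+y. ennreal (norm ((f y - f t) * b (t * cnj y))) \<partial>\<mu>)"
    using integral_norm_bound_ennreal[OF i[of "\<lambda>y. f y - f t"]] fi by simp
  also have "\<dots> \<le> (\<integral>\<^sup>+y. ennreal C * ennreal (poisson r (t * cnj y) * norm (f y - f t)) \<partial>\<mu>)"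
  proof (rule nn_integral_mono)
    fix y assume "y \<in> space \<mu>"
    then have n: "norm (t * cnj y) = 1" using t by (simp add: norm_mult)
    have "norm (f y - f t) * norm (b (t * cnj y)) \<le> norm (f y - f t) * (C * poisson r (t * cnj y))"
      by (intro mult_left_mono bound n) simp
    then show "ennreal (norm ((f y - f t) * b (t * cnj y))) \<le> ennreal C * ennreal (poisson r (t * cnj y) * norm (f y - f t))"
      using C poisson_nonneg[OF r, of "t * cnj y"]
      by (simp add: norm_mult ennreal_mult[symmetric] mult_ac)
  qed
  also have "\<dots> = ennreal C * (\<integral>\<^sup>+y. ennreal (poisson r (t * cnj y) * norm (f y - f t)) \<partial>\<mu>)"
  proof (rule nn_integral_cmult)
    have "(\<lambda>y. poisson r (t * cnj y)) \<in> borel_measurable \<mu>"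
      by (rule continuous_imp_circle[OF continuous_poisson[OF r t]])
    then show "(\<lambda>y. ennreal (poisson r (t * cnj y) * norm (f y - f t))) \<in> borel_measurable \<mu>"
      using fi by measurable
  qed
  finally show ?thesis .
qed

lemma ennreal_norm_tendsto_zero:
  fixes x :: "nat \<Rightarrow> complex"
  assumes "\<And>n. ennreal (norm (x n)) \<le> ennreal C * y n" "y \<longlonglongrightarrow> 0"
  shows "x \<longlonglongrightarrow> 0"
proof -
  have "(\<lambda>n. ennreal C * y n) \<longlonglongrightarrow> ennreal C * 0"
    by (intro ennreal_tendsto_cmult assms) simp
  then have "(\<lambda>n. ennreal C * y n) \<longlonglongrightarrow> 0" by simp
  from tendsto_sandwich[OF _ _ tendsto_const this, of "\<lambda>n. ennreal (norm (x n))"] assms(1)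
  have "(\<lambda>n. ennreal (norm (x n))) \<longlonglongrightarrow> ennreal 0" by simp
  then have "(\<lambda>n. norm (x n)) \<longlonglongrightarrow> 0" by (subst (asm) tendsto_ennreal_iff) auto
  then show ?thesis by (rule tendsto_norm_zero_cancel)
qed

text \<open>Truncating at \<open>1 - r\<close> couples the principal value to the radius
  \<open>r\<close>, so one subsequence of radii serves both limits. The implication from
  \<open>has_pv\<close> keeps the statement valid for every integrable \<open>f\<close>.\<close>

lemma cauchy_poisson_limits:
  assumes f: "f \<in> L_one"
  shows "\<exists>k. strict_mono k \<and> (AE t in \<mu>.
    (\<lambda>j. poisson_integral (radius (k j)) f t) \<longlonglongrightarrow> f t \<and>
    (\<forall>l. has_pv f t l \<longrightarrow> (\<lambda>j. cauchy_integral (radius (k j)) f t) \<longlonglongrightarrow> f t / 2 + l))"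
proof -
  obtain k where k: "strict_mono k" and ae: "AE t in \<mu>.
    (\<lambda>j. \<integral>\<^sup>+y. ennreal (poisson (radius (k j)) (t * cnj y) * norm (f y - f t)) \<partial>\<mu>) \<longlonglongrightarrow> 0"
    using poisson_osc_AE[OF f] by blast
  have rk: "(\<lambda>j. radius (k j)) \<longlonglongrightarrow> 1"
    using LIMSEQ_subseq_LIMSEQ[OF radius_tendsto k] by (simp add: o_def)
  have "AE t in \<mu>.
    (\<lambda>j. poisson_integral (radius (k j)) f t) \<longlonglongrightarrow> f t \<and>
    (\<forall>l. has_pv f t l \<longrightarrow> (\<lambda>j. cauchy_integral (radius (k j)) f t) \<longlonglongrightarrow> f t / 2 + l)"
    using ae AE_sphere
  proof (eventually_elim, intro conjI allI impI)
    fix t assume lim: "(\<lambda>j. \<integral>\<^sup>+y. ennreal (poisson (radius (k j)) (t * cnj y) * norm (f y - f t)) \<partial>\<mu>) \<longlonglongrightarrow> 0"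
      and "t \<in> sphere 0 1"
    then have t: "norm t = 1" by simp
    have "(\<lambda>j. poisson_integral (radius (k j)) f t - f t) \<longlonglongrightarrow> 0"
    proof (rule ennreal_norm_tendsto_zero[OF _ lim])
      fix j
      note r = radius[of "k j"]
      have "(\<integral>y. complex_of_real (poisson (radius (k j)) (t * cnj y)) \<partial>\<mu>) = of_real (\<integral>y. poisson (radius (k j)) (t * cnj y) \<partial>\<mu>)"
        by (rule integral_complex_of_real)
      then have "(\<integral>y. complex_of_real (poisson (radius (k j)) (t * cnj y)) \<partial>\<mu>) = 1"
        using integral_poisson[OF r t] by simp
      moreover have "(\<lambda>y. complex_of_real (poisson (radius (k j)) (t * cnj y))) \<in> borel_measurable \<mu>"
        by (intro continuous_imp_circle continuous_intros continuous_poisson r t)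
      ultimately show "ennreal (norm (poisson_integral (radius (k j)) f t - f t)) \<le>
          ennreal 1 * (\<integral>\<^sup>+y. ennreal (poisson (radius (k j)) (t * cnj y) * norm (f y - f t)) \<partial>\<mu>)"
        using poisson_osc_integral[OF f r t, of "\<lambda>s. of_real (poisson (radius (k j)) s)" 1] poisson_nonneg[OF r]
        by (simp add: poisson_integral_def)
    qed
    then show "(\<lambda>j. poisson_integral (radius (k j)) f t) \<longlonglongrightarrow> f t" by (rule LIM_zero_cancel)
    fix l assume l: "has_pv f t l"
    let ?e = "\<lambda>j. 1 - radius (k j)"
    have e: "?e j > 0" "?e j \<le> 1" for j using radius[of "k j"] by auto
    have e0: "?e \<longlonglongrightarrow> 0" using tendsto_diff[OF tendsto_const[of 1] rk] by simp
    have er: "filterlim ?e (at_right 0) sequentially"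
    proof -
      have "\<forall>j. ?e j \<in> {0<..} \<and> ?e j \<noteq> 0" using e(1) by (metis greaterThan_iff less_irrefl)
      then show ?thesis using e0 unfolding filterlim_at by (intro conjI always_eventually)
    qed
    have T: "(\<lambda>j. truncated_cauchy (?e j) f t) \<longlonglongrightarrow> l"
      by (rule filterlim_compose[OF l[unfolded has_pv_def] er])
    have T1: "(\<lambda>j. truncated_cauchy (?e j) (\<lambda>_. 1) t) \<longlonglongrightarrow> 1 / 2"
      by (rule filterlim_compose[OF has_pv_one[OF t, unfolded has_pv_def] er])
    have D: "(\<lambda>j. (truncated_cauchy (?e j) f t - cauchy_integral (radius (k j)) f t) -
        f t * (truncated_cauchy (?e j) (\<lambda>_. 1) t - 1)) \<longlonglongrightarrow> 0"
    proof (rule ennreal_norm_tendsto_zero[OF _ lim])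
      fix j
      note r = radius[of "k j"]
      let ?b = "\<lambda>s. truncated_kernel (?e j) s - 1 / (1 - of_real (radius (k j)) * s)"
      have c: "continuous_on (sphere 0 1) (\<lambda>y. 1 / (1 - of_real (radius (k j)) * (t * cnj y)))"
      proof (intro continuous_intros ballI)
        fix y :: complex assume "y \<in> sphere 0 1"
        then show "1 - of_real (radius (k j)) * (t * cnj y) \<noteq> 0"
          using one_minus_nonzero(1)[OF norm_radius[OF r, of "t * cnj y"]] t by (simp add: norm_mult)
      qed
      have tk: "(\<lambda>y. truncated_kernel (?e j) (t * cnj y)) \<in> borel_measurable \<mu>"
        by (rule borel_imp_circle) measurable
      have m: "(\<lambda>y. ?b (t * cnj y)) \<in> borel_measurable \<mu>"
        using tk continuous_imp_circle[OF c] by (intro borel_measurable_diff)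
      have b: "norm (?b s) \<le> 8 * poisson (radius (k j)) s" if "norm s = 1" for s
        using truncated_kernel_bound[OF r that] by (simp add: truncated_kernel_def)
      have eq: "(\<integral>y. g y * ?b (t * cnj y) \<partial>\<mu>) = truncated_cauchy (?e j) g t - cauchy_integral (radius (k j)) g t"
        if g: "g \<in> L_one" for g
        using integrable_truncated[OF g e(1), of j t] integrable_mult_continuous[OF L_oneD(1)[OF g] c]
        by (simp add: truncated_cauchy_def cauchy_integral_def right_diff_distrib)
      have "cauchy_integral (radius (k j)) (\<lambda>_. 1) t = 1"
        using integral_cauchy_kernel(2)[of "of_real (radius (k j)) * t"] norm_radius[OF r t]
        by (simp add: cauchy_integral_def mult.assoc)
      then have eq1: "(\<integral>y. ?b (t * cnj y) \<partial>\<mu>) = truncated_cauchy (?e j) (\<lambda>_. 1) t - 1"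
        using eq[OF L_one_const[of 1]] by simp
      show "ennreal (norm ((truncated_cauchy (?e j) f t - cauchy_integral (radius (k j)) f t) -
        f t * (truncated_cauchy (?e j) (\<lambda>_. 1) t - 1))) \<le>
          ennreal 8 * (\<integral>\<^sup>+y. ennreal (poisson (radius (k j)) (t * cnj y) * norm (f y - f t)) \<partial>\<mu>)"
        using poisson_osc_integral[OF f r t m b] by (simp only: eq[OF f] eq1)
    qed
    \<comment> \<open>The truncated kernel has mass tending to \<open>1 / 2\<close>, the Cauchy
      kernel has mass \<open>1\<close>; this discrepancy contributes the term
      \<open>f t / 2\<close>.\<close>
    have "(\<lambda>j. truncated_cauchy (?e j) f t - f t * (truncated_cauchy (?e j) (\<lambda>_. 1) t - 1) -
        ((truncated_cauchy (?e j) f t - cauchy_integral (radius (k j)) f t) -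
        f t * (truncated_cauchy (?e j) (\<lambda>_. 1) t - 1))) \<longlonglongrightarrow> l - f t * (1 / 2 - 1) - 0"
      by (intro tendsto_intros T T1 D)
    then show "(\<lambda>j. cauchy_integral (radius (k j)) f t) \<longlonglongrightarrow> f t / 2 + l"
      by (simp add: add.commute)
  qed
  then show ?thesis using k by blast
qed

lemma riesz_limit:
  assumes f: "pv_exists f"
  shows "\<exists>k. strict_mono k \<and> (AE t in \<mu>.
    (\<lambda>j. poisson_integral (radius (k j)) f t) \<longlonglongrightarrow> f t \<and>
    (\<lambda>j. cauchy_integral (radius (k j)) f t) \<longlonglongrightarrow> riesz_projection f t)"
proof -
  have L: "f \<in> L_one" and ae: "AE t in \<mu>. \<exists>l. has_pv f t l" using f by (auto simp: pv_exists_def)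
  obtain k where k: "strict_mono k" and lim: "AE t in \<mu>.
    (\<lambda>j. poisson_integral (radius (k j)) f t) \<longlonglongrightarrow> f t \<and>
    (\<forall>l. has_pv f t l \<longrightarrow> (\<lambda>j. cauchy_integral (radius (k j)) f t) \<longlonglongrightarrow> f t / 2 + l)"
    using cauchy_poisson_limits[OF L] by blast
  have "AE t in \<mu>. (\<lambda>j. poisson_integral (radius (k j)) f t) \<longlonglongrightarrow> f t \<and>
    (\<lambda>j. cauchy_integral (radius (k j)) f t) \<longlonglongrightarrow> riesz_projection f t"
    using lim ae AE_sphere
  proof eventually_elim
    case (elim t)
    then obtain l where "has_pv f t l" by blast
    then show ?case using elim riesz_pv[OF L, of t l] by simp
  qed
  then show ?thesis using k by blast
qed

section \<open>Analytic multipliers and outer functions\<close>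

text \<open>On the circle \<open>z\<close> is inverse to \<open>cnj z\<close>, so the coefficients
  of negative index are moments with natural exponents.\<close>

lemma hardy_L_one_iff:
  "f \<in> hardy L_one \<longleftrightarrow> f \<in> L_one \<and> (\<forall>k\<ge>1. (\<integral>z. f z * z ^ k \<partial>\<mu>) = 0)"
proof -
  have eq: "fourier_coeff f (- int k) = (\<integral>z. f z * z ^ k \<partial>\<mu>)" if f: "f \<in> L_one" for k
    unfolding fourier_coeff_circle[OF f]
  proof (rule Bochner_Integration.integral_cong[OF refl])
    fix z assume "z \<in> space \<mu>"
    then have "z * cnj z = 1" by (simp add: complex_norm_square[symmetric])
    then have "inverse (cnj z) = z" by (metis inverse_unique mult.commute)
    then show "f z * cnj z powi (- int k) = f z * z ^ k"
      by (simp add: power_int_minus power_inverse[symmetric])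
  qed
  have "(\<forall>n<0. fourier_coeff f n = 0) \<longleftrightarrow> (\<forall>k\<ge>1. (\<integral>z. f z * z ^ k \<partial>\<mu>) = 0)" if f: "f \<in> L_one"
  proof safe
    fix k :: nat assume "\<forall>n<0. fourier_coeff f n = 0" "k \<ge> 1"
    then show "(\<integral>z. f z * z ^ k \<partial>\<mu>) = 0" using eq[OF f, of k] by simp
  next
    fix n :: int assume *: "\<forall>k\<ge>1. (\<integral>z. f z * z ^ k \<partial>\<mu>) = 0" "n < 0"
    then have "n = - int (nat (- n))" "nat (- n) \<ge> 1" by auto
    then show "fourier_coeff f n = 0" using eq[OF f, of "nat (- n)"] *(1) by metis
  qed
  then show ?thesis by (auto simp: hardy_def)
qed

lemma hardy_iff: "Y \<subseteq> L_one \<Longrightarrow> f \<in> hardy Y \<longleftrightarrow> f \<in> Y \<and> f \<in> hardy L_one"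
  by (auto simp: hardy_def)

lemma hardy_oneD:
  assumes "f \<in> hardy L_one"
  shows "f \<in> L_one" "k \<ge> 1 \<Longrightarrow> (\<integral>z. f z * z ^ k \<partial>\<mu>) = 0"
  using assms by (auto simp: hardy_L_one_iff)

lemma integrable_mult_power:
  "f \<in> L_one \<Longrightarrow> integrable \<mu> (\<lambda>z. f z * z ^ k)"
  by (intro integrable_mult_continuous L_oneD continuous_intros)

lemma hardy_one_add:
  assumes f: "f \<in> hardy L_one" and g: "g \<in> hardy L_one"
  shows "(\<lambda>z. f z + g z) \<in> hardy L_one"
  unfolding hardy_L_one_iff
proof (intro conjI allI impI)
  show "(\<lambda>z. f z + g z) \<in> L_one" by (intro L_one_add hardy_oneD f g)
  fix k :: nat assume k: "k \<ge> 1"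
  show "(\<integral>z. (f z + g z) * z ^ k \<partial>\<mu>) = 0"
    using hardy_oneD(2)[OF f k] hardy_oneD(2)[OF g k]
      integrable_mult_power[OF hardy_oneD(1)[OF f], of k] integrable_mult_power[OF hardy_oneD(1)[OF g], of k]
    by (simp add: distrib_right)
qed

lemma hardy_one_cmult:
  assumes f: "f \<in> hardy L_one" shows "(\<lambda>z. c * f z) \<in> hardy L_one"
  using hardy_oneD[OF f] by (simp add: hardy_L_one_iff L_one_cmult mult.assoc)

lemma hardy_one_const: "(\<lambda>_. c) \<in> hardy L_one"
  unfolding hardy_L_one_iff by (simp add: L_one_const integral_circle_power)

lemma hardy_one_mult_ident:
  assumes f: "f \<in> hardy L_one" shows "(\<lambda>z. z * f z) \<in> hardy L_one"
  unfolding hardy_L_one_iff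
proof (intro conjI allI impI)
  show "(\<lambda>z. z * f z) \<in> L_one"
    using integrable_mult_power[OF hardy_oneD(1)[OF f], of 1] by (simp add: L_one_def mult.commute)
  fix k :: nat assume k: "k \<ge> 1"
  have "(\<integral>z. z * f z * z ^ k \<partial>\<mu>) = (\<integral>z. f z * z ^ Suc k \<partial>\<mu>)"
    by (intro Bochner_Integration.integral_cong) auto
  then show "(\<integral>z. z * f z * z ^ k \<partial>\<mu>) = 0"
    using hardy_oneD(2)[OF f, of "Suc k"] by simp
qed

lemma hardy_one_limit:
  assumes s: "\<And>n. s n \<in> hardy L_one" and f: "f \<in> borel_measurable \<mu>"
    and lim: "AE z in \<mu>. (\<lambda>n. s n z) \<longlonglongrightarrow> f z"
    and bound: "\<And>n. AE z in \<mu>. norm (s n z) \<le> w z"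
    and w: "integrable \<mu> w"
  shows "f \<in> hardy L_one"
proof -
  have sm: "s n \<in> borel_measurable \<mu>" for n
    by (intro L_oneD hardy_oneD s)
  have fi: "integrable \<mu> f"
    by (rule integrable_dominated_convergence[OF f sm w lim bound])
  have "(\<integral>z. f z * z ^ k \<partial>\<mu>) = 0" if k: "k \<ge> 1" for k
  proof -
    have "(\<lambda>n. \<integral>z. s n z * z ^ k \<partial>\<mu>) \<longlonglongrightarrow> (\<integral>z. f z * z ^ k \<partial>\<mu>)"
    proof (rule integral_dominated_convergence[OF _ _ w])
      show "(\<lambda>z. f z * z ^ k) \<in> borel_measurable \<mu>"
        "(\<lambda>z. s n z * z ^ k) \<in> borel_measurable \<mu>" for n
        using integrable_mult_power[OF hardy_oneD(1)[OF s]] integrable_mult_power[of f] fi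
        by (auto simp: L_one_def)
      show "AE z in \<mu>. (\<lambda>n. s n z * z ^ k) \<longlonglongrightarrow> f z * z ^ k"
        using lim by eventually_elim (rule tendsto_mult_right)
      show "AE z in \<mu>. norm (s n z * z ^ k) \<le> w z" for n
        using bound[of n] AE_sphere by eventually_elim (simp add: norm_mult norm_power)
    qed
    then show ?thesis
      using hardy_oneD(2)[OF s k] by (simp add: LIMSEQ_const_iff)
  qed
  moreover have "f \<in> L_one" using fi by (simp add: L_one_def)
  ultimately show ?thesis unfolding hardy_L_one_iff by blast
qed

section \<open>Bounded analytic functions as multipliers\<close>

text \<open>These are the bounded analytic functions, described by their action on
  \<open>hardy L_one\<close>. In this form products are immediate and require no convolution of
  Fourier coefficients.\<close>

definition analytic_multiplier :: "(complex \<Rightarrow> complex) \<Rightarrow> bool" where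
  "analytic_multiplier \<phi> \<longleftrightarrow> \<phi> \<in> borel_measurable \<mu> \<and>
     (\<exists>C. AE z in \<mu>. norm (\<phi> z) \<le> C) \<and> (\<forall>f\<in>hardy L_one. (\<lambda>z. \<phi> z * f z) \<in> hardy L_one)"

text \<open>Dominated convergence, applied after multiplication by a fixed analytic function.
  Exponentials, Cauchy integrals and bounded analytic functions are all obtained through such
  limits.\<close>

lemma analytic_multiplier_limit:
  assumes s: "\<And>n. analytic_multiplier (s n)" and f: "f \<in> borel_measurable \<mu>"
    and lim: "AE z in \<mu>. (\<lambda>n. s n z) \<longlonglongrightarrow> f z"
    and bound: "\<And>n. AE z in \<mu>. norm (s n z) \<le> C"
  shows "analytic_multiplier f"
  unfolding analytic_multiplier_def
proof (intro conjI exI ballI)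
  have "AE z in \<mu>. \<forall>n. norm (s n z) \<le> C" using bound by (simp add: AE_all_countable)
  then show "AE z in \<mu>. norm (f z) \<le> C"
    using lim
  proof eventually_elim
    case (elim z)
    show ?case by (rule LIMSEQ_le_const2[OF tendsto_norm[OF elim(2)]]) (use elim in auto)
  qed
  fix g assume g: "g \<in> hardy L_one"
  show "(\<lambda>z. f z * g z) \<in> hardy L_one"
  proof (rule hardy_one_limit[where w="\<lambda>z. C * norm (g z)"])
    show "(\<lambda>z. s n z * g z) \<in> hardy L_one" for n
      using s g by (auto simp: analytic_multiplier_def)
    show "(\<lambda>z. f z * g z) \<in> borel_measurable \<mu>"
      using f L_oneD(2)[OF hardy_oneD(1)[OF g]] by auto
    show "AE z in \<mu>. (\<lambda>n. s n z * g z) \<longlonglongrightarrow> f z * g z"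
      using lim by eventually_elim (rule tendsto_mult_right)
    show "AE z in \<mu>. norm (s n z * g z) \<le> C * norm (g z)" for n
      using bound[of n] by eventually_elim (auto simp: norm_mult intro!: mult_right_mono)
    show "integrable \<mu> (\<lambda>z. C * norm (g z))"
      using L_oneD(1)[OF hardy_oneD(1)[OF g]] by auto
  qed
qed fact

lemma analytic_multiplier_const: "analytic_multiplier (\<lambda>_. c)"
  by (auto simp: analytic_multiplier_def hardy_one_cmult)

lemma analytic_multiplier_ident: "analytic_multiplier (\<lambda>z. z)"
  unfolding analytic_multiplier_def
proof (intro conjI exI ballI)
  show "AE z in \<mu>. norm z \<le> 1" by (rule AE_I2) simp
qed (auto intro: borel_imp_circle hardy_one_mult_ident)

lemma analytic_multiplier_add:
  assumes \<phi>: "analytic_multiplier \<phi>" and \<psi>: "analytic_multiplier \<psi>"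
  shows "analytic_multiplier (\<lambda>z. \<phi> z + \<psi> z)"
proof -
  obtain C D where "AE z in \<mu>. norm (\<phi> z) \<le> C" "AE z in \<mu>. norm (\<psi> z) \<le> D"
    using \<phi> \<psi> by (auto simp: analytic_multiplier_def)
  then have "AE z in \<mu>. norm (\<phi> z + \<psi> z) \<le> C + D"
    by eventually_elim (rule norm_triangle_mono)
  then show ?thesis
    using \<phi> \<psi> by (auto simp: analytic_multiplier_def distrib_right intro!: hardy_one_add)
qed

lemma analytic_multiplier_mult:
  assumes \<phi>: "analytic_multiplier \<phi>" and \<psi>: "analytic_multiplier \<psi>"
  shows "analytic_multiplier (\<lambda>z. \<phi> z * \<psi> z)"
proof -
  obtain C D where "AE z in \<mu>. norm (\<phi> z) \<le> C" "AE z in \<mu>. norm (\<psi> z) \<le> D"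
    using \<phi> \<psi> by (auto simp: analytic_multiplier_def)
  then have "AE z in \<mu>. norm (\<phi> z * \<psi> z) \<le> C * D"
    by eventually_elim (auto simp: norm_mult intro!: mult_mono order.trans[OF norm_ge_zero])
  then show ?thesis
    using \<phi> \<psi> by (auto simp: analytic_multiplier_def mult.assoc)
qed

lemma analytic_multiplier_power:
  "analytic_multiplier \<phi> \<Longrightarrow> analytic_multiplier (\<lambda>z. \<phi> z ^ n)"
  by (induction n) (auto intro: analytic_multiplier_const analytic_multiplier_mult)

lemma analytic_multiplier_sum:
  "(\<And>n. n < N \<Longrightarrow> analytic_multiplier (\<phi> n)) \<Longrightarrow> analytic_multiplier (\<lambda>z. \<Sum>n<N. \<phi> n z)" for N :: nat
  by (induction N) (auto intro: analytic_multiplier_const analytic_multiplier_add)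

lemma analytic_multiplier_exp:
  assumes \<phi>: "analytic_multiplier \<phi>" shows "analytic_multiplier (\<lambda>z. exp (\<phi> z))"
proof -
  obtain C where C: "AE z in \<mu>. norm (\<phi> z) \<le> C" using \<phi> by (auto simp: analytic_multiplier_def)
  show ?thesis
  proof (rule analytic_multiplier_limit[where s="\<lambda>N z. \<Sum>n<N. of_real (inverse (fact n)) * \<phi> z ^ n" and C="exp C"])
    show "analytic_multiplier (\<lambda>z. \<Sum>n<N. of_real (inverse (fact n)) * \<phi> z ^ n)" for N
      by (intro analytic_multiplier_sum analytic_multiplier_mult analytic_multiplier_const analytic_multiplier_power \<phi>)
    show "(\<lambda>z. exp (\<phi> z)) \<in> borel_measurable \<mu>"
      using \<phi> by (auto simp: analytic_multiplier_def)
    show "AE z in \<mu>. (\<lambda>N. \<Sum>n<N. of_real (inverse (fact n)) * \<phi> z ^ n) \<longlonglongrightarrow> exp (\<phi> z)"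
      by (intro AE_I2) (rule exp_converges[unfolded sums_def scaleR_conv_of_real])
    show "AE z in \<mu>. norm (\<Sum>n<N. of_real (inverse (fact n)) * \<phi> z ^ n) \<le> exp C" for N
      using C
    proof eventually_elim
      case (elim z)
      have "norm (\<Sum>n<N. of_real (inverse (fact n)) * \<phi> z ^ n) \<le> (\<Sum>n<N. inverse (fact n) * norm (\<phi> z) ^ n)"
        by (rule order.trans[OF norm_sum]) (simp add: norm_mult norm_power norm_inverse)
      also have "\<dots> \<le> exp (norm (\<phi> z))"
        using sum_le_suminf[OF summable_exp[of "norm (\<phi> z)"], of "{..<N}"] 
        by (simp add: exp_def)
      also have "\<dots> \<le> exp C" using elim by simp
      finally show ?case .
    qed
  qed
qed

lemma cauchy_integral_sums:
  assumes f: "f \<in> L_one" and r: "0 \<le> r" "r < 1" and t: "norm t = 1"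
  shows "(\<lambda>n. (of_real r * t) ^ n * (\<integral>z. f z * cnj z ^ n \<partial>\<mu>)) sums cauchy_integral r f t"
  using integral_geometric[OF L_oneD(1)[OF f], of "of_real r * t" cnj] norm_radius[OF r t]
  by (auto simp: cauchy_integral_def mult.assoc intro!: continuous_intros)

text \<open>For fixed \<open>r < 1\<close> the Cauchy integral is a power series in
  \<open>r * t\<close> whose coefficients are bounded by the L1 norm of \<open>f\<close>; its
  partial sums are polynomials bounded by the geometric series.\<close>

lemma analytic_multiplier_cauchy:
  assumes f: "f \<in> L_one" and r: "0 \<le> r" "r < 1"
  shows "analytic_multiplier (cauchy_integral r f)"
proof (rule analytic_multiplier_limit[where
    s="\<lambda>N t. \<Sum>n<N. (of_real r * t) ^ n * (\<integral>z. f z * cnj z ^ n \<partial>\<mu>)" and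
    C="(\<integral>z. norm (f z) \<partial>\<mu>) / (1 - r)"])
  show am: "analytic_multiplier (\<lambda>t. \<Sum>n<N. (of_real r * t) ^ n * (\<integral>z. f z * cnj z ^ n \<partial>\<mu>))" for N
    by (intro analytic_multiplier_sum analytic_multiplier_mult analytic_multiplier_const analytic_multiplier_power analytic_multiplier_ident)
  have lim: "(\<lambda>N. \<Sum>n<N. (of_real r * t) ^ n * (\<integral>z. f z * cnj z ^ n \<partial>\<mu>)) \<longlonglongrightarrow> cauchy_integral r f t"
    if "t \<in> space \<mu>" for t
    using cauchy_integral_sums[OF f r, of t] that by (simp add: sums_def)
  show "cauchy_integral r f \<in> borel_measurable \<mu>"
    by (rule borel_measurable_LIMSEQ_metric[OF _ lim]) (use am in \<open>auto simp: analytic_multiplier_def\<close>)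
  show "AE t in \<mu>. (\<lambda>N. \<Sum>n<N. (of_real r * t) ^ n * (\<integral>z. f z * cnj z ^ n \<partial>\<mu>)) \<longlonglongrightarrow> cauchy_integral r f t"
    using lim by (rule AE_I2)
  let ?I = "\<integral>z. norm (f z) \<partial>\<mu>"
  show "AE t in \<mu>. norm (\<Sum>n<N. (of_real r * t) ^ n * (\<integral>z. f z * cnj z ^ n \<partial>\<mu>)) \<le> ?I / (1 - r)" for N
  proof (rule AE_I2)
    fix t assume "t \<in> space \<mu>"
    then have t: "norm t = 1" by simp
    have c: "norm (\<integral>z. f z * cnj z ^ n \<partial>\<mu>) \<le> ?I" for n
    proof -
      have "norm (\<integral>z. f z * cnj z ^ n \<partial>\<mu>) \<le> (\<integral>z. norm (f z * cnj z ^ n) \<partial>\<mu>)"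
        by (rule integral_norm_bound)
      also have "\<dots> = ?I"
        by (rule Bochner_Integration.integral_cong) (auto simp: norm_mult norm_power)
      finally show ?thesis .
    qed
    have "norm (\<Sum>n<N. (of_real r * t) ^ n * (\<integral>z. f z * cnj z ^ n \<partial>\<mu>)) \<le> (\<Sum>n<N. r ^ n * ?I)"
    proof (rule sum_norm_le)
      fix n
      show "norm ((of_real r * t) ^ n * (\<integral>z. f z * cnj z ^ n \<partial>\<mu>)) \<le> r ^ n * ?I"
        using mult_left_mono[OF c[of n], of "r ^ n"] r t by (simp add: norm_mult norm_power)
    qed
    also have "\<dots> = (\<Sum>n<N. r ^ n) * ?I" by (simp add: sum_distrib_right)
    also have "\<dots> \<le> (1 / (1 - r)) * ?I"
      using r sum_le_suminf[OF summable_geometric[of r], of "{..<N}"] suminf_geometric[of r]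
      by (intro mult_right_mono) auto
    finally show "norm (\<Sum>n<N. (of_real r * t) ^ n * (\<integral>z. f z * cnj z ^ n \<partial>\<mu>)) \<le> ?I / (1 - r)" by simp
  qed
qed

lemma integrable_cauchy_kernel:
  assumes f: "f \<in> L_one" and r: "0 \<le> r" "r < 1" and t: "norm t = 1"
  shows "integrable \<mu> (\<lambda>y. f y / (1 - of_real r * (t * cnj y)))"
    "integrable \<mu> (\<lambda>y. f y / (1 - of_real r * (cnj t * y)))"
proof -
  have 1: "1 - of_real r * (t * cnj y) \<noteq> 0" "1 - of_real r * (cnj t * y) \<noteq> 0" if "y \<in> sphere 0 1" for y
    using one_minus_nonzero(1)[OF norm_radius[OF r, of "t * cnj y"]]
      one_minus_nonzero(1)[OF norm_radius[OF r, of "cnj t * y"]] t that by (auto simp: norm_mult)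
  have "continuous_on (sphere 0 1) (\<lambda>y. 1 / (1 - of_real r * (t * cnj y)))"
    "continuous_on (sphere 0 1) (\<lambda>y. 1 / (1 - of_real r * (cnj t * y)))"
    by (intro continuous_intros ballI 1; assumption)+
  from this[THEN integrable_mult_continuous[OF L_oneD(1)[OF f]]]
  show "integrable \<mu> (\<lambda>y. f y / (1 - of_real r * (t * cnj y)))"
    "integrable \<mu> (\<lambda>y. f y / (1 - of_real r * (cnj t * y)))" by auto
qed

lemma poisson_integral_split:
  assumes f: "f \<in> L_one" and r: "0 \<le> r" "r < 1" and t: "norm t = 1"
  shows "poisson_integral r f t = cauchy_integral r f t +
    (\<integral>y. f y / (1 - of_real r * (cnj t * y)) \<partial>\<mu>) - (\<integral>y. f y \<partial>\<mu>)"
proof -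
  have "poisson_integral r f t = (\<integral>y. f y / (1 - of_real r * (t * cnj y)) +
     f y / (1 - of_real r * (cnj t * y)) - f y \<partial>\<mu>)"
    unfolding poisson_integral_def
  proof (rule Bochner_Integration.integral_cong[OF refl])
    fix y assume "y \<in> space \<mu>"
    then have "norm (t * cnj y) = 1" using t by (simp add: norm_mult)
    from poisson_cauchy[OF r this]
    have "f y * of_real (poisson r (t * cnj y)) =
      f y * (1 / (1 - of_real r * (t * cnj y)) + 1 / (1 - of_real r * (cnj t * y)) - 1)" by simp
    then show "f y * of_real (poisson r (t * cnj y)) = f y / (1 - of_real r * (t * cnj y)) +
     f y / (1 - of_real r * (cnj t * y)) - f y"
      by (simp add: right_diff_distrib distrib_left)
  qed
  then show ?thesis
    using integrable_cauchy_kernel[OF f r t] L_oneD(1)[OF f] by (simp add: cauchy_integral_def)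
qed

text \<open>For analytic \<open>f\<close> the coanalytic series reduces to its constant term, which
  cancels the mean in \<open>poisson_integral_split\<close>.\<close>

lemma hardy_poisson_cauchy:
  assumes f: "f \<in> hardy L_one" and r: "0 \<le> r" "r < 1" and t: "norm t = 1"
  shows "poisson_integral r f t = cauchy_integral r f t"
proof -
  note L = hardy_oneD(1)[OF f]
  have "(\<lambda>n. (of_real r * cnj t) ^ n * (\<integral>z. f z * z ^ n \<partial>\<mu>)) sums
     (\<integral>y. f y / (1 - of_real r * (cnj t * y)) \<partial>\<mu>)"
    using integral_geometric[OF L_oneD(1)[OF L], of "of_real r * cnj t" "\<lambda>z. z"] norm_radius[OF r, of "cnj t"] t
    by (auto simp: mult.assoc intro!: continuous_intros)
  moreover have "(of_real r * cnj t) ^ n * (\<integral>z. f z * z ^ n \<partial>\<mu>) = (if n = 0 then (\<integral>z. f z \<partial>\<mu>) else 0)" for n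
    using hardy_oneD(2)[OF f, of n] by simp
  ultimately have "(\<integral>y. f y / (1 - of_real r * (cnj t * y)) \<partial>\<mu>) = (\<integral>z. f z \<partial>\<mu>)"
    using sums_unique2[OF _ sums_single[of 0 "\<lambda>_. \<integral>z. f z \<partial>\<mu>"]] by fastforce
  then show ?thesis using poisson_integral_split[OF L r t] by simp
qed

text \<open>Poisson and Cauchy integrals coincide for analytic functions; along a common sequence of
  radii the former tend to \<open>f\<close> and the latter to \<open>P f\<close>.\<close>

lemma riesz_hardy:
  assumes f: "f \<in> hardy L_one" and pv: "pv_exists f"
  shows "AE t in \<mu>. riesz_projection f t = f t"
proof -
  obtain k where "AE t in \<mu>.
    (\<lambda>j. poisson_integral (radius (k j)) f t) \<longlonglongrightarrow> f t \<and>
    (\<lambda>j. cauchy_integral (radius (k j)) f t) \<longlonglongrightarrow> riesz_projection f t"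
    using riesz_limit[OF pv] by blast
  then show ?thesis using AE_sphere
  proof eventually_elim
    case (elim t)
    then have "(\<lambda>j. cauchy_integral (radius (k j)) f t) \<longlonglongrightarrow> f t" "(\<lambda>j. cauchy_integral (radius (k j)) f t) \<longlonglongrightarrow> riesz_projection f t"
      using hardy_poisson_cauchy[OF f radius, of t] by auto
    then show ?case by (metis LIMSEQ_unique)
  qed
qed

lemma norm_poisson_integral_le:
  assumes f: "f \<in> borel_measurable \<mu>" "AE z in \<mu>. norm (f z) \<le> C"
    and r: "0 \<le> r" "r < 1" and t: "norm t = 1"
  shows "norm (poisson_integral r f t) \<le> C"
proof -
  have "norm (poisson_integral r f t) \<le> (\<integral>y. C * poisson r (t * cnj y) \<partial>\<mu>)"
    unfolding poisson_integral_def
  proof (rule order.trans[OF integral_norm_bound integral_mono_AE])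
    have "AE y in \<mu>. norm (complex_of_real (poisson r (t * cnj y))) \<le> (1 - r\<^sup>2) / (1 - r)\<^sup>2"
      using poisson_le[OF r] poisson_nonneg[OF r] t by (intro AE_I2) (simp add: norm_mult)
    moreover have "integrable \<mu> f"
      by (rule circle.integrable_const_bound[OF f(2,1)])
    ultimately show "integrable \<mu> (\<lambda>y. norm (f y * of_real (poisson r (t * cnj y))))"
      using continuous_imp_circle[OF continuous_on_of_real[OF continuous_poisson[OF r t]]] by (intro integrable_norm integrable_mult_bounded)
    show "integrable \<mu> (\<lambda>y. C * poisson r (t * cnj y))"
      by (intro integrable_mult_right integrable_poisson r t)
  next
    show "AE y in \<mu>. norm (f y * of_real (poisson r (t * cnj y))) \<le> C * poisson r (t * cnj y)"
      using f(2) by eventually_elim (auto simp: norm_mult poisson_nonneg[OF r] intro!: mult_right_mono)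
  qed
  then show ?thesis using integral_poisson[OF r t] by simp
qed

text \<open>The Cauchy integrals of \<open>h\<close> are multipliers and equal its Poisson
  integrals, which keep the bound \<open>C\<close> because the kernel is positive with integral one,
  and which converge to \<open>h\<close> almost everywhere.\<close>

lemma analytic_multiplier_hardy_infty:
  assumes h: "h \<in> hardy L_infty"
  shows "analytic_multiplier h"
proof -
  have hm: "h \<in> borel_measurable \<mu>" using h by (auto simp: hardy_def L_infty_def)
  obtain C where C: "AE z in \<mu>. norm (h z) \<le> C" using h by (auto simp: hardy_def L_infty_def)
  have L: "h \<in> L_one" using circle.integrable_const_bound[OF C hm] by (simp add: L_one_def)
  have H: "h \<in> hardy L_one" using h L by (auto simp: hardy_def)
  obtain k where k: "AE t in \<mu>. (\<lambda>j. poisson_integral (radius (k j)) h t) \<longlonglongrightarrow> h t"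
    using cauchy_poisson_limits[OF L] by auto
  show ?thesis
  proof (rule analytic_multiplier_limit[where s="\<lambda>j. cauchy_integral (radius (k j)) h", OF _ hm])
    show "analytic_multiplier (cauchy_integral (radius (k j)) h)" for j
      by (intro analytic_multiplier_cauchy L radius)
    show "AE t in \<mu>. (\<lambda>j. cauchy_integral (radius (k j)) h t) \<longlonglongrightarrow> h t"
      using k AE_sphere by eventually_elim (simp add: hardy_poisson_cauchy[OF H radius])
    show "AE t in \<mu>. norm (cauchy_integral (radius (k j)) h t) \<le> C" for j
      using AE_sphere by eventually_elim
        (use norm_poisson_integral_le[OF hm C radius] hardy_poisson_cauchy[OF H radius] in simp)
  qed
qed

section \<open>Outer functions\<close>

text \<open>For real \<open>u\<close> the coanalytic part of the Poisson integral is the conjugate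
  of the analytic part, so the left side is the real part of the Herglotz integral.\<close>

lemma Re_herglotz:
  assumes u: "(\<lambda>z. complex_of_real (u z)) \<in> L_one" and r: "0 \<le> r" "r < 1" and t: "norm t = 1"
  shows "Re (2 * cauchy_integral r (\<lambda>z. of_real (u z)) t - (\<integral>z. of_real (u z) \<partial>\<mu>)) =
    Re (poisson_integral r (\<lambda>z. of_real (u z)) t)"
proof -
  have "cnj (cauchy_integral r (\<lambda>z. of_real (u z)) t) = (\<integral>y. of_real (u y) / (1 - of_real r * (cnj t * y)) \<partial>\<mu>)"
    unfolding cauchy_integral_def by (simp flip: Bochner_Integration.integral_cnj)
  then have "Re (\<integral>y. of_real (u y) / (1 - of_real r * (cnj t * y)) \<partial>\<mu>) =
      Re (cauchy_integral r (\<lambda>z. of_real (u z)) t)" by (metis cnj.simps(1))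
  then show ?thesis using poisson_integral_split[OF u r t] by simp
qed

lemma Re_poisson_integral_le:
  assumes u: "(\<lambda>z. complex_of_real (u z)) \<in> L_one" and le: "\<And>z. u z \<le> C"
    and r: "0 \<le> r" "r < 1" and t: "norm t = 1"
  shows "Re (poisson_integral r (\<lambda>z. of_real (u z)) t) \<le> C"
proof -
  have ui: "integrable \<mu> u" using integrable_Re[OF L_oneD(1)[OF u]] by simp
  have "poisson_integral r (\<lambda>z. of_real (u z)) t = (\<integral>y. of_real (u y * poisson r (t * cnj y)) \<partial>\<mu>)"
    by (simp add: poisson_integral_def)
  also have "\<dots> = of_real (\<integral>y. u y * poisson r (t * cnj y) \<partial>\<mu>)"
    by (rule integral_complex_of_real)
  finally have "Re (poisson_integral r (\<lambda>z. of_real (u z)) t) = (\<integral>y. u y * poisson r (t * cnj y) \<partial>\<mu>)"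
    by simp
  also have "\<dots> \<le> (\<integral>y. C * poisson r (t * cnj y) \<partial>\<mu>)"
  proof (rule integral_mono)
    have "integrable \<mu> (\<lambda>y. complex_of_real (u y) * of_real (poisson r (t * cnj y)))"
      by (intro integrable_mult_continuous L_oneD u continuous_intros continuous_poisson r t)
    from integrable_Re[OF this]
    show "integrable \<mu> (\<lambda>y. u y * poisson r (t * cnj y))" by simp
    show "integrable \<mu> (\<lambda>y. C * poisson r (t * cnj y))"
      by (intro integrable_mult_right integrable_poisson r t)
    show "u y * poisson r (t * cnj y) \<le> C * poisson r (t * cnj y)" for y
      by (intro mult_right_mono le poisson_nonneg r)
  qed
  also have "\<dots> = C" using integral_poisson[OF r t] by simp
  finally show ?thesis .
qed

text \<open>Boundary values of the Herglotz integral of \<open>u\<close>; the outer function with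
  modulus \<open>exp u\<close> is its exponential. \<open>P\<close> keeps the constant term entire,
  so \<open>2 * P u\<close> contains the mean twice and it is subtracted once.\<close>

definition outer_log :: "(complex \<Rightarrow> real) \<Rightarrow> complex \<Rightarrow> complex" where
  "outer_log u t = 2 * riesz_projection (\<lambda>z. of_real (u z)) t - (\<integral>z. of_real (u z) \<partial>\<mu>)"

text \<open>The Herglotz integrals converge to \<open>outer_log u\<close>, and their real parts are
  Poisson integrals, which converge to \<open>u\<close>. This fixes the modulus of the outer
  function.\<close>

lemma outer_log_limit:
  assumes u: "pv_exists (\<lambda>z. complex_of_real (u z))"
  shows "\<exists>k. strict_mono k \<and> (AE t in \<mu>. Re (outer_log u t) = u t \<and>
    (\<lambda>j. 2 * cauchy_integral (radius (k j)) (\<lambda>z. of_real (u z)) t - (\<integral>z. of_real (u z) \<partial>\<mu>)) \<longlonglongrightarrow> outer_log u t)"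
proof -
  have L: "(\<lambda>z. complex_of_real (u z)) \<in> L_one" using u by (simp add: pv_exists_def)
  obtain k where k: "strict_mono k" "AE t in \<mu>.
    (\<lambda>j. poisson_integral (radius (k j)) (\<lambda>z. of_real (u z)) t) \<longlonglongrightarrow> of_real (u t) \<and>
    (\<lambda>j. cauchy_integral (radius (k j)) (\<lambda>z. of_real (u z)) t) \<longlonglongrightarrow> riesz_projection (\<lambda>z. of_real (u z)) t"
    using riesz_limit[OF u] by blast
  have "AE t in \<mu>. Re (outer_log u t) = u t \<and>
    (\<lambda>j. 2 * cauchy_integral (radius (k j)) (\<lambda>z. of_real (u z)) t - (\<integral>z. of_real (u z) \<partial>\<mu>)) \<longlonglongrightarrow> outer_log u t"
    using k(2) AE_sphere
  proof eventually_elim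
    case (elim t)
    have lim: "(\<lambda>j. 2 * cauchy_integral (radius (k j)) (\<lambda>z. of_real (u z)) t - (\<integral>z. of_real (u z) \<partial>\<mu>)) \<longlonglongrightarrow> outer_log u t"
      unfolding outer_log_def using elim by (intro tendsto_intros) auto
    have "(\<lambda>j. Re (2 * cauchy_integral (radius (k j)) (\<lambda>z. of_real (u z)) t - (\<integral>z. of_real (u z) \<partial>\<mu>))) \<longlonglongrightarrow> Re (outer_log u t)"
      by (rule tendsto_Re[OF lim])
    moreover have "(\<lambda>j. Re (poisson_integral (radius (k j)) (\<lambda>z. of_real (u z)) t)) \<longlonglongrightarrow> Re (of_real (u t))"
      using elim by (intro tendsto_Re) auto
    ultimately have "Re (outer_log u t) = Re (of_real (u t))"
      using Re_herglotz[OF L radius, of t] elim LIMSEQ_unique by auto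
    then show ?case using lim by simp
  qed
  then show ?thesis using k(1) by blast
qed

text \<open>Truncating \<open>u\<close> from above makes the outer function bounded without increasing its modulus,
  so the limit \<open>n \<rightarrow> \<infinity>\<close> is dominated.\<close>

lemma outer_mult_hardy:
  assumes u: "pv_exists (\<lambda>z. complex_of_real (u z))"
    and v: "\<And>n::nat. pv_exists (\<lambda>z. complex_of_real (max 0 (u z - real n)))"
    and meas: "\<And>n::nat. riesz_projection (\<lambda>z. complex_of_real (max 0 (u z - real n))) \<in> borel_measurable \<mu>"
    and h: "h \<in> borel_measurable \<mu>" "AE z in \<mu>. h z = outer_log u z"
    and k: "strict_mono k" "AE t in \<mu>.
      (\<lambda>j. riesz_projection (\<lambda>z. complex_of_real (max 0 (u z - real (k j)))) t) \<longlonglongrightarrow> 0"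
    and f: "f \<in> hardy L_one" and w: "(\<lambda>z. of_real (exp (u z)) * f z) \<in> L_one"
  shows "(\<lambda>z. exp (h z) * f z) \<in> hardy L_one"
proof -
  have uL: "(\<lambda>z. complex_of_real (u z)) \<in> L_one" using u by (simp add: pv_exists_def)
  have ui: "integrable \<mu> u" using integrable_Re[OF L_oneD(1)[OF uL]] by simp
  define vn where "vn n z = max 0 (u z - real n)" for n z
  define un where "un n z = min (u z) (real n)" for n z
  have un: "complex_of_real (un n z) = of_real (u z) + (-1) * of_real (vn n z)" for n z
    by (simp add: un_def vn_def min_def max_def)
  have v': "pv_exists (\<lambda>z. complex_of_real (vn n z))" for n using v by (simp add: vn_def)
  have upv: "pv_exists (\<lambda>z. complex_of_real (un n z))" for n
    unfolding un by (intro pv_exists_add pv_exists_cmult u v')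
  have unL: "(\<lambda>z. complex_of_real (un n z)) \<in> L_one" and vnL: "(\<lambda>z. complex_of_real (vn n z)) \<in> L_one" for n
    using upv v' by (auto simp: pv_exists_def)
  have hn: "AE z in \<mu>. outer_log (un n) z = h z - outer_log (vn n) z" for n
  proof -
    have eq: "(\<integral>z. complex_of_real (un n z) \<partial>\<mu>) =
        (\<integral>z. complex_of_real (u z) \<partial>\<mu>) - (\<integral>z. complex_of_real (vn n z) \<partial>\<mu>)"
      unfolding un using L_oneD(1)[OF uL] L_oneD(1)[OF vnL[of n]] by simp
    have "AE z in \<mu>. riesz_projection (\<lambda>z. complex_of_real (un n z)) z =
        riesz_projection (\<lambda>z. of_real (u z)) z + riesz_projection (\<lambda>z. (-1) * of_real (vn n z)) z"
      unfolding un by (intro pv_exists_add pv_exists_cmult u v')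
    moreover have "AE z in \<mu>. riesz_projection (\<lambda>z. (-1) * of_real (vn n z)) z = (-1) * riesz_projection (\<lambda>z. of_real (vn n z)) z"
      by (intro pv_exists_cmult v')
    ultimately show ?thesis using h(2)
      by eventually_elim (simp only: outer_log_def eq, simp add: algebra_simps)
  qed
  \<comment> \<open>\<open>un n\<close> need not lie in a space on which \<open>P\<close> acts, so
    \<open>outer_log (un n)\<close> is not known to be measurable. \<open>hh n\<close> is a
    measurable version of it.\<close>
  define hh where "hh n z = h z - outer_log (vn n) z" for n z
  have hhm: "hh n \<in> borel_measurable \<mu>" for n
    unfolding hh_def outer_log_def using h(1) meas[of n] by (simp add: vn_def)
  have am: "analytic_multiplier (\<lambda>z. exp (hh n z))" for n
  proof -
    obtain m where m: "AE t in \<mu>. Re (outer_log (un n) t) = un n t \<and>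
      (\<lambda>j. 2 * cauchy_integral (radius (m j)) (\<lambda>z. of_real (un n z)) t - (\<integral>z. of_real (un n z) \<partial>\<mu>)) \<longlonglongrightarrow> outer_log (un n) t"
      using outer_log_limit[OF upv[of n]] by blast
    let ?s = "\<lambda>j t. 2 * cauchy_integral (radius (m j)) (\<lambda>z. of_real (un n z)) t + - (\<integral>z. of_real (un n z) \<partial>\<mu>)"
    show ?thesis
    proof (rule analytic_multiplier_limit[where s="\<lambda>j t. exp (?s j t)" and C="exp (real n)"])
      show "analytic_multiplier (\<lambda>t. exp (?s j t))" for j
        by (intro analytic_multiplier_exp analytic_multiplier_add analytic_multiplier_mult
            analytic_multiplier_const analytic_multiplier_cauchy unL radius)
      show "(\<lambda>z. exp (hh n z)) \<in> borel_measurable \<mu>" using hhm by auto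
      show "AE t in \<mu>. (\<lambda>j. exp (?s j t)) \<longlonglongrightarrow> exp (hh n t)"
        using m hn[of n] by eventually_elim (auto simp: hh_def intro!: tendsto_exp)
      \<comment> \<open>The modulus is the exponential of the Poisson integral of
        \<open>un n\<close>, and \<open>un n\<close> is at most \<open>n\<close>.\<close>
      show "AE t in \<mu>. norm (exp (?s j t)) \<le> exp (real n)" for j
      proof (rule AE_I2)
        fix t assume "t \<in> space \<mu>"
        then have t: "norm t = 1" by simp
        show "norm (exp (?s j t)) \<le> exp (real n)"
          using Re_herglotz[OF unL[of n] radius t, of "m j"] Re_poisson_integral_le[OF unL[of n] _ radius t, of "real n" "m j"]
          by (simp add: norm_exp_eq_Re un_def)
      qed
    qed
  qed
  have Re_hh: "AE z in \<mu>. Re (hh n z) = un n z" for n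
  proof -
    obtain m :: "nat \<Rightarrow> nat" where "AE t in \<mu>. Re (outer_log (un n) t) = un n t"
      using outer_log_limit[OF upv[of n]] by auto
    then show ?thesis using hn[of n] by eventually_elim (simp add: hh_def)
  qed
  have int0: "(\<lambda>j. \<integral>z. complex_of_real (vn (k j) z) \<partial>\<mu>) \<longlonglongrightarrow> (\<integral>z. 0 \<partial>\<mu>)"
  proof (rule integral_dominated_convergence[where w="\<lambda>z. \<bar>u z\<bar>"])
    show "AE z in \<mu>. (\<lambda>j. complex_of_real (vn (k j) z)) \<longlonglongrightarrow> 0"
    proof (rule AE_I2)
      fix z
      obtain N where N: "u z \<le> real N" using real_arch_simple by blast
      have "complex_of_real (vn (k j) z) = 0" if "j \<ge> N" for j
      proof -
        have "N \<le> k j" using that seq_suble[OF k(1), of j] by linarith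
        then have "real N \<le> real (k j)" by simp
        then show ?thesis using N by (simp add: vn_def)
      qed
      then show "(\<lambda>j. complex_of_real (vn (k j) z)) \<longlonglongrightarrow> 0"
        by (intro tendsto_eventually) (auto simp: eventually_sequentially)
    qed
    show "AE z in \<mu>. norm (complex_of_real (vn (k j) z)) \<le> \<bar>u z\<bar>" for j
      by (rule AE_I2) (auto simp: vn_def)
    show "(\<lambda>z. complex_of_real (vn (k j) z)) \<in> borel_measurable \<mu>" for j
      using L_oneD(2)[OF vnL] .
  qed (use ui in auto)
  have wi: "integrable \<mu> (\<lambda>z. norm (of_real (exp (u z)) * f z))"
    using L_oneD(1)[OF w] by (rule integrable_norm)
  show ?thesis
  proof (rule hardy_one_limit[where s="\<lambda>j z. exp (hh (k j) z) * f z", OF _ _ _ _ wi])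
    show "(\<lambda>z. exp (hh (k j) z) * f z) \<in> hardy L_one" for j
      using am f by (auto simp: analytic_multiplier_def)
    show "(\<lambda>z. exp (h z) * f z) \<in> borel_measurable \<mu>"
      using h(1) L_oneD(2)[OF hardy_oneD(1)[OF f]] by auto
    show "AE z in \<mu>. (\<lambda>j. exp (hh (k j) z) * f z) \<longlonglongrightarrow> exp (h z) * f z"
      using k(2)
    proof eventually_elim
      case (elim t)
      have "(\<lambda>j. hh (k j) t) \<longlonglongrightarrow> h t - (2 * 0 - (\<integral>z. 0 \<partial>\<mu>))"
        unfolding hh_def outer_log_def vn_def
        by (intro tendsto_intros elim int0[unfolded vn_def])
      then show ?case by (intro tendsto_intros) simp
    qed
    show "AE z in \<mu>. norm (exp (hh (k j) z) * f z) \<le> norm (of_real (exp (u z)) * f z)" for j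
      using Re_hh[of "k j"]
      by eventually_elim (auto simp: norm_mult un_def intro!: mult_right_mono)
  qed
qed

section \<open>Solid function spaces\<close>

text \<open>What X and X(w) have in common before \<open>P\<close> enters. The weighted norm is not
  known to dominate the L1 norm, so \<open>AE_subseq\<close> takes the place of an embedding: it
  survives division by a weight that is positive almost everywhere.\<close>

locale function_space =
  fixes Y :: "(complex \<Rightarrow> complex) set" and N :: "(complex \<Rightarrow> complex) \<Rightarrow> ennreal"
  assumes meas: "f \<in> Y \<Longrightarrow> f \<in> borel_measurable \<mu>"
    and solid: "f \<in> Y \<Longrightarrow> g \<in> borel_measurable \<mu> \<Longrightarrow>
      AE z in \<mu>. norm (g z) \<le> norm (f z) \<Longrightarrow> g \<in> Y \<and> N g \<le> N f"
    and add: "f \<in> Y \<Longrightarrow> g \<in> Y \<Longrightarrow> (\<lambda>z. f z + g z) \<in> Y \<and> N (\<lambda>z. f z + g z) \<le> N f + N g"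
    and scale: "f \<in> Y \<Longrightarrow> (\<lambda>z. c * f z) \<in> Y \<and> N (\<lambda>z. c * f z) = ennreal (norm c) * N f"
    and finite: "f \<in> Y \<Longrightarrow> N f < \<infinity>"
    and AE_subseq: "(\<And>n::nat. F n \<in> Y) \<Longrightarrow> (\<lambda>n. N (F n)) \<longlonglongrightarrow> 0 \<Longrightarrow>
      \<exists>k. strict_mono k \<and> (AE z in \<mu>. (\<lambda>n. F (k n) z) \<longlonglongrightarrow> 0)"
begin

lemma cong:
  assumes f: "f \<in> Y" and ae: "AE z in \<mu>. f z = g z"
  shows "g \<in> Y" "N g = N f"
proof -
  have g: "g \<in> borel_measurable \<mu>"
    using meas[OF f] ae by (rule circle_measurable_AE)
  have "AE z in \<mu>. norm (g z) \<le> norm (f z)" using ae by eventually_elim simp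
  from solid[OF f g this] have gY: "g \<in> Y" and 1: "N g \<le> N f" by auto
  show "g \<in> Y" by fact
  have "AE z in \<mu>. norm (f z) \<le> norm (g z)" using ae by eventually_elim simp
  from solid[OF gY meas[OF f] this] 1 show "N g = N f" by auto
qed

lemma diff: "f \<in> Y \<Longrightarrow> g \<in> Y \<Longrightarrow> (\<lambda>z. f z - g z) \<in> Y \<and> N (\<lambda>z. f z - g z) \<le> N f + N g"
  using add[of f "\<lambda>z. (-1) * g z"] scale[of g "-1"] by simp

lemma norm_zero: "f \<in> Y \<Longrightarrow> N f = 0 \<Longrightarrow> AE z in \<mu>. f z = 0"
  using AE_subseq[of "\<lambda>_. f"] by (auto simp: LIMSEQ_const_iff elim!: eventually_mono)

lemma unimodular:
  assumes f: "f \<in> Y" and g: "continuous_on (sphere 0 1) g" "\<And>z. norm z = 1 \<Longrightarrow> norm (g z) = 1"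
  shows "(\<lambda>z. g z * f z) \<in> Y" "N (\<lambda>z. g z * f z) \<le> N f"
proof -
  have "(\<lambda>z. g z * f z) \<in> borel_measurable \<mu>"
    using meas[OF f] continuous_imp_circle[OF g(1)] by simp
  moreover have "AE z in \<mu>. norm (g z * f z) \<le> norm (f z)"
    using AE_sphere by eventually_elim (simp add: norm_mult g(2))
  ultimately show "(\<lambda>z. g z * f z) \<in> Y" "N (\<lambda>z. g z * f z) \<le> N f" using solid[OF f] by auto
qed

lemma bounded_multiplier:
  assumes f: "f \<in> Y" and g: "g \<in> borel_measurable \<mu>" "AE z in \<mu>. norm (g z) \<le> C"
  shows "(\<lambda>z. g z * f z) \<in> Y" "N (\<lambda>z. g z * f z) \<le> ennreal \<bar>C\<bar> * N f"
proof -
  have m: "(\<lambda>z. g z * f z) \<in> borel_measurable \<mu>" using meas[OF f] g(1) by simp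
  have "AE z in \<mu>. norm (g z * f z) \<le> norm (of_real C * f z)"
    using g(2) by eventually_elim (auto simp: norm_mult intro!: mult_right_mono)
  from solid[OF conjunct1[OF scale[OF f]] m this] scale[OF f, of "of_real C"]
  show "(\<lambda>z. g z * f z) \<in> Y" "N (\<lambda>z. g z * f z) \<le> ennreal \<bar>C\<bar> * N f" by auto
qed

lemma weighted:
  fixes v :: "complex \<Rightarrow> real"
  assumes v: "v \<in> borel_measurable \<mu>" "AE z in \<mu>. v z > 0"
  shows "function_space {f \<in> borel_measurable \<mu>. (\<lambda>z. f z * of_real (v z)) \<in> Y}
    (\<lambda>f. N (\<lambda>z. f z * of_real (v z)))"
proof
  let ?Y = "{f \<in> borel_measurable \<mu>. (\<lambda>z. f z * of_real (v z)) \<in> Y}"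
  have vm: "(\<lambda>z. f z * of_real (v z)) \<in> borel_measurable \<mu>" if "f \<in> borel_measurable \<mu>" for f :: "complex \<Rightarrow> complex"
    using that v(1) by measurable
  fix f g :: "complex \<Rightarrow> complex" and c :: complex
  assume f: "f \<in> ?Y"
  show "f \<in> borel_measurable \<mu>" using f by simp
  show "g \<in> ?Y \<and> N (\<lambda>z. g z * of_real (v z)) \<le> N (\<lambda>z. f z * of_real (v z))"
    if g: "g \<in> borel_measurable \<mu>" "AE z in \<mu>. norm (g z) \<le> norm (f z)"
  proof -
    have "AE z in \<mu>. norm (g z * of_real (v z)) \<le> norm (f z * of_real (v z))"
      using g(2) by eventually_elim (simp add: norm_mult mult_right_mono)
    then show ?thesis using solid[of "\<lambda>z. f z * of_real (v z)" "\<lambda>z. g z * of_real (v z)"] f g vm by auto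
  qed
  show "(\<lambda>z. f z + g z) \<in> ?Y \<and> N (\<lambda>z. (f z + g z) * of_real (v z)) \<le> N (\<lambda>z. f z * of_real (v z)) + N (\<lambda>z. g z * of_real (v z))"
    if "g \<in> ?Y"
    using that f add[of "\<lambda>z. f z * of_real (v z)" "\<lambda>z. g z * of_real (v z)"] by (auto simp: distrib_right)
  show "(\<lambda>z. c * f z) \<in> ?Y \<and> N (\<lambda>z. c * f z * of_real (v z)) = ennreal (norm c) * N (\<lambda>z. f z * of_real (v z))"
    using f scale[of "\<lambda>z. f z * of_real (v z)" c] by (auto simp: mult.assoc)
  show "N (\<lambda>z. f z * of_real (v z)) < \<infinity>" using f finite by auto
next
  fix F :: "nat \<Rightarrow> complex \<Rightarrow> complex"
  assume "\<And>n. F n \<in> {f \<in> borel_measurable \<mu>. (\<lambda>z. f z * of_real (v z)) \<in> Y}"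
    "(\<lambda>n. N (\<lambda>z. F n z * of_real (v z))) \<longlonglongrightarrow> 0"
  then obtain k where k: "strict_mono k" "AE z in \<mu>. (\<lambda>n. F (k n) z * of_real (v z)) \<longlonglongrightarrow> 0"
    using AE_subseq[of "\<lambda>n z. F n z * of_real (v z)"] by auto
  have "AE z in \<mu>. (\<lambda>n. F (k n) z) \<longlonglongrightarrow> 0"
    using k(2) v(2)
  proof eventually_elim
    case (elim z)
    from tendsto_mult_right[OF elim(1), of "1 / of_real (v z)"] elim(2) show ?case by simp
  qed
  then show "\<exists>k. strict_mono k \<and> (AE z in \<mu>. (\<lambda>n. F (k n) z) \<longlonglongrightarrow> 0)" using k(1) by blast
qed

text \<open>Each test function settles existence off the set where its own principal value vanishes,
  and almost no point belongs to both of these sets.\<close>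

lemma pv_exists_all:
  assumes riesz: "riesz_bounded_on Y N"
    and g: "g1 \<in> Y" "g2 \<in> Y" "pv_exists g1" "pv_exists g2"
    and ne: "AE t in \<mu>. \<not> (has_pv g1 t 0 \<and> has_pv g2 t 0)"
    and f: "f \<in> Y"
  shows "pv_exists f"
proof -
  have fL: "f \<in> L_one" using riesz f by (auto simp: riesz_bounded_on_def)
  have "AE z in \<mu>. riesz_projection (\<lambda>z. f z + g z) z = riesz_projection f z + riesz_projection g z"
    if "g \<in> Y" for g
    using riesz f that by (auto simp: riesz_bounded_on_def bounded_operator_def)
  then have "AE t in \<mu>. (\<exists>l. has_pv f t l) \<or> has_pv g t 0" if "g \<in> Y" "pv_exists g" for g
    using pv_dichotomy[OF fL] that by blast
  from this[OF g(1,3)] this[OF g(2,4)] ne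
  have "AE t in \<mu>. \<exists>l. has_pv f t l" by eventually_elim blast
  then show ?thesis using fL by (simp add: pv_exists_def)
qed

end

locale riesz_space = function_space +
  assumes riesz: "riesz_bounded_on Y N" and one: "(\<lambda>_. 1) \<in> Y" and pv: "f \<in> Y \<Longrightarrow> pv_exists f"

lemma pv_exists_one: "pv_exists (\<lambda>_. 1)"
  unfolding pv_exists_def
proof
  show "AE t in \<mu>. \<exists>l. has_pv (\<lambda>_. 1) t l"
    using AE_sphere by eventually_elim (use has_pv_one in auto)
qed (rule L_one_const)

text \<open>The constant \<open>1\<close> has principal value \<open>1 / 2\<close> at every point of
  the circle, so the second alternative of \<open>pv_dichotomy\<close> never occurs.\<close>

lemma (in function_space) riesz_spaceI:
  assumes riesz: "riesz_bounded_on Y N" and one: "(\<lambda>_. 1) \<in> Y"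
  shows "riesz_space Y N"
proof
  show "pv_exists f" if "f \<in> Y" for f
  proof (rule pv_exists_all[OF riesz one one pv_exists_one pv_exists_one _ that])
    show "AE t in \<mu>. \<not> (has_pv (\<lambda>_. 1) t 0 \<and> has_pv (\<lambda>_. 1) t 0)"
      using AE_sphere
    proof eventually_elim
      case (elim t)
      then have "has_pv (\<lambda>_. 1) t (1 / 2)" by (intro has_pv_one) simp
      then show ?case using tendsto_unique[of "at_right (0::real)"] by (fastforce simp: has_pv_def)
    qed
  qed
qed fact+

text \<open>The constants come out of the commutator of \<open>P\<close> with multiplication by \<open>cnj z\<close>.\<close>

lemma (in function_space) riesz_space_of_mean:
  assumes riesz: "riesz_bounded_on Y N"
    and g: "g \<in> Y" "pv_exists g" "(\<integral>z. g z \<partial>\<mu>) \<noteq> 0"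
  shows "riesz_space Y N"
proof -
  let ?g = "\<lambda>z. cnj z * g z"
  have g2: "?g \<in> Y" by (rule unimodular(1)[OF g(1)]) (auto intro: continuous_intros)
  have gL: "g \<in> L_one" using g(2) by (simp add: pv_exists_def)
  have PY: "riesz_projection f \<in> Y" if "f \<in> Y" for f
    using riesz that by (auto simp: riesz_bounded_on_def bounded_operator_def)
  have "(\<lambda>t. t * riesz_projection ?g t) \<in> Y"
    by (rule unimodular(1)[OF PY[OF g2]]) (auto intro: continuous_intros)
  then have "(\<lambda>t. riesz_projection g t - t * riesz_projection ?g t) \<in> Y" using diff PY[OF g(1)] by blast
  from cong(1)[OF this pv_exists_shift(2)[OF g(2)]]
  have "(\<lambda>t. \<integral>z. g z \<partial>\<mu>) \<in> Y" .
  from conjunct1[OF scale[OF this, of "1 / (\<integral>z. g z \<partial>\<mu>)"]] g(3)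
  have one: "(\<lambda>_. 1) \<in> Y" by simp
  then show ?thesis by (rule riesz_spaceI[OF riesz])
qed

context riesz_space
begin

lemma integrable: "f \<in> Y \<Longrightarrow> f \<in> L_one"
  using riesz by (auto simp: riesz_bounded_on_def)

lemma hardy_Y: "f \<in> hardy Y \<longleftrightarrow> f \<in> Y \<and> f \<in> hardy L_one"
  by (rule hardy_iff) (use integrable in auto)

lemma riesz_in: "f \<in> Y \<Longrightarrow> riesz_projection f \<in> Y"
  using riesz by (auto simp: riesz_bounded_on_def bounded_operator_def)

lemma riesz_norm: "\<exists>C\<ge>0. \<forall>f\<in>Y. N (riesz_projection f) \<le> ennreal C * N f"
proof -
  obtain C where C: "\<forall>f\<in>Y. N (riesz_projection f) \<le> ennreal C * N f"
    using riesz by (auto simp: riesz_bounded_on_def bounded_operator_def)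
  \<comment> \<open>\<open>ennreal\<close> maps negative reals to zero, so the bound itself is
    unchanged.\<close>
  have "ennreal (max C 0) = ennreal C" by (simp add: max_def ennreal_neg)
  then show ?thesis using C by (intro exI[of _ "max C 0"]) auto
qed

lemma norm_one: "N (\<lambda>_. 1) \<noteq> 0"
  using norm_zero[OF one] by auto

lemma const: "(\<lambda>_. c) \<in> Y" "N (\<lambda>_. c) = ennreal (norm c) * N (\<lambda>_. 1)"
  using scale[OF one, of c] by auto

text \<open>The inclusion of \<open>Y\<close> in \<open>L_one\<close> carries no norm estimate. The
  commutator identity expresses the constant function with the mean as value through
  \<open>P\<close> and unimodular factors, which gives \<open>2 * C\<close> divided by the norm of
  \<open>1\<close>.\<close>

lemma mean_bound: "\<exists>C\<ge>0. \<forall>f\<in>Y. ennreal (norm (\<integral>z. f z \<partial>\<mu>)) \<le> ennreal C * N f"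
proof -
  obtain C where C: "C \<ge> 0" "\<And>f. f \<in> Y \<Longrightarrow> N (riesz_projection f) \<le> ennreal C * N f"
    using riesz_norm by auto
  obtain n1 where n1: "N (\<lambda>_. 1) = ennreal n1" "n1 > 0"
    using finite[OF one] norm_one by (cases "N (\<lambda>_. 1)") (auto simp: less_le)
  have "ennreal (norm (\<integral>z. f z \<partial>\<mu>)) \<le> ennreal (2 * C / n1) * N f" if f: "f \<in> Y" for f
  proof -
    let ?g = "\<lambda>z. cnj z * f z"
    have g: "?g \<in> Y" "N ?g \<le> N f" by (rule unimodular[OF f]; auto intro: continuous_intros)+
    have t: "(\<lambda>t. t * riesz_projection ?g t) \<in> Y" "N (\<lambda>t. t * riesz_projection ?g t) \<le> N (riesz_projection ?g)"
      by (rule unimodular[OF riesz_in[OF g(1)]]; auto intro: continuous_intros)+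
    note d = diff[OF riesz_in[OF f] t(1)]
    have "ennreal (norm (\<integral>z. f z \<partial>\<mu>)) * ennreal n1 = N (\<lambda>t. \<integral>z. f z \<partial>\<mu>)"
      using const(2)[of "\<integral>z. f z \<partial>\<mu>"] n1(1) by (simp only:)
    also have "\<dots> = N (\<lambda>t. riesz_projection f t - t * riesz_projection ?g t)"
      using cong(2)[OF conjunct1[OF d] pv_exists_shift(2)[OF pv[OF f]]] .
    also have "\<dots> \<le> N (riesz_projection f) + N (riesz_projection ?g)"
      using d t(2) by (meson add_left_mono order_trans)
    also have "\<dots> \<le> ennreal C * N f + ennreal C * N f"
      using C(2)[OF f] C(2)[OF g(1)] g(2) by (meson add_mono mult_left_mono order_trans zero_le)
    also have "\<dots> = ennreal (2 * C) * N f"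
      using C(1) by (simp add: distrib_right[symmetric] ennreal_plus[symmetric] del: ennreal_plus)
    finally have *: "ennreal (norm (\<integral>z. f z \<partial>\<mu>)) * ennreal n1 \<le> ennreal (2 * C) * N f" .
    obtain x where x: "N f = ennreal x" "x \<ge> 0" using finite[OF f] by (cases "N f") auto
    have "norm (\<integral>z. f z \<partial>\<mu>) * n1 \<le> 2 * C * x"
      using * x n1 C(1) by (simp add: ennreal_mult[symmetric])
    then show ?thesis using x n1 C(1) by (simp add: ennreal_mult[symmetric] field_simps)
  qed
  then show ?thesis using C(1) n1(2) by (intro exI[of _ "2 * C / n1"]) auto
qed

lemma riesz_fix: "f \<in> hardy Y \<Longrightarrow> AE t in \<mu>. riesz_projection f t = f t"
  using riesz_hardy pv by (simp add: hardy_Y)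

end

section \<open>The backward shift\<close>

text \<open>This is \<open>T(cnj z)\<close> on analytic functions, written without \<open>P\<close>
  so that linearity is an equation of functions on all of \<open>L_one\<close> and not only almost
  everywhere.\<close>

definition backward_shift :: "(complex \<Rightarrow> complex) \<Rightarrow> complex \<Rightarrow> complex" where
  "backward_shift f z = cnj z * (f z - (\<integral>z. f z \<partial>\<mu>))"

lemma cnj_mult_self: "norm z = 1 \<Longrightarrow> cnj z * z = 1"
  by (metis complex_norm_square mult.commute of_real_1 power_one)

context riesz_space
begin

lemma shift_in: "f \<in> Y \<Longrightarrow> backward_shift f \<in> Y"
  unfolding backward_shift_def[abs_def]
  by (rule unimodular(1)) (use diff const in \<open>auto intro: continuous_intros\<close>)

text \<open>Division by \<open>z\<close> would move the coefficient of index \<open>0\<close> to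
  index \<open>-1\<close>, but this coefficient is the mean that has been subtracted.\<close>

lemma shift_hardy:
  assumes f: "f \<in> hardy Y" shows "backward_shift f \<in> hardy Y"
proof -
  have fY: "f \<in> Y" and fH: "f \<in> hardy L_one" using f by (auto simp: hardy_Y)
  note fL = integrable[OF fY]
  have "(\<integral>z. backward_shift f z * z ^ k \<partial>\<mu>) = 0" if k: "k \<ge> 1" for k
  proof -
    obtain j where j: "k = Suc j" using k by (cases k) auto
    have "(\<integral>z. backward_shift f z * z ^ k \<partial>\<mu>) =
        (\<integral>z. f z * z ^ j - (\<integral>z. f z \<partial>\<mu>) * z ^ j \<partial>\<mu>)"
    proof (rule Bochner_Integration.integral_cong[OF refl])
      fix z assume "z \<in> space \<mu>"
      then have "cnj z * z = 1" by (simp add: cnj_mult_self)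
      have "backward_shift f z * z ^ k = (cnj z * z) * ((f z - (\<integral>z. f z \<partial>\<mu>)) * z ^ j)"
        by (simp add: backward_shift_def j)
      also have "\<dots> = f z * z ^ j - (\<integral>z. f z \<partial>\<mu>) * z ^ j"
        by (simp only: \<open>cnj z * z = 1\<close>) (simp add: left_diff_distrib)
      finally show "backward_shift f z * z ^ k = f z * z ^ j - (\<integral>z. f z \<partial>\<mu>) * z ^ j" .
    qed
    also have "\<dots> = (\<integral>z. f z * z ^ j \<partial>\<mu>) - (\<integral>z. f z \<partial>\<mu>) * (\<integral>z. z ^ j \<partial>\<mu>)"
      using integrable_mult_power[OF fL, of j] integrable_mult_power[OF L_one_const[of 1], of j] by simp
    also have "\<dots> = 0"
      using hardy_oneD(2)[OF fH, of j] integral_circle_power[of j] circle.prob_space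
      by (cases "j = 0") auto
    finally show ?thesis .
  qed
  then show ?thesis
    using shift_in[OF fY] integrable[OF shift_in[OF fY]] by (simp add: hardy_Y hardy_L_one_iff)
qed

lemma shift_norm: "\<exists>C\<ge>0. \<forall>f\<in>Y. N (backward_shift f) \<le> ennreal C * N f"
proof -
  obtain C where C: "C \<ge> 0" "\<And>f. f \<in> Y \<Longrightarrow> ennreal (norm (\<integral>z. f z \<partial>\<mu>)) \<le> ennreal C * N f"
    using mean_bound by auto
  obtain n1 where n1: "N (\<lambda>_. 1) = ennreal n1" "n1 \<ge> 0"
    using finite[OF one] by (cases "N (\<lambda>_. 1)") auto
  have "N (backward_shift f) \<le> ennreal (1 + C * n1) * N f" if f: "f \<in> Y" for f
  proof -
    note d = diff[OF f const(1)[of "\<integral>z. f z \<partial>\<mu>"]]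
    have "N (backward_shift f) \<le> N (\<lambda>z. f z - (\<integral>z. f z \<partial>\<mu>))"
      unfolding backward_shift_def[abs_def]
      by (rule unimodular(2)) (use d in \<open>auto intro: continuous_intros\<close>)
    also have "\<dots> \<le> N f + ennreal (norm (\<integral>z. f z \<partial>\<mu>)) * ennreal n1"
      using d const(2)[of "\<integral>z. f z \<partial>\<mu>"] n1(1) by (simp only:)
    also have "\<dots> \<le> N f + (ennreal C * N f) * ennreal n1"
      by (intro add_left_mono mult_right_mono C f) simp
    also have "\<dots> = ennreal (1 + C * n1) * N f"
      using C(1) n1(2) by (simp add: ennreal_mult distrib_left distrib_right mult_ac)
    finally show ?thesis .
  qed
  then show ?thesis using C(1) n1(2) by (intro exI[of _ "1 + C * n1"]) auto
qed

lemma shift_pow_in: "f \<in> Y \<Longrightarrow> (backward_shift ^^ n) f \<in> Y"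
  by (induction n) (auto intro: shift_in)

lemma shift_pow_hardy: "f \<in> hardy Y \<Longrightarrow> (backward_shift ^^ n) f \<in> hardy Y"
  by (induction n) (auto intro: shift_hardy)

lemma shift_pow_norm: "\<exists>C\<ge>0. \<forall>f\<in>Y. N ((backward_shift ^^ n) f) \<le> ennreal C * N f"
proof (induction n)
  case 0 show ?case by (intro exI[of _ 1]) auto
next
  case (Suc n)
  then obtain C where C: "C \<ge> 0" "\<And>f. f \<in> Y \<Longrightarrow> N ((backward_shift ^^ n) f) \<le> ennreal C * N f" by auto
  obtain D where D: "D \<ge> 0" "\<And>f. f \<in> Y \<Longrightarrow> N (backward_shift f) \<le> ennreal D * N f" using shift_norm by auto
  have "N ((backward_shift ^^ Suc n) f) \<le> ennreal (D * C) * N f" if f: "f \<in> Y" for f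
  proof -
    have "N ((backward_shift ^^ Suc n) f) \<le> ennreal D * N ((backward_shift ^^ n) f)"
      using D(2)[OF shift_pow_in[OF f]] by simp
    also have "\<dots> \<le> ennreal D * (ennreal C * N f)" by (intro mult_left_mono C f) simp
    finally show ?thesis using C(1) D(1) by (simp add: ennreal_mult mult.assoc)
  qed
  then show ?case using C(1) D(1) by (intro exI[of _ "D * C"]) auto
qed

text \<open>Each step lowers the nonnegative Fourier indices by one. The induction needs every
  \<open>j\<close>; the case \<open>j = 0\<close> gives the means that occur in the commutator
  identity.\<close>

lemma shift_pow_mean:
  assumes f: "f \<in> Y"
  shows "(\<integral>z. (backward_shift ^^ n) f z * cnj z ^ j \<partial>\<mu>) = (\<integral>z. f z * cnj z ^ (n + j) \<partial>\<mu>)"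
proof (induction n arbitrary: j)
  case 0 show ?case by simp
next
  case (Suc n)
  let ?g = "(backward_shift ^^ n) f"
  have gL: "?g \<in> L_one" by (intro integrable shift_pow_in f)
  have i: "integrable \<mu> (\<lambda>z. g z * cnj z ^ m)" if "g \<in> L_one" for g m
    by (intro integrable_mult_continuous L_oneD that continuous_intros)
  have "(\<integral>z. cnj z ^ Suc j \<partial>\<mu>) = cnj (\<integral>z. z ^ Suc j \<partial>\<mu>)"
    by (simp flip: Bochner_Integration.integral_cnj)
  then have 0: "(\<integral>z. cnj z ^ Suc j \<partial>\<mu>) = 0" using integral_circle_power[of "Suc j"] by simp
  have "(\<integral>z. (backward_shift ^^ Suc n) f z * cnj z ^ j \<partial>\<mu>) =
      (\<integral>z. ?g z * cnj z ^ Suc j - (\<integral>z. ?g z \<partial>\<mu>) * cnj z ^ Suc j \<partial>\<mu>)"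
    by (intro Bochner_Integration.integral_cong refl) (simp add: backward_shift_def algebra_simps)
  also have "\<dots> = (\<integral>z. ?g z * cnj z ^ Suc j \<partial>\<mu>) -
      (\<integral>z. ?g z \<partial>\<mu>) * (\<integral>z. cnj z ^ Suc j \<partial>\<mu>)"
    using i[OF gL, of "Suc j"] i[OF L_one_const[of 1], of "Suc j"]
    by (subst Bochner_Integration.integral_diff) (auto simp del: power_Suc)
  also have "\<dots> = (\<integral>z. f z * cnj z ^ (n + Suc j) \<partial>\<mu>)" unfolding 0 Suc.IH by simp
  finally show ?case by simp
qed

lemma cnj_pow_in: "f \<in> Y \<Longrightarrow> (\<lambda>z. cnj z ^ n * f z) \<in> Y"
  by (rule unimodular(1)) (auto intro!: continuous_intros simp: norm_power)

text \<open>Solving the commutator identity for \<open>P (cnj z * g)\<close> with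
  \<open>g = cnj z ^ n * f\<close> produces one more backward shift, because \<open>g\<close> and
  \<open>(backward_shift ^^ n) f\<close> have the same mean.\<close>

lemma riesz_cnj_pow:
  assumes f: "f \<in> hardy Y"
  shows "AE z in \<mu>. riesz_projection (\<lambda>z. cnj z ^ n * f z) z = (backward_shift ^^ n) f z"
proof (induction n)
  case 0 show ?case using riesz_fix[OF f] by simp
next
  case (Suc n)
  have fY: "f \<in> Y" using f by (simp add: hardy_Y)
  let ?g = "\<lambda>z. cnj z ^ n * f z"
  have eq: "(\<lambda>z. cnj z ^ Suc n * f z) = (\<lambda>z. cnj z * ?g z)" by (simp add: mult.assoc)
  have m: "(\<integral>z. ?g z \<partial>\<mu>) = (\<integral>z. (backward_shift ^^ n) f z \<partial>\<mu>)"
    using shift_pow_mean[OF fY, of n 0] by (simp add: mult.commute)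
  show ?case
    using pv_exists_shift(2)[OF pv[OF cnj_pow_in[OF fY, of n]]] Suc AE_sphere
  proof eventually_elim
    case (elim t)
    then have t: "cnj t * t = 1" by (simp add: cnj_mult_self)
    have "riesz_projection (\<lambda>z. cnj z * ?g z) t = (cnj t * t) * riesz_projection (\<lambda>z. cnj z * ?g z) t" using t by simp
    also have "\<dots> = cnj t * ((backward_shift ^^ n) f t - (\<integral>z. (backward_shift ^^ n) f z \<partial>\<mu>))"
    proof -
      have aux: "b = a - c" if "a - b = c" for a b c :: complex using that by auto
      show ?thesis using aux[OF elim(1)[unfolded m elim(2)]] by (simp only: mult.assoc)
    qed
    finally show ?case
      unfolding eq funpow.simps o_apply backward_shift_def[of "(backward_shift ^^ n) f"] .
  qed
qed

end

section \<open>Finite rank and sums of compact operators\<close>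

context function_space
begin

text \<open>The scalars \<open>\<gamma> (F n)\<close> are bounded by \<open>C\<close>, so
  Bolzano-Weierstrass provides the subsequence and the limit is a multiple of
  \<open>e\<close>.\<close>

lemma rank_one_compact:
  assumes H: "H \<subseteq> Y" and e: "e \<in> H" and scaleH: "\<And>c. (\<lambda>z. c * e z) \<in> H"
    and lin: "\<And>f g. f \<in> H \<Longrightarrow> g \<in> H \<Longrightarrow> \<gamma> (\<lambda>z. f z + g z) = \<gamma> f + \<gamma> g" "\<And>f c. f \<in> H \<Longrightarrow> \<gamma> (\<lambda>z. c * f z) = c * \<gamma> f"
    and bound: "\<And>f. f \<in> H \<Longrightarrow> ennreal (norm (\<gamma> f)) \<le> ennreal C * N f" and C: "C \<ge> 0"
  shows "compact_operator H N (\<lambda>f z. \<gamma> f * e z)"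
proof -
  have eY: "e \<in> Y" using e H by blast
  obtain n1 where n1: "N e = ennreal n1" "n1 \<ge> 0" using finite[OF eY] by (cases "N e") auto
  have "N (\<lambda>z. \<gamma> f * e z) \<le> ennreal (C * n1) * N f" if f: "f \<in> H" for f
  proof -
    have "N (\<lambda>z. \<gamma> f * e z) = ennreal (norm (\<gamma> f)) * ennreal n1" using scale[OF eY] n1 by simp
    also have "\<dots> \<le> (ennreal C * N f) * ennreal n1" by (intro mult_right_mono bound f) simp
    finally show ?thesis using C n1 by (simp add: ennreal_mult mult_ac)
  qed
  then have bd: "bounded_operator H N (\<lambda>f z. \<gamma> f * e z)"
    unfolding bounded_operator_def using lin scaleH by (auto simp: distrib_right)
  have "\<exists>g\<in>H. \<exists>r. strict_mono r \<and> (\<lambda>n. N (\<lambda>z. \<gamma> (F (r n)) * e z - g z)) \<longlonglongrightarrow> 0"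
    if F: "\<And>n::nat. F n \<in> H \<and> N (F n) \<le> 1" for F
  proof -
    have "norm (\<gamma> (F n)) \<le> C" for n
    proof -
      have "ennreal (norm (\<gamma> (F n))) \<le> ennreal C * N (F n)" using bound F by blast
      also have "\<dots> \<le> ennreal C * 1" by (intro mult_left_mono) (use F in auto)
      finally show ?thesis using C by simp
    qed
    then have "bounded (range (\<lambda>n. \<gamma> (F n)))" by (auto simp: bounded_iff)
    then obtain l r where r: "strict_mono r" "((\<lambda>n. \<gamma> (F n)) \<circ> r) \<longlonglongrightarrow> l"
      using bounded_imp_convergent_subsequence by blast
    have "N (\<lambda>z. \<gamma> (F (r n)) * e z - l * e z) = ennreal (norm (\<gamma> (F (r n)) - l)) * N e" for n
      using scale[OF eY, of "\<gamma> (F (r n)) - l"] by (simp add: left_diff_distrib)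
    moreover have "(\<lambda>n. ennreal (norm (\<gamma> (F (r n)) - l) * n1)) \<longlonglongrightarrow> ennreal (0 * n1)"
      by (intro tendsto_ennrealI tendsto_mult tendsto_const tendsto_norm_zero LIM_zero)
        (use r(2) in \<open>simp add: o_def\<close>)
    ultimately have "(\<lambda>n. N (\<lambda>z. \<gamma> (F (r n)) * e z - l * e z)) \<longlonglongrightarrow> 0"
      using n1 by (simp add: ennreal_mult)
    then show ?thesis using scaleH[of l] r(1) by (intro bexI[of _ "\<lambda>z. l * e z"] exI[of _ r] conjI)
  qed
  then show ?thesis using bd unfolding compact_operator_def by blast
qed

lemma compact_add:
  assumes H: "H \<subseteq> Y" and addH: "\<And>f g. f \<in> H \<Longrightarrow> g \<in> H \<Longrightarrow> (\<lambda>z. f z + g z) \<in> H"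
    and K: "compact_operator H N K" and L: "compact_operator H N L"
  shows "compact_operator H N (\<lambda>f z. K f z + L f z)"
proof -
  have bK: "bounded_operator H N K" and bL: "bounded_operator H N L"
    using K L by (auto simp: compact_operator_def)
  have KH: "K f \<in> H" and LH: "L f \<in> H" if "f \<in> H" for f
    using bK bL that by (auto simp: bounded_operator_def)
  obtain C D where C: "\<And>f. f \<in> H \<Longrightarrow> N (K f) \<le> ennreal C * N f" and D: "\<And>f. f \<in> H \<Longrightarrow> N (L f) \<le> ennreal D * N f"
    using bK bL unfolding bounded_operator_def by metis
  \<comment> \<open>The bounds \<open>C\<close> and \<open>D\<close> may be negative, and
    \<open>ennreal\<close> is additive only on nonnegative reals.\<close>
  have "N (\<lambda>z. K f z + L f z) \<le> ennreal (max C 0 + max D 0) * N f" if f: "f \<in> H" for f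
  proof -
    have "N (\<lambda>z. K f z + L f z) \<le> N (K f) + N (L f)" using add KH[OF f] LH[OF f] H by blast
    also have "\<dots> \<le> ennreal C * N f + ennreal D * N f" using C D f by (intro add_mono) auto
    also have "\<dots> \<le> ennreal (max C 0) * N f + ennreal (max D 0) * N f"
      by (intro add_mono mult_right_mono ennreal_leI) auto
    finally show ?thesis by (simp add: distrib_right)
  qed
  moreover have "AE z in \<mu>. K (\<lambda>x. f x + g x) z + L (\<lambda>x. f x + g x) z = (K f z + L f z) + (K g z + L g z)"
    if "f \<in> H" "g \<in> H" for f g
  proof -
    have "AE z in \<mu>. K (\<lambda>x. f x + g x) z = K f z + K g z"
      "AE z in \<mu>. L (\<lambda>x. f x + g x) z = L f z + L g z"
      using bK bL that by (auto simp: bounded_operator_def)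
    then show ?thesis by eventually_elim simp
  qed
  moreover have "AE z in \<mu>. K (\<lambda>x. c * f x) z + L (\<lambda>x. c * f x) z = c * (K f z + L f z)"
    if "f \<in> H" for f c
  proof -
    have "AE z in \<mu>. K (\<lambda>x. c * f x) z = c * K f z"
      "AE z in \<mu>. L (\<lambda>x. c * f x) z = c * L f z"
      using bK bL that by (auto simp: bounded_operator_def)
    then show ?thesis by eventually_elim (simp add: distrib_left)
  qed
  ultimately have bd: "bounded_operator H N (\<lambda>f z. K f z + L f z)"
    unfolding bounded_operator_def using addH[OF KH LH]
    by (intro conjI ballI allI exI[of _ "max C 0 + max D 0"])
  have "\<exists>g\<in>H. \<exists>r. strict_mono r \<and> (\<lambda>n. N (\<lambda>z. (K (F (r n)) z + L (F (r n)) z) - g z)) \<longlonglongrightarrow> 0"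
    if F: "\<And>n::nat. F n \<in> H \<and> N (F n) \<le> 1" for F
  proof -
    obtain g r where g: "g \<in> H" and r: "strict_mono r" "(\<lambda>n. N (\<lambda>z. K (F (r n)) z - g z)) \<longlonglongrightarrow> 0"
      using K F unfolding compact_operator_def by blast
    have "\<And>n. F (r n) \<in> H \<and> N (F (r n)) \<le> 1" using F by blast
    then obtain h s where h: "h \<in> H" and s: "strict_mono s" "(\<lambda>n. N (\<lambda>z. L (F (r (s n))) z - h z)) \<longlonglongrightarrow> 0"
      using L[unfolded compact_operator_def, THEN conjunct2, rule_format, of "\<lambda>n. F (r n)"] by blast
    have 1: "(\<lambda>n. N (\<lambda>z. K (F (r (s n))) z - g z)) \<longlonglongrightarrow> 0"
      using LIMSEQ_subseq_LIMSEQ[OF r(2) s(1)] by (simp add: o_def)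
    have le: "N (\<lambda>z. (K (F (r (s n))) z + L (F (r (s n))) z) - (g z + h z)) \<le>
        N (\<lambda>z. K (F (r (s n))) z - g z) + N (\<lambda>z. L (F (r (s n))) z - h z)" for n
    proof -
      have Fn: "F (r (s n)) \<in> H" using F by blast
      have "(\<lambda>z. K (F (r (s n))) z - g z) \<in> Y"
        using diff[OF subsetD[OF H KH[OF Fn]] subsetD[OF H g]] by (rule conjunct1)
      moreover have "(\<lambda>z. L (F (r (s n))) z - h z) \<in> Y"
        using diff[OF subsetD[OF H LH[OF Fn]] subsetD[OF H h]] by (rule conjunct1)
      ultimately have "N (\<lambda>z. (K (F (r (s n))) z - g z) + (L (F (r (s n))) z - h z)) \<le>
        N (\<lambda>z. K (F (r (s n))) z - g z) + N (\<lambda>z. L (F (r (s n))) z - h z)"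
        by (rule conjunct2[OF add])
      then show ?thesis by (simp only: add_diff_add)
    qed
    have "(\<lambda>n. N (\<lambda>z. K (F (r (s n))) z - g z) + N (\<lambda>z. L (F (r (s n))) z - h z)) \<longlonglongrightarrow> 0"
      using tendsto_add[OF 1 s(2)] by simp
    then have "(\<lambda>n. N (\<lambda>z. (K (F (r (s n))) z + L (F (r (s n))) z) - (g z + h z))) \<longlonglongrightarrow> 0"
      by (rule tendsto_sandwich[OF _ _ tendsto_const, rotated 2]) (use le in auto)
    moreover have "strict_mono (r \<circ> s)" using r(1) s(1) by (rule strict_mono_o)
    ultimately show ?thesis
      by (intro bexI[OF _ addH[OF g h]] exI[of _ "r \<circ> s"] conjI) (simp_all only: o_apply)
  qed
  then show ?thesis using bd unfolding compact_operator_def by blast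
qed

end

section \<open>Comparison of essential norms\<close>

lemma (in function_space) finite_rank_compact:
  fixes n :: nat
  assumes H: "H \<subseteq> Y" and addH: "\<And>f g. f \<in> H \<Longrightarrow> g \<in> H \<Longrightarrow> (\<lambda>z. f z + g z) \<in> H"
    and scaleH: "\<And>f c. f \<in> H \<Longrightarrow> (\<lambda>z. c * f z) \<in> H"
    and K: "compact_operator H N K" and e: "\<And>k. k < n \<Longrightarrow> e k \<in> H"
    and lin: "\<And>k f g. f \<in> H \<Longrightarrow> g \<in> H \<Longrightarrow> \<gamma> k (\<lambda>z. f z + g z) = \<gamma> k f + \<gamma> k g"
      "\<And>k f c. f \<in> H \<Longrightarrow> \<gamma> k (\<lambda>z. c * f z) = c * \<gamma> k f"
    and bound: "\<And>k. \<exists>C\<ge>0. \<forall>f\<in>H. ennreal (norm (\<gamma> k f)) \<le> ennreal C * N f"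
  shows "compact_operator H N (\<lambda>f z. K f z + (\<Sum>k<n. \<gamma> k f * e k z))"
  using e
proof (induction n)
  case 0 then show ?case using K by simp
next
  case (Suc n)
  obtain C where C: "C \<ge> 0" "\<And>f. f \<in> H \<Longrightarrow> ennreal (norm (\<gamma> n f)) \<le> ennreal C * N f" using bound[of n] by blast
  have e: "e n \<in> H" using Suc.prems by simp
  have A: "compact_operator H N (\<lambda>f z. \<gamma> n f * e n z)"
    by (rule rank_one_compact[OF H e scaleH[OF e] _ _ C(2,1)]) (use lin in auto)
  have B: "compact_operator H N (\<lambda>f z. K f z + (\<Sum>k<n. \<gamma> k f * e k z))"
    using Suc by simp
  have "compact_operator H N (\<lambda>f z. (K f z + (\<Sum>k<n. \<gamma> k f * e k z)) + \<gamma> n f * e n z)"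
    by (rule compact_add[OF H addH B A])
  then show ?case by (simp add: add.assoc)
qed

section \<open>Approximation of the symbol\<close>

text \<open>Wider than the trigonometric polynomials, as \<open>p\<close> may be any analytic
  multiplier. The class is closed under sums and products and contains \<open>z\<close> and
  \<open>cnj z\<close>, so Stone-Weierstrass reaches every continuous function through it.\<close>

definition trigonometric :: "(complex \<Rightarrow> complex) \<Rightarrow> bool" where
  "trigonometric f \<longleftrightarrow> (\<exists>n p. analytic_multiplier p \<and> (\<forall>z\<in>sphere 0 1. f z = cnj z ^ n * p z))"

lemma trigonometricI: "analytic_multiplier p \<Longrightarrow> (\<And>z. norm z = 1 \<Longrightarrow> f z = cnj z ^ n * p z) \<Longrightarrow> trigonometric f"
  by (auto simp: trigonometric_def)

lemma trigonometricE:
  assumes "trigonometric f"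
  obtains n p where "analytic_multiplier p" "\<And>z. norm z = 1 \<Longrightarrow> f z = cnj z ^ n * p z"
  using assms by (fastforce simp: trigonometric_def)

lemma trigonometric_add:
  assumes "trigonometric f" "trigonometric g" shows "trigonometric (\<lambda>z. f z + g z)"
proof -
  obtain n p m q where p: "analytic_multiplier p" "\<And>z. norm z = 1 \<Longrightarrow> f z = cnj z ^ n * p z"
    and q: "analytic_multiplier q" "\<And>z. norm z = 1 \<Longrightarrow> g z = cnj z ^ m * q z"
    by (metis trigonometricE assms)
  show ?thesis
  proof (rule trigonometricI)
    show "analytic_multiplier (\<lambda>z. z ^ m * p z + z ^ n * q z)"
      by (intro analytic_multiplier_add analytic_multiplier_mult analytic_multiplier_power analytic_multiplier_ident p q)
    fix z :: complex assume z: "norm z = 1"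
    then have zz: "cnj z ^ k * z ^ k = 1" for k by (simp add: power_mult_distrib[symmetric] cnj_mult_self)
    have "cnj z ^ (n + m) * (z ^ m * p z + z ^ n * q z) =
      (cnj z ^ m * z ^ m) * (cnj z ^ n * p z) + (cnj z ^ n * z ^ n) * (cnj z ^ m * q z)"
      by (simp add: power_add algebra_simps)
    then show "f z + g z = cnj z ^ (n + m) * (z ^ m * p z + z ^ n * q z)"
      using p(2)[OF z] q(2)[OF z] by (simp only: zz mult_1)
  qed
qed

lemma trigonometric_mult:
  assumes "trigonometric f" "trigonometric g" shows "trigonometric (\<lambda>z. f z * g z)"
proof -
  obtain n p m q where p: "analytic_multiplier p" "\<And>z. norm z = 1 \<Longrightarrow> f z = cnj z ^ n * p z"
    and q: "analytic_multiplier q" "\<And>z. norm z = 1 \<Longrightarrow> g z = cnj z ^ m * q z"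
    by (metis trigonometricE assms)
  show ?thesis
    by (rule trigonometricI[OF analytic_multiplier_mult[OF p(1) q(1)], of _ "n + m"])
       (simp add: p q power_add mult_ac)
qed

lemma trigonometric_const: "trigonometric (\<lambda>_. c)"
  by (rule trigonometricI[OF analytic_multiplier_const[of c], of _ 0]) simp

lemma trigonometric_real_polynomial:
  fixes f :: "complex \<Rightarrow> real"
  assumes "real_polynomial_function f" shows "trigonometric (\<lambda>z. of_real (f z))"
  using assms
proof (induction rule: real_polynomial_function.induct)
  case (linear f)
  have z: "trigonometric (\<lambda>z. z)"
    by (rule trigonometricI[OF analytic_multiplier_ident, of _ 0]) simp
  have c: "trigonometric cnj"
    by (rule trigonometricI[OF analytic_multiplier_const[of 1], of _ 1]) simp
  \<comment> \<open>A real linear functional is determined by its values at \<open>1\<close> and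
    \<open>\<i>\<close>; \<open>Re z\<close> and \<open>Im z\<close> are then expressed by
    \<open>z\<close> and \<open>cnj z\<close>.\<close>
  have "complex_of_real (f z) = (1 / 2 * of_real (f 1) + - (\<i> * (1 / 2)) * of_real (f \<i>)) * z + (1 / 2 * of_real (f 1) + \<i> * (1 / 2) * of_real (f \<i>)) * cnj z" for z
  proof -
    have "f z = f (Re z *\<^sub>R 1 + Im z *\<^sub>R \<i>)" by (rule arg_cong[where f=f]) (simp add: complex_eq_iff)
    also have "\<dots> = Re z * f 1 + Im z * f \<i>"
      using bounded_linear.linear[OF linear] by (simp only: linear_add linear_scale) simp
    finally have 1: "complex_of_real (f z) = of_real (Re z) * of_real (f 1) + of_real (Im z) * of_real (f \<i>)" by simp
    have 2: "complex_of_real (Re z) = (z + cnj z) * (1 / 2)" "complex_of_real (Im z) = - (\<i> * (1 / 2)) * (z - cnj z)"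
      by (simp_all add: complex_eq_iff)
    have "(z + c) * h * A + - (\<i> * h) * (z - c) * B = (h * A + - (\<i> * h) * B) * z + (h * A + \<i> * h * B) * c" for A B c h
      by (simp add: algebra_simps)
    from this[of "cnj z" "1 / 2" "of_real (f 1)" "of_real (f \<i>)"] show ?thesis unfolding 1 2 .
  qed
  then have eq: "(\<lambda>z. complex_of_real (f z)) =
    (\<lambda>z. (1 / 2 * of_real (f 1) + - (\<i> * (1 / 2)) * of_real (f \<i>)) * z + (1 / 2 * of_real (f 1) + \<i> * (1 / 2) * of_real (f \<i>)) * cnj z)"
    by (rule ext)
  show ?case
    by (subst eq) (intro trigonometric_add trigonometric_mult trigonometric_const z c)
qed (auto intro: trigonometric_const trigonometric_add trigonometric_mult)

lemma trigonometric_approximation: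
  assumes g: "continuous_on (sphere 0 1) g" and d: "\<delta> > 0"
  shows "\<exists>f. trigonometric f \<and> (\<forall>z\<in>sphere 0 1. norm (g z - f z) \<le> \<delta>)"
proof -
  have "compact (sphere (0::complex) 1)" by simp
  note sw = Stone_Weierstrass_real_polynomial_function[OF this _ half_gt_zero[OF d]]
  obtain p where p: "real_polynomial_function p" "\<And>z. z \<in> sphere 0 1 \<Longrightarrow> \<bar>Re (g z) - p z\<bar> < \<delta> / 2"
    using sw[of "\<lambda>z. Re (g z)"] g by (auto intro: continuous_intros)
  obtain q where q: "real_polynomial_function q" "\<And>z. z \<in> sphere 0 1 \<Longrightarrow> \<bar>Im (g z) - q z\<bar> < \<delta> / 2"
    using sw[of "\<lambda>z. Im (g z)"] g by (auto intro: continuous_intros)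
  show ?thesis
  proof (intro exI conjI ballI)
    show "trigonometric (\<lambda>z. of_real (p z) + \<i> * of_real (q z))"
      by (intro trigonometric_add trigonometric_mult trigonometric_const trigonometric_real_polynomial p q)
    fix z :: complex assume z: "z \<in> sphere 0 1"
    have "norm (g z - (of_real (p z) + \<i> * of_real (q z))) \<le> \<bar>Re (g z) - p z\<bar> + \<bar>Im (g z) - q z\<bar>"
      using cmod_le[of "g z - (of_real (p z) + \<i> * of_real (q z))"] by simp
    then show "norm (g z - (of_real (p z) + \<i> * of_real (q z))) \<le> \<delta>"
      using p(2)[OF z] q(2)[OF z] by linarith
  qed
qed

text \<open>The bounded analytic summand \<open>k\<close> equals
  \<open>cnj z ^ n * (z ^ n * k)\<close> on the circle, so it joins the analytic factor of the
  approximation to the continuous summand.\<close>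

lemma C_plus_H_infty_approximation:
  assumes a: "a \<in> C_plus_H_infty" and d: "\<delta> > 0"
  obtains n h s where "analytic_multiplier h" "s \<in> borel_measurable \<mu>"
    "AE z in \<mu>. norm (s z) \<le> \<delta>" "AE z in \<mu>. a z = cnj z ^ n * h z + s z"
proof -
  obtain g k where g: "continuous_on (sphere 0 1) g" and k: "k \<in> hardy L_infty"
    and ae: "AE z in \<mu>. a z = g z + k z"
    using a by (auto simp: C_plus_H_infty_def)
  obtain f where tf: "trigonometric f" and f: "\<And>z. norm z = 1 \<Longrightarrow> norm (g z - f z) \<le> \<delta>"
    using trigonometric_approximation[OF g d] by auto
  obtain n p where p: "analytic_multiplier p" "\<And>z. norm z = 1 \<Longrightarrow> f z = cnj z ^ n * p z"
    using tf by (metis trigonometricE)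
  let ?h = "\<lambda>z. p z + z ^ n * k z"
  have h: "analytic_multiplier ?h"
    by (intro analytic_multiplier_add analytic_multiplier_mult analytic_multiplier_power
        analytic_multiplier_ident analytic_multiplier_hardy_infty p k)
  have am: "a \<in> borel_measurable \<mu>" using a by (auto simp: C_plus_H_infty_def L_infty_def)
  have cm: "(\<lambda>z. cnj z ^ n) \<in> borel_measurable \<mu>"
    by (intro continuous_imp_circle continuous_intros)
  show thesis
  proof (rule that[OF h, of "\<lambda>z. a z - cnj z ^ n * ?h z" n])
    show "(\<lambda>z. a z - cnj z ^ n * ?h z) \<in> borel_measurable \<mu>"
      using h am cm by (auto simp: analytic_multiplier_def)
    show "AE z in \<mu>. norm (a z - cnj z ^ n * ?h z) \<le> \<delta>"
      using ae AE_sphere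
    proof eventually_elim
      case (elim z)
      then have z: "norm z = 1" by simp
      then have zz: "cnj z ^ n * z ^ n = 1" by (simp add: power_mult_distrib[symmetric] cnj_mult_self)
      have "cnj z ^ n * ?h z = cnj z ^ n * p z + (cnj z ^ n * z ^ n) * k z" by (simp add: algebra_simps)
      then have "a z - cnj z ^ n * ?h z = g z - f z" using elim(1) p(2)[OF z] by (simp only: zz) simp
      then show ?case using f[OF z] by simp
    qed
  qed auto
qed

context riesz_space
begin

lemma one_hardy: "(\<lambda>_. 1) \<in> hardy Y"
  using one by (simp add: hardy_Y hardy_one_const)

lemma hardy_add: "f \<in> hardy Y \<Longrightarrow> g \<in> hardy Y \<Longrightarrow> (\<lambda>z. f z + g z) \<in> hardy Y"
  using add hardy_one_add by (auto simp: hardy_Y)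

lemma hardy_scale: "f \<in> hardy Y \<Longrightarrow> (\<lambda>z. c * f z) \<in> hardy Y"
  using scale hardy_one_cmult by (auto simp: hardy_Y)

lemma hardy_multiplier:
  assumes "analytic_multiplier h" "f \<in> hardy Y"
  shows "(\<lambda>z. h z * f z) \<in> hardy Y"
  using assms bounded_multiplier(1)[of f h] by (auto simp: hardy_Y analytic_multiplier_def)

text \<open>The main part becomes an iterated backward shift, to which algebra applies. The small
  remainder stays under \<open>P\<close>, where it costs \<open>\<delta>\<close> times the norm of
  \<open>P\<close>.\<close>

lemma toeplitz_split:
  assumes f: "f \<in> hardy Y" and h: "analytic_multiplier h"
    and s: "s \<in> borel_measurable \<mu>" "AE z in \<mu>. norm (s z) \<le> \<delta>"
    and a: "AE z in \<mu>. a z = cnj z ^ n * h z + s z"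
  shows "toeplitz a f \<in> Y" "(\<lambda>z. s z * f z) \<in> Y"
    "AE z in \<mu>. toeplitz a f z = (backward_shift ^^ n) (\<lambda>z. h z * f z) z + riesz_projection (\<lambda>z. s z * f z) z"
proof -
  have fY: "f \<in> Y" using f by (simp add: hardy_Y)
  have hf: "(\<lambda>z. h z * f z) \<in> hardy Y" by (rule hardy_multiplier[OF h f])
  then have hfY: "(\<lambda>z. h z * f z) \<in> Y" by (simp add: hardy_Y)
  have cY: "(\<lambda>z. cnj z ^ n * (h z * f z)) \<in> Y" by (rule cnj_pow_in[OF hfY])
  show sY: "(\<lambda>z. s z * f z) \<in> Y" by (rule bounded_multiplier(1)[OF fY s])
  have sum: "(\<lambda>z. cnj z ^ n * (h z * f z) + s z * f z) \<in> Y" using add cY sY by blast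
  have ae: "AE z in \<mu>. cnj z ^ n * (h z * f z) + s z * f z = a z * f z"
    using a by eventually_elim (simp add: algebra_simps)
  have aY: "(\<lambda>z. a z * f z) \<in> Y" by (rule cong(1)[OF sum ae])
  show "toeplitz a f \<in> Y" unfolding toeplitz_def by (rule riesz_in[OF aY])
  show "AE z in \<mu>. toeplitz a f z = (backward_shift ^^ n) (\<lambda>z. h z * f z) z + riesz_projection (\<lambda>z. s z * f z) z"
    using riesz_cong[OF integrable[OF sum] integrable[OF aY] ae]
      pv_exists_add(2)[OF pv[OF cY] pv[OF sY]] riesz_cnj_pow[OF hf, of n]
    by eventually_elim (simp add: toeplitz_def)
qed

end

lemma backward_shift_cong:
  assumes "f \<in> L_one" "g \<in> L_one" and ae: "AE z in \<mu>. f z = g z"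
  shows "AE z in \<mu>. backward_shift f z = backward_shift g z"
proof -
  have "(\<integral>z. f z \<partial>\<mu>) = (\<integral>z. g z \<partial>\<mu>)"
    using assms by (intro integral_cong_AE) (auto dest: L_oneD)
  note eq = this
  show ?thesis using ae by eventually_elim (simp add: backward_shift_def eq)
qed

lemma backward_shift_L_one: "f \<in> L_one \<Longrightarrow> backward_shift f \<in> L_one"
  unfolding backward_shift_def[abs_def]
  by (rule L_one_cnj_mult) (auto simp: L_one_def)

lemma backward_shift_pow_L_one: "f \<in> L_one \<Longrightarrow> (backward_shift ^^ n) f \<in> L_one"
  by (induction n) (auto intro: backward_shift_L_one)

lemma backward_shift_add:
  "f \<in> L_one \<Longrightarrow> g \<in> L_one \<Longrightarrow> backward_shift (\<lambda>z. f z + g z) = (\<lambda>z. backward_shift f z + backward_shift g z)"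
  by (rule ext) (simp add: backward_shift_def L_one_def algebra_simps)

lemma backward_shift_cmult:
  "backward_shift (\<lambda>z. c * f z) = (\<lambda>z. c * backward_shift f z)"
  by (rule ext) (simp add: backward_shift_def algebra_simps)

lemma backward_shift_pow_add:
  "f \<in> L_one \<Longrightarrow> g \<in> L_one \<Longrightarrow>
    (backward_shift ^^ n) (\<lambda>z. f z + g z) = (\<lambda>z. (backward_shift ^^ n) f z + (backward_shift ^^ n) g z)"
  by (induction n) (simp_all add: backward_shift_add backward_shift_pow_L_one)

lemma backward_shift_pow_cmult:
  "(backward_shift ^^ n) (\<lambda>z. c * f z) = (\<lambda>z. c * (backward_shift ^^ n) f z)"
  by (induction n) (simp_all add: backward_shift_cmult)

lemma L_one_sum: "(\<And>k. k < n \<Longrightarrow> e k \<in> L_one) \<Longrightarrow> (\<lambda>z. \<Sum>k<n. c k * e k z) \<in> L_one" for n :: nat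
  by (induction n) (simp_all add: L_one_add L_one_cmult L_one_const)

lemma backward_shift_sum:
  "(\<And>k. k < n \<Longrightarrow> e k \<in> L_one) \<Longrightarrow>
    backward_shift (\<lambda>z. \<Sum>k<n. c k * e k z) = (\<lambda>z. \<Sum>k<n. c k * backward_shift (e k) z)" for n :: nat
proof (induction n)
  case 0 show ?case by (rule ext) (simp add: backward_shift_def)
next
  case (Suc n)
  then show ?case
    using backward_shift_add[OF L_one_sum[of n e c] L_one_cmult[of "e n" "c n"]] backward_shift_cmult[of "c n" "e n"]
    by simp
qed

section \<open>Transfer of Toeplitz operators by an outer function\<close>

text \<open>The relation is one-sided, so that the converse inequality can be read off from the pair
  with \<open>1 / W\<close>. Since \<open>W\<close> vanishes nowhere, multiplying and dividing by it
  cancel as functions.\<close>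

locale riesz_pair = Y1: riesz_space Y1 N1 + Y2: riesz_space Y2 N2
  for Y1 N1 Y2 N2 +
  fixes W :: "complex \<Rightarrow> complex"
  assumes W_nonzero [simp]: "W z \<noteq> 0"
    and W_iso: "x \<in> Y2 \<Longrightarrow> (\<lambda>z. W z * x z) \<in> Y1 \<and> N1 (\<lambda>z. W z * x z) = N2 x"
    and W_hardy: "x \<in> hardy Y2 \<Longrightarrow> (\<lambda>z. W z * x z) \<in> hardy Y1"
    and W_inverse: "y \<in> hardy Y1 \<Longrightarrow> (\<lambda>z. y z / W z) \<in> hardy Y2"
begin

lemma W_in: "W \<in> hardy Y1"
  using W_hardy[OF Y2.one_hardy] by simp

text \<open>The mean of \<open>W * x\<close> is the product of the means of \<open>W\<close> and
  \<open>x\<close>: the function \<open>W * backward_shift x\<close> is analytic, so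
  \<open>z\<close> times it has mean zero. The rest is algebra with the definition of the
  shift.\<close>

lemma shift_W:
  assumes x: "x \<in> hardy Y2"
  shows "AE z in \<mu>. backward_shift (\<lambda>z. W z * x z) z =
    W z * backward_shift x z + (\<integral>z. x z \<partial>\<mu>) * backward_shift W z"
proof -
  let ?c = "\<integral>z. x z \<partial>\<mu>"
  have L: "W \<in> L_one" "(\<lambda>z. W z * x z) \<in> L_one"
    using W_in W_hardy[OF x] by (auto simp: Y1.hardy_Y intro: Y1.integrable)
  have "(\<lambda>z. W z * backward_shift x z) \<in> hardy L_one"
    using W_hardy[OF Y2.shift_hardy[OF x]] by (simp add: Y1.hardy_Y)
  from hardy_oneD(2)[OF this, of 1]
  have "(\<integral>z. W z * backward_shift x z * z \<partial>\<mu>) = 0" by simp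
  also have "(\<integral>z. W z * backward_shift x z * z \<partial>\<mu>) = (\<integral>z. W z * x z - ?c * W z \<partial>\<mu>)"
  proof (rule Bochner_Integration.integral_cong[OF refl])
    fix z assume "z \<in> space \<mu>"
    then have z: "cnj z * z = 1" by (simp add: cnj_mult_self)
    have "W z * backward_shift x z * z = (cnj z * z) * (W z * (x z - ?c))"
      by (simp add: backward_shift_def)
    then show "W z * backward_shift x z * z = W z * x z - ?c * W z" by (simp only: z) (simp add: algebra_simps)
  qed
  also have "\<dots> = (\<integral>z. W z * x z \<partial>\<mu>) - ?c * (\<integral>z. W z \<partial>\<mu>)"
    using L by (simp add: L_one_def)
  finally have "(\<integral>z. W z * x z \<partial>\<mu>) = ?c * (\<integral>z. W z \<partial>\<mu>)" by simp
  then show ?thesis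
    by (intro AE_I2) (simp add: backward_shift_def algebra_simps)
qed

text \<open>The rank one term with the mean of \<open>(backward_shift ^^ k) x\<close> appears with
  one shift of \<open>W\<close> and is then shifted \<open>n - k - 1\<close> more times, which gives
  the exponent \<open>n - k\<close>.\<close>

lemma shift_pow_W:
  assumes x: "x \<in> hardy Y2"
  shows "AE z in \<mu>. (backward_shift ^^ n) (\<lambda>z. W z * x z) z = W z * (backward_shift ^^ n) x z +
    (\<Sum>k<n. (\<integral>z. (backward_shift ^^ k) x z \<partial>\<mu>) * (backward_shift ^^ (n - k)) W z)"
proof (induction n)
  case 0 show ?case by simp
next
  case (Suc n)
  let ?c = "\<lambda>k. \<integral>z. (backward_shift ^^ k) x z \<partial>\<mu>"
  let ?v = "(backward_shift ^^ n) x"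
  have v: "?v \<in> hardy Y2" by (rule Y2.shift_pow_hardy[OF x])
  have L: "(\<lambda>z. W z * x z) \<in> L_one" "(\<lambda>z. W z * ?v z) \<in> L_one" "(backward_shift ^^ k) W \<in> L_one" for k
    using W_hardy[OF x] W_hardy[OF v] Y1.shift_pow_hardy[OF W_in, of k] by (auto simp: Y1.hardy_Y intro: Y1.integrable)
  have S: "(\<lambda>z. \<Sum>k<n. ?c k * (backward_shift ^^ (n - k)) W z) \<in> L_one" by (intro L_one_sum L)
  have "AE z in \<mu>. backward_shift ((backward_shift ^^ n) (\<lambda>z. W z * x z)) z =
      backward_shift (\<lambda>z. W z * ?v z + (\<Sum>k<n. ?c k * (backward_shift ^^ (n - k)) W z)) z"
    by (rule backward_shift_cong[OF backward_shift_pow_L_one[OF L(1)] L_one_add[OF L(2) S] Suc])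
  note ae = this
  have "backward_shift (\<lambda>z. W z * ?v z + (\<Sum>k<n. ?c k * (backward_shift ^^ (n - k)) W z)) =
      (\<lambda>z. backward_shift (\<lambda>z. W z * ?v z) z + (\<Sum>k<n. ?c k * (backward_shift ^^ (Suc n - k)) W z))"
    unfolding backward_shift_add[OF L(2) S] backward_shift_sum[OF L(3)]
    by (intro ext arg_cong2[where f="(+)"] refl sum.cong) (simp add: Suc_diff_le)
  note eq = this
  show ?case
    using ae[unfolded eq] shift_W[OF v] by eventually_elim (simp add: algebra_simps)
qed

text \<open>Division by \<open>W\<close> turns a sequence in the unit ball of
  \<open>hardy Y1\<close> into one in the unit ball of \<open>hardy Y2\<close>, and multiplication
  by \<open>W\<close> carries the limit back without change of norm.\<close>

lemma compact_transfer:
  assumes K: "compact_operator (hardy Y2) N2 K"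
  shows "compact_operator (hardy Y1) N1 (\<lambda>f z. W z * K (\<lambda>z. f z / W z) z)"
proof -
  have bK: "bounded_operator (hardy Y2) N2 K" using K by (simp add: compact_operator_def)
  have KH: "K x \<in> hardy Y2" if "x \<in> hardy Y2" for x using bK that by (auto simp: bounded_operator_def)
  have norm2: "N2 (\<lambda>z. f z / W z) = N1 f" if "f \<in> hardy Y1" for f
    using W_iso[of "\<lambda>z. f z / W z"] W_inverse[OF that] by (simp add: Y2.hardy_Y)
  have norm1: "N1 (\<lambda>z. W z * x z) = N2 x" if "x \<in> Y2" for x using W_iso[OF that] by simp
  obtain C where C: "\<And>x. x \<in> hardy Y2 \<Longrightarrow> N2 (K x) \<le> ennreal C * N2 x"
    using bK unfolding bounded_operator_def by blast
  have bd: "bounded_operator (hardy Y1) N1 (\<lambda>f z. W z * K (\<lambda>z. f z / W z) z)"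
    unfolding bounded_operator_def
  proof (intro conjI ballI allI exI)
    fix f assume f: "f \<in> hardy Y1"
    note x = W_inverse[OF f]
    show "(\<lambda>z. W z * K (\<lambda>z. f z / W z) z) \<in> hardy Y1" by (rule W_hardy[OF KH[OF x]])
    show "N1 (\<lambda>z. W z * K (\<lambda>z. f z / W z) z) \<le> ennreal C * N1 f"
      using C[OF x] norm1[of "K (\<lambda>z. f z / W z)"] KH[OF x] by (simp add: norm2[OF f] Y2.hardy_Y)
    fix c
    have "AE z in \<mu>. K (\<lambda>z. c * (f z / W z)) z = c * K (\<lambda>z. f z / W z) z"
      using bK x by (auto simp: bounded_operator_def)
    then show "AE z in \<mu>. W z * K (\<lambda>z. c * f z / W z) z = c * (W z * K (\<lambda>z. f z / W z) z)"
      by eventually_elim simp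
  next
    fix f g assume f: "f \<in> hardy Y1" and g: "g \<in> hardy Y1"
    have "AE z in \<mu>. K (\<lambda>z. f z / W z + g z / W z) z = K (\<lambda>z. f z / W z) z + K (\<lambda>z. g z / W z) z"
      using bK W_inverse[OF f] W_inverse[OF g] by (auto simp: bounded_operator_def)
    then show "AE z in \<mu>. W z * K (\<lambda>z. (f z + g z) / W z) z =
        W z * K (\<lambda>z. f z / W z) z + W z * K (\<lambda>z. g z / W z) z"
      by eventually_elim (simp add: add_divide_distrib distrib_left)
  qed
  have "\<exists>g\<in>hardy Y1. \<exists>r. strict_mono r \<and> (\<lambda>n. N1 (\<lambda>z. W z * K (\<lambda>z. F (r n) z / W z) z - g z)) \<longlonglongrightarrow> 0"
    if F: "\<And>n::nat. F n \<in> hardy Y1 \<and> N1 (F n) \<le> 1" for F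
  proof -
    have "\<forall>n. (\<lambda>z. F n z / W z) \<in> hardy Y2 \<and> N2 (\<lambda>z. F n z / W z) \<le> 1"
      using F W_inverse norm2 by auto
    with K[unfolded compact_operator_def, THEN conjunct2, rule_format, of "\<lambda>n z. F n z / W z"]
    obtain g r where g: "g \<in> hardy Y2" and r: "strict_mono r"
      "(\<lambda>n. N2 (\<lambda>z. K (\<lambda>z. F (r n) z / W z) z - g z)) \<longlonglongrightarrow> 0" by blast
    have "N1 (\<lambda>z. W z * K (\<lambda>z. F (r n) z / W z) z - W z * g z) = N2 (\<lambda>z. K (\<lambda>z. F (r n) z / W z) z - g z)" for n
    proof -
      have "F (r n) \<in> hardy Y1" using F by blast
      then have "(\<lambda>z. K (\<lambda>z. F (r n) z / W z) z - g z) \<in> Y2"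
        using Y2.diff[of "K (\<lambda>z. F (r n) z / W z)" g] KH[OF W_inverse] g by (simp add: Y2.hardy_Y)
      from norm1[OF this] show ?thesis by (simp add: right_diff_distrib)
    qed
    then show ?thesis using r W_hardy[OF g] by (intro bexI[of _ "\<lambda>z. W z * g z"] exI[of _ r]) auto
  qed
  then show ?thesis using bd unfolding compact_operator_def by blast
qed

text \<open>A compact \<open>K\<close> on \<open>hardy Y2\<close> is matched by its conjugate under
  multiplication by \<open>W\<close> plus the finite rank sum of \<open>shift_pow_W\<close>. The
  remaining error is at most \<open>(C1 + C2) * \<delta>\<close>, one summand for the remainder of
  the symbol in each space.\<close>

lemma essential_norm_le:
  assumes a: "a \<in> C_plus_H_infty"
  shows "essential_norm (hardy Y1) N1 (toeplitz a) \<le> essential_norm (hardy Y2) N2 (toeplitz a)"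
  unfolding essential_norm_def[of "hardy Y2"]
proof (rule INF_greatest)
  fix K assume "K \<in> {K. compact_operator (hardy Y2) N2 K}"
  then have K: "compact_operator (hardy Y2) N2 K" by simp
  then have KH: "K x \<in> hardy Y2" if "x \<in> hardy Y2" for x
    using that by (auto simp: compact_operator_def bounded_operator_def)
  let ?op = "operator_norm (hardy Y2) N2 (\<lambda>f z. toeplitz a f z - K f z)"
  obtain C1 where C1: "C1 \<ge> 0" "\<And>f. f \<in> Y1 \<Longrightarrow> N1 (riesz_projection f) \<le> ennreal C1 * N1 f"
    using Y1.riesz_norm by auto
  obtain C2 where C2: "C2 \<ge> 0" "\<And>f. f \<in> Y2 \<Longrightarrow> N2 (riesz_projection f) \<le> ennreal C2 * N2 f"
    using Y2.riesz_norm by auto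
  have H1: "hardy Y1 \<subseteq> Y1" and H2: "hardy Y2 \<subseteq> Y2" by (auto simp: hardy_def)
  have norm2: "N2 (\<lambda>z. f z / W z) = N1 f" if "f \<in> hardy Y1" for f
    using W_iso[of "\<lambda>z. f z / W z"] W_inverse[OF that] by (simp add: Y2.hardy_Y)
  have main: "essential_norm (hardy Y1) N1 (toeplitz a) \<le> ?op + ennreal ((C1 + C2) * \<delta>)" if \<delta>: "\<delta> > 0" for \<delta>
  proof -
    obtain n h s where h: "analytic_multiplier h" and s: "s \<in> borel_measurable \<mu>"
      "AE z in \<mu>. norm (s z) \<le> \<delta>" and as: "AE z in \<mu>. a z = cnj z ^ n * h z + s z"
      using C_plus_H_infty_approximation[OF a \<delta>] by blast
    obtain Ch where Ch: "AE z in \<mu>. norm (h z) \<le> Ch" and hm: "h \<in> borel_measurable \<mu>"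
      using h by (auto simp: analytic_multiplier_def)
    \<comment> \<open>The functionals and vectors of \<open>shift_pow_W\<close> for
      \<open>x = h * (f / W)\<close>.\<close>
    define \<gamma> where "\<gamma> k f = (\<integral>z. (backward_shift ^^ k) (\<lambda>z. h z * (f z / W z)) z \<partial>\<mu>)" for k f
    define e where "e k = (backward_shift ^^ (n - k)) W" for k
    \<comment> \<open>This operator depends on \<open>\<delta>\<close> through \<open>n\<close> and
      \<open>h\<close>, which is permitted because the essential norm is an infimum over all compact
      operators.\<close>
    define K1 where "K1 f z = W z * K (\<lambda>z. f z / W z) z + (\<Sum>k<n. \<gamma> k f * e k z)" for f z
    have hx: "(\<lambda>z. h z * (f z / W z)) \<in> hardy Y2" if "f \<in> hardy Y1" for f
      by (rule Y2.hardy_multiplier[OF h W_inverse[OF that]])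
    then have hxL: "(\<lambda>z. h z * (f z / W z)) \<in> L_one" if "f \<in> hardy Y1" for f
      using that Y2.integrable by (auto simp: Y2.hardy_Y)
    have "compact_operator (hardy Y1) N1 (\<lambda>f z. W z * K (\<lambda>z. f z / W z) z + (\<Sum>k<n. \<gamma> k f * e k z))"
    proof (rule Y1.finite_rank_compact[OF H1 Y1.hardy_add Y1.hardy_scale compact_transfer[OF K]])
      show "e k \<in> hardy Y1" for k unfolding e_def by (rule Y1.shift_pow_hardy[OF W_in])
      fix k and f g :: "complex \<Rightarrow> complex" and c :: complex
      assume f: "f \<in> hardy Y1"
      have eq: "(\<lambda>z. h z * (c * f z / W z)) = (\<lambda>z. c * (h z * (f z / W z)))" by auto
      show "\<gamma> k (\<lambda>z. c * f z) = c * \<gamma> k f"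
        unfolding \<gamma>_def eq backward_shift_pow_cmult by (rule integral_mult_right_zero)
      assume g: "g \<in> hardy Y1"
      have eq: "(\<lambda>z. h z * ((f z + g z) / W z)) = (\<lambda>z. h z * (f z / W z) + h z * (g z / W z))"
        by (auto simp: add_divide_distrib distrib_left)
      show "\<gamma> k (\<lambda>z. f z + g z) = \<gamma> k f + \<gamma> k g"
        unfolding \<gamma>_def eq backward_shift_pow_add[OF hxL[OF f] hxL[OF g]]
        by (intro Bochner_Integration.integral_add L_oneD backward_shift_pow_L_one hxL f g)
    next
      fix k
      obtain C where C: "C \<ge> 0" "\<And>f. f \<in> Y2 \<Longrightarrow> ennreal (norm (\<integral>z. f z \<partial>\<mu>)) \<le> ennreal C * N2 f"
        using Y2.mean_bound by auto
      obtain D where D: "D \<ge> 0" "\<And>f. f \<in> Y2 \<Longrightarrow> N2 ((backward_shift ^^ k) f) \<le> ennreal D * N2 f"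
        using Y2.shift_pow_norm[of k] by auto
      have "ennreal (norm (\<gamma> k f)) \<le> ennreal (C * (D * \<bar>Ch\<bar>)) * N1 f" if f: "f \<in> hardy Y1" for f
      proof -
        have xY: "(\<lambda>z. f z / W z) \<in> Y2" using W_inverse[OF f] H2 by auto
        have hxY: "(\<lambda>z. h z * (f z / W z)) \<in> Y2" using hx[OF f] H2 by auto
        have "ennreal (norm (\<gamma> k f)) \<le> ennreal C * N2 ((backward_shift ^^ k) (\<lambda>z. h z * (f z / W z)))"
          unfolding \<gamma>_def by (rule C(2)[OF Y2.shift_pow_in[OF hxY]])
        also have "\<dots> \<le> ennreal C * (ennreal D * N2 (\<lambda>z. h z * (f z / W z)))"
          by (intro mult_left_mono D hxY) simp
        also have "\<dots> \<le> ennreal C * (ennreal D * (ennreal \<bar>Ch\<bar> * N2 (\<lambda>z. f z / W z)))"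
          by (intro mult_left_mono Y2.bounded_multiplier(2)[OF xY hm Ch]) simp_all
        finally show ?thesis using C(1) D(1) by (simp add: norm2[OF f] ennreal_mult mult.assoc)
      qed
      then show "\<exists>C\<ge>0. \<forall>f\<in>hardy Y1. ennreal (norm (\<gamma> k f)) \<le> ennreal C * N1 f"
        using C(1) D(1) by (intro exI[of _ "C * (D * \<bar>Ch\<bar>)"]) auto
    qed
    then have K1: "compact_operator (hardy Y1) N1 K1"
      unfolding K1_def[abs_def] .
    have "N1 (\<lambda>z. toeplitz a f z - K1 f z) \<le> ?op + ennreal ((C1 + C2) * \<delta>)"
      if f: "f \<in> hardy Y1" and f1: "N1 f \<le> 1" for f
    proof -
      let ?x = "\<lambda>z. f z / W z"
      have x: "?x \<in> hardy Y2" by (rule W_inverse[OF f])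
      note T1 = Y1.toeplitz_split[OF f h s as] and T2 = Y2.toeplitz_split[OF x h s as]
      let ?R1 = "riesz_projection (\<lambda>z. s z * f z)" and ?R2 = "riesz_projection (\<lambda>z. s z * ?x z)"
      let ?d = "\<lambda>z. toeplitz a ?x z - K ?x z"
      have dY: "?d \<in> Y2" using Y2.diff[OF T2(1)] KH[OF x] H2 by blast
      have fxY: "f \<in> Y1" "?x \<in> Y2" using f x H1 H2 by auto
      have R1: "?R1 \<in> Y1" "N1 ?R1 \<le> ennreal (C1 * \<delta>)"
      proof -
        show "?R1 \<in> Y1" by (rule Y1.riesz_in[OF T1(2)])
        have "N1 ?R1 \<le> ennreal C1 * (ennreal \<bar>\<delta>\<bar> * N1 f)"
          by (rule order.trans[OF C1(2)[OF T1(2)]]) (intro mult_left_mono Y1.bounded_multiplier(2)[OF fxY(1) s], simp)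
        also have "\<dots> \<le> ennreal C1 * (ennreal \<bar>\<delta>\<bar> * 1)" by (intro mult_left_mono f1) simp_all
        finally show "N1 ?R1 \<le> ennreal (C1 * \<delta>)" using \<delta> C1(1) by (simp add: ennreal_mult)
      qed
      have R2: "?R2 \<in> Y2" "N2 ?R2 \<le> ennreal (C2 * \<delta>)"
      proof -
        show "?R2 \<in> Y2" by (rule Y2.riesz_in[OF T2(2)])
        have "N2 ?R2 \<le> ennreal C2 * (ennreal \<bar>\<delta>\<bar> * N2 ?x)"
          by (rule order.trans[OF C2(2)[OF T2(2)]]) (intro mult_left_mono Y2.bounded_multiplier(2)[OF fxY(2) s], simp)
        also have "\<dots> \<le> ennreal C2 * (ennreal \<bar>\<delta>\<bar> * 1)" by (intro mult_left_mono) (simp_all add: norm2[OF f] f1)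
        finally show "N2 ?R2 \<le> ennreal (C2 * \<delta>)" using \<delta> C2(1) by (simp add: ennreal_mult)
      qed
      \<comment> \<open>The shifted main terms and the finite rank sum cancel; \<open>?d\<close> is
        measured by the operator norm on \<open>hardy Y2\<close>, the two remainders by
        \<open>C1 * \<delta>\<close> and \<open>C2 * \<delta>\<close>.\<close>
      let ?rhs = "\<lambda>z. (W z * ?d z + ?R1 z) - W z * ?R2 z"
      have WdY: "(\<lambda>z. W z * ?d z) \<in> Y1" "N1 (\<lambda>z. W z * ?d z) = N2 ?d" using W_iso[OF dY] by auto
      have WRY: "(\<lambda>z. W z * ?R2 z) \<in> Y1" "N1 (\<lambda>z. W z * ?R2 z) = N2 ?R2" using W_iso[OF R2(1)] by auto
      note s1 = Y1.add[OF WdY(1) R1(1)]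
      note s2 = Y1.diff[OF conjunct1[OF s1] WRY(1)]
      have "AE z in \<mu>. ?rhs z = toeplitz a f z - K1 f z"
      proof -
        \<comment> \<open>The multiplier \<open>h\<close> commutes with multiplication by
          \<open>W\<close>, so only the backward shifts contribute to the commutator.\<close>
        have "(\<lambda>z. W z * (h z * ?x z)) = (\<lambda>z. h z * f z)"
          using W_nonzero by (auto simp: mult.left_commute)
        from shift_pow_W[OF hx[OF f], of n, unfolded this]
        have "AE z in \<mu>. (backward_shift ^^ n) (\<lambda>z. h z * f z) z =
           W z * (backward_shift ^^ n) (\<lambda>z. h z * ?x z) z + (\<Sum>k<n. \<gamma> k f * e k z)"
          unfolding \<gamma>_def e_def .
        then show ?thesis using T1(3) T2(3)
          by eventually_elim (simp only: K1_def, simp add: algebra_simps)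
      qed
      from Y1.cong(2)[OF conjunct1[OF s2] this]
      have "N1 (\<lambda>z. toeplitz a f z - K1 f z) = N1 ?rhs" .
      also have "\<dots> \<le> (N2 ?d + N1 ?R1) + N2 ?R2"
        using conjunct2[OF s2] conjunct2[OF s1] unfolding WdY(2) WRY(2)
        by (meson add_right_mono order_trans)
      also have "\<dots> \<le> (?op + ennreal (C1 * \<delta>)) + ennreal (C2 * \<delta>)"
      proof (intro add_mono R1 R2)
        show "N2 ?d \<le> ?op"
          unfolding operator_norm_def using x norm2[OF f] f1
          by (intro SUP_upper2[of ?x]) auto
      qed
      also have "\<dots> = ?op + ennreal ((C1 + C2) * \<delta>)"
        using \<delta> C1(1) C2(1) by (simp add: distrib_right add.assoc)
      finally show ?thesis .
    qed
    then have "operator_norm (hardy Y1) N1 (\<lambda>f z. toeplitz a f z - K1 f z) \<le> ?op + ennreal ((C1 + C2) * \<delta>)"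
      unfolding operator_norm_def[of "hardy Y1"] by (intro SUP_least) auto
    then show ?thesis
      unfolding essential_norm_def using K1 by (intro INF_lower2[of K1]) auto
  qed
  show "essential_norm (hardy Y1) N1 (toeplitz a) \<le> ?op"
  proof (rule ennreal_le_epsilon)
    fix \<epsilon> :: real assume \<epsilon>: "\<epsilon> > 0"
    \<comment> \<open>The summand \<open>1\<close> keeps the divisor positive when both constants
      are zero.\<close>
    have "(C1 + C2) * (\<epsilon> / (C1 + C2 + 1)) \<le> \<epsilon>"
      using \<epsilon> C1(1) C2(1) by (simp add: field_simps)
    then have "ennreal ((C1 + C2) * (\<epsilon> / (C1 + C2 + 1))) \<le> ennreal \<epsilon>" by (rule ennreal_leI)
    moreover have "\<epsilon> / (C1 + C2 + 1) > 0" using \<epsilon> C1(1) C2(1) by simp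
    ultimately show "essential_norm (hardy Y1) N1 (toeplitz a) \<le> ?op + ennreal \<epsilon>"
      using main by (meson add_left_mono order_trans)
  qed
qed

end

section \<open>The weighted space\<close>

text \<open>Since \<open>max 0 x \<le> exp x\<close>, the part of \<open>u\<close> above
  \<open>n\<close> has norm at most \<open>exp (- n)\<close> times the norm of \<open>exp u\<close>.
  Boundedness of \<open>P\<close> makes its projection tend to zero in norm, hence almost everywhere
  along a subsequence, as \<open>outer_mult_hardy\<close> requires.\<close>

lemma (in riesz_space) outer_hardy:
  fixes u :: "complex \<Rightarrow> real"
  assumes um: "u \<in> borel_measurable \<mu>" and upv: "pv_exists (\<lambda>z. complex_of_real (u z))"
    and d: "(\<lambda>z. complex_of_real (exp (u z))) \<in> Y"
    and h: "h \<in> borel_measurable \<mu>" "AE z in \<mu>. h z = outer_log u z"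
    and f: "f \<in> hardy L_one" and w: "(\<lambda>z. of_real (exp (u z)) * f z) \<in> L_one"
  shows "(\<lambda>z. exp (h z) * f z) \<in> hardy L_one"
proof -
  let ?v = "\<lambda>n::nat. \<lambda>z. complex_of_real (max 0 (u z - real n))"
  let ?d = "\<lambda>z. complex_of_real (exp (u z))"
  have v: "?v n \<in> Y" "N (?v n) \<le> ennreal (exp (- real n)) * N ?d" for n
  proof -
    have m: "?v n \<in> borel_measurable \<mu>" using um by measurable
    note s = scale[OF d, of "of_real (exp (- real n))"]
    have "norm (?v n z) \<le> norm (of_real (exp (- real n)) * ?d z)" for z
    proof -
      have "max 0 (u z - real n) \<le> exp (u z - real n)"
        using exp_ge_add_one_self[of "u z - real n"] exp_gt_zero[of "u z - real n"] by linarith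
      moreover have "norm (of_real (exp (- real n)) * ?d z) = exp (u z - real n)"
        by (simp add: of_real_mult[symmetric] exp_add[symmetric] del: of_real_mult)
      ultimately show ?thesis by simp
    qed
    from solid[OF conjunct1[OF s] m AE_I2[OF this]] s
    show "?v n \<in> Y" "N (?v n) \<le> ennreal (exp (- real n)) * N ?d" by auto
  qed
  obtain C where C: "C \<ge> 0" "\<And>f. f \<in> Y \<Longrightarrow> N (riesz_projection f) \<le> ennreal C * N f"
    using riesz_norm by auto
  obtain x where x: "N ?d = ennreal x" "x \<ge> 0" using finite[OF d] by (cases "N ?d") auto
  have le: "N (riesz_projection (?v n)) \<le> ennreal (C * (exp (- real n) * x))" for n
  proof -
    have "N (riesz_projection (?v n)) \<le> ennreal C * (ennreal (exp (- real n)) * ennreal x)"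
      using order.trans[OF C(2)[OF v(1)[of n]] mult_left_mono[OF v(2)[of n], of "ennreal C"]] x(1) by simp
    then show ?thesis using C(1) x(2) by (simp add: ennreal_mult)
  qed
  have "(\<lambda>n. ennreal (C * (exp (- real n) * x))) \<longlonglongrightarrow> ennreal (C * (0 * x))"
    by (intro tendsto_ennrealI tendsto_intros) real_asymp
  then have "(\<lambda>n. ennreal (C * (exp (- real n) * x))) \<longlonglongrightarrow> 0" by simp
  then have lim: "(\<lambda>n. N (riesz_projection (?v n))) \<longlonglongrightarrow> 0"
    by (rule tendsto_sandwich[OF _ _ tendsto_const, rotated 2]) (use le in auto)
  obtain k where "strict_mono k" "AE z in \<mu>. (\<lambda>j. riesz_projection (?v (k j)) z) \<longlonglongrightarrow> 0"
    using AE_subseq[of "\<lambda>n. riesz_projection (?v n)", OF riesz_in[OF v(1)] lim] by blast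
  then show ?thesis
    by (rule outer_mult_hardy[OF upv pv[OF v(1)] meas[OF riesz_in[OF v(1)]] h _ _ f w])
qed

text \<open>The indicator of \<open>{v \<le> n}\<close> is bounded and remains bounded after
  multiplication by \<open>v\<close>, so it lies in both spaces; its principal value exists because
  it lies in \<open>Y\<close>. The means tend to \<open>1\<close>, so one of them is nonzero and
  \<open>riesz_space_of_mean\<close> applies.\<close>

lemma (in riesz_space) weighted_riesz_space:
  fixes v :: "complex \<Rightarrow> real"
  assumes v: "v \<in> borel_measurable \<mu>" "AE z in \<mu>. v z > 0"
    and riesz: "riesz_bounded_on {f \<in> borel_measurable \<mu>. (\<lambda>z. f z * of_real (v z)) \<in> Y}
      (\<lambda>f. N (\<lambda>z. f z * of_real (v z)))"
  shows "riesz_space {f \<in> borel_measurable \<mu>. (\<lambda>z. f z * of_real (v z)) \<in> Y}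
      (\<lambda>f. N (\<lambda>z. f z * of_real (v z)))"
proof -
  interpret w: function_space "{f \<in> borel_measurable \<mu>. (\<lambda>z. f z * of_real (v z)) \<in> Y}"
    "\<lambda>f. N (\<lambda>z. f z * of_real (v z))"
    by (rule weighted[OF v])
  let ?g = "\<lambda>n::nat. \<lambda>z. indicator {z \<in> sphere 0 1. v z \<le> real n} z :: complex"
  have S: "{z \<in> sphere 0 1. v z \<le> real n} \<in> sets \<mu>" for n
  proof -
    have "{z \<in> space \<mu>. v z \<le> real n} \<in> sets \<mu>" using v(1) by measurable
    then show ?thesis by simp
  qed
  have gm: "?g n \<in> borel_measurable \<mu>" for n
    using S by (rule borel_measurable_indicator)
  have gY: "?g n \<in> Y" for n
    using solid[OF one gm[of n]] by (auto simp: indicator_def)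
  have "(\<lambda>z. ?g n z * of_real (v z)) \<in> Y" for n
  proof -
    have m: "(\<lambda>z. ?g n z * of_real (v z)) \<in> borel_measurable \<mu>"
      using gm[of n] v(1) by measurable
    have "AE z in \<mu>. norm (?g n z * of_real (v z)) \<le> norm (of_nat n :: complex)"
      using v(2) by eventually_elim (auto simp: indicator_def norm_mult)
    from solid[OF const(1) m this] show ?thesis by simp
  qed
  then have gY2: "?g n \<in> {f \<in> borel_measurable \<mu>. (\<lambda>z. f z * of_real (v z)) \<in> Y}" for n
    using gm by simp
  have "(\<lambda>n. \<integral>z. ?g n z \<partial>\<mu>) \<longlonglongrightarrow> (\<integral>z. 1 \<partial>\<mu>)"
  proof (rule integral_dominated_convergence[where w="\<lambda>_. 1"])
    show "AE z in \<mu>. (\<lambda>n. ?g n z) \<longlonglongrightarrow> 1"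
    proof (rule AE_I2)
      fix z assume z: "z \<in> space \<mu>"
      obtain M where M: "v z \<le> real M" using real_arch_simple by blast
      have "?g n z = 1" if "n \<ge> M" for n
        using M z that by (auto simp: indicator_def)
      then show "(\<lambda>n. ?g n z) \<longlonglongrightarrow> 1"
        by (intro tendsto_eventually) (auto simp: eventually_sequentially)
    qed
    show "AE z in \<mu>. norm (?g n z) \<le> 1" for n by (rule AE_I2) (simp add: indicator_def)
  qed (use gm in auto)
  then have lim: "(\<lambda>n. \<integral>z. ?g n z \<partial>\<mu>) \<longlonglongrightarrow> 1"
    using circle.prob_space by simp
  have "\<exists>n. (\<integral>z. ?g n z \<partial>\<mu>) \<noteq> 0"
  proof (rule ccontr)
    assume "\<not> ?thesis"
    then have "(\<lambda>n. \<integral>z. ?g n z \<partial>\<mu>) = (\<lambda>_. 0)" by blast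
    from lim[unfolded this] show False by (simp add: LIMSEQ_const_iff)
  qed
  then obtain n where "(\<integral>z. ?g n z \<partial>\<mu>) \<noteq> 0" by blast
  then show ?thesis
    using w.riesz_space_of_mean[OF riesz gY2 pv[OF gY]] by blast
qed

lemma outer_log_uminus:
  assumes "pv_exists (\<lambda>z. complex_of_real (u z))"
  shows "AE z in \<mu>. outer_log (\<lambda>z. - u z) z = - outer_log u z"
  using pv_exists_cmult(2)[OF assms, of "-1"]
  by eventually_elim (simp add: outer_log_def)

text \<open>\<open>AE_subseq\<close> comes from the integral bound in the definition of the norm:
  norm convergence implies convergence in L1, hence almost everywhere along a subsequence.\<close>

lemma bf_function_space:
  assumes \<rho>: "banach_function_norm \<rho>"
  shows "function_space (bf_space \<rho>) (bf_norm \<rho>)" and "(\<lambda>_. 1) \<in> bf_space \<rho>"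
proof -
  note \<rho>' = \<rho>[unfolded banach_function_norm_def]
  have scale\<rho>: "\<rho> (\<lambda>z. ennreal c * f z) = ennreal c * \<rho> f"
    if "f \<in> borel_measurable \<mu>" "c \<ge> 0" for f c using \<rho>' that by blast
  have add\<rho>: "\<rho> (\<lambda>z. f z + g z) \<le> \<rho> f + \<rho> g"
    if "f \<in> borel_measurable \<mu>" "g \<in> borel_measurable \<mu>" for f g using \<rho>' that by blast
  have mono\<rho>: "\<rho> g \<le> \<rho> f"
    if "f \<in> borel_measurable \<mu>" "g \<in> borel_measurable \<mu>" "AE z in \<mu>. g z \<le> f z" for f g
    using \<rho>' that by blast
  have "\<exists>C::real. C > 0 \<and> (\<forall>f \<in> borel_measurable \<mu>. (\<integral>\<^sup>+z. f z \<partial>\<mu>) \<le> ennreal C * \<rho> f)"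
    using \<rho>' by (elim conjE)
  then obtain C where C: "C > 0" "\<And>f. f \<in> borel_measurable \<mu> \<Longrightarrow> (\<integral>\<^sup>+z. f z \<partial>\<mu>) \<le> ennreal C * \<rho> f"
    by blast
  have bfI: "f \<in> borel_measurable \<mu>" "(\<lambda>z. ennreal (norm (f z))) \<in> borel_measurable \<mu>"
    if "f \<in> bf_space \<rho>" for f
  proof -
    show f: "f \<in> borel_measurable \<mu>" using that by (simp add: bf_space_def)
    show "(\<lambda>z. ennreal (norm (f z))) \<in> borel_measurable \<mu>" using f by measurable
  qed
  have "\<rho> (\<lambda>_. 1) < \<infinity>" using \<rho>' by (elim conjE)
  then show "(\<lambda>_. 1) \<in> bf_space \<rho>"
    by (simp add: bf_space_def bf_norm_def)
  show "function_space (bf_space \<rho>) (bf_norm \<rho>)"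
  proof
    fix f g :: "complex \<Rightarrow> complex" and c :: complex
    assume f: "f \<in> bf_space \<rho>"
    show "f \<in> borel_measurable \<mu>" using bfI[OF f] by simp
    show fin: "bf_norm \<rho> f < \<infinity>" using f by (simp add: bf_space_def)
    show "g \<in> bf_space \<rho> \<and> bf_norm \<rho> g \<le> bf_norm \<rho> f"
      if g: "g \<in> borel_measurable \<mu>" "AE z in \<mu>. norm (g z) \<le> norm (f z)"
    proof -
      have "bf_norm \<rho> g \<le> bf_norm \<rho> f"
        unfolding bf_norm_def by (rule mono\<rho>[OF bfI(2)[OF f]]) (use g in \<open>auto simp: ennreal_leI\<close>)
      then show ?thesis using fin g by (auto simp: bf_space_def)
    qed
    show "(\<lambda>z. c * f z) \<in> bf_space \<rho> \<and> bf_norm \<rho> (\<lambda>z. c * f z) = ennreal (norm c) * bf_norm \<rho> f"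
    proof -
      have "bf_norm \<rho> (\<lambda>z. c * f z) = ennreal (norm c) * bf_norm \<rho> f"
        using scale\<rho>[OF bfI(2)[OF f], of "norm c"] by (simp add: bf_norm_def norm_mult ennreal_mult)
      then show ?thesis using fin bfI(1)[OF f] by (simp add: bf_space_def ennreal_mult_less_top)
    qed
    show "(\<lambda>z. f z + g z) \<in> bf_space \<rho> \<and> bf_norm \<rho> (\<lambda>z. f z + g z) \<le> bf_norm \<rho> f + bf_norm \<rho> g"
      if g: "g \<in> bf_space \<rho>"
    proof -
      have "bf_norm \<rho> (\<lambda>z. f z + g z) \<le> \<rho> (\<lambda>z. ennreal (norm (f z)) + ennreal (norm (g z)))"
        unfolding bf_norm_def
        by (rule mono\<rho>) (use bfI[OF f] bfI[OF g] in \<open>auto intro!: AE_I2 ennreal_leI norm_triangle_ineq simp: ennreal_plus[symmetric] simp del: ennreal_plus\<close>)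
      also have "\<dots> \<le> bf_norm \<rho> f + bf_norm \<rho> g"
        unfolding bf_norm_def by (rule add\<rho>[OF bfI(2)[OF f] bfI(2)[OF g]])
      finally have le: "bf_norm \<rho> (\<lambda>z. f z + g z) \<le> bf_norm \<rho> f + bf_norm \<rho> g" .
      have "bf_norm \<rho> f + bf_norm \<rho> g < \<infinity>" using fin g by (simp add: bf_space_def)
      then show ?thesis using le bfI(1)[OF f] bfI(1)[OF g] by (auto simp: bf_space_def intro: le_less_trans)
    qed
  next
    fix F :: "nat \<Rightarrow> complex \<Rightarrow> complex"
    assume F: "\<And>n. F n \<in> bf_space \<rho>" and lim: "(\<lambda>n. bf_norm \<rho> (F n)) \<longlonglongrightarrow> 0"
    have le: "(\<integral>\<^sup>+z. ennreal (norm (F n z)) \<partial>\<mu>) \<le> ennreal C * bf_norm \<rho> (F n)" for n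
      unfolding bf_norm_def by (rule C(2)[OF bfI(2)[OF F]])
    have int: "integrable \<mu> (F n)" for n
    proof (rule integrableI_bounded)
      have "ennreal C * bf_norm \<rho> (F n) < \<infinity>" using F[of n] by (simp add: bf_space_def ennreal_mult_less_top)
      then show "(\<integral>\<^sup>+z. ennreal (norm (F n z)) \<partial>\<mu>) < \<infinity>" using le[of n] by (rule le_less_trans[rotated])
    qed (rule bfI(1)[OF F])
    have "(\<lambda>n. ennreal C * bf_norm \<rho> (F n)) \<longlonglongrightarrow> ennreal C * 0"
      by (intro ennreal_tendsto_cmult lim) simp
    then have "(\<lambda>n. ennreal C * bf_norm \<rho> (F n)) \<longlonglongrightarrow> 0" by simp
    then have "(\<lambda>n. \<integral>\<^sup>+z. ennreal (norm (F n z)) \<partial>\<mu>) \<longlonglongrightarrow> 0"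
      by (rule tendsto_sandwich[OF _ _ tendsto_const, rotated 2]) (use le in auto)
    moreover have "(\<integral>\<^sup>+z. ennreal (norm (F n z)) \<partial>\<mu>) = ennreal (\<integral>z. norm (F n z) \<partial>\<mu>)" for n
      by (rule nn_integral_eq_integral) (use int[of n] in auto)
    ultimately have "(\<lambda>n. ennreal (\<integral>z. norm (F n z) \<partial>\<mu>)) \<longlonglongrightarrow> ennreal 0" by simp
    then have "(\<lambda>n. \<integral>z. norm (F n z) \<partial>\<mu>) \<longlonglongrightarrow> 0"
      by (subst (asm) tendsto_ennreal_iff) auto
    from tendsto_L1_AE_subseq[OF int this]
    show "\<exists>k. strict_mono k \<and> (AE z in \<mu>. (\<lambda>n. F (k n) z) \<longlonglongrightarrow> 0)" .
  qed
qed

lemma (in riesz_space) weighted_riesz_pair: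
  fixes v :: "complex \<Rightarrow> real"
  defines "Y2 \<equiv> {f \<in> borel_measurable \<mu>. (\<lambda>z. f z * of_real (v z)) \<in> Y}"
    and "N2 \<equiv> \<lambda>f. N (\<lambda>z. f z * of_real (v z))"
  assumes v: "v \<in> borel_measurable \<mu>" "AE z in \<mu>. v z > 0"
    and R2: "riesz_space Y2 N2"
  shows "\<exists>W. riesz_pair Y N Y2 N2 W \<and> riesz_pair Y2 N2 Y N (\<lambda>z. 1 / W z)"
proof -
  interpret Y2: riesz_space Y2 N2 by (rule R2)
  define u where "u z = ln (v z)" for z
  have um: "u \<in> borel_measurable \<mu>" unfolding u_def[abs_def] using v(1) by measurable
  have eu: "AE z in \<mu>. exp (u z) = v z" using v(2) by eventually_elim (simp add: u_def)
  have expY: "(\<lambda>z. complex_of_real (exp (u z))) \<in> Y"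
  proof -
    \<comment> \<open>That the constant \<open>1\<close> belongs to the weighted space means that
      the weight itself lies in \<open>Y\<close>.\<close>
    have "(\<lambda>z. of_real (v z)) \<in> Y" using Y2.one by (simp add: Y2_def)
    then show ?thesis
      by (rule cong(1)) (use eu in eventually_elim, simp)
  qed
  have expY2: "(\<lambda>z. complex_of_real (exp (- u z))) \<in> Y2"
  proof -
    have "AE z in \<mu>. 1 = complex_of_real (exp (- u z)) * of_real (v z)"
      using eu v(2) by eventually_elim (simp add: exp_minus)
    from cong(1)[OF one this] um show ?thesis by (simp add: Y2_def)
  qed
  have p: "(\<lambda>z. complex_of_real (max 0 (u z))) \<in> Y"
  proof -
    have "norm (complex_of_real (max 0 (u z))) \<le> norm (complex_of_real (exp (u z)))" for z
    proof -
      have "max 0 (u z) \<le> exp (u z)" using exp_ge_add_one_self[of "u z"] exp_gt_zero[of "u z"] by linarith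
      then show ?thesis by simp
    qed
    then show ?thesis using solid[OF expY] um by (auto intro!: AE_I2)
  qed
  have q: "(\<lambda>z. complex_of_real (max 0 (- u z))) \<in> Y2"
  proof -
    have "norm (complex_of_real (max 0 (- u z))) \<le> norm (complex_of_real (exp (- u z)))" for z
    proof -
      have "max 0 (- u z) \<le> exp (- u z)" using exp_ge_add_one_self[of "- u z"] exp_gt_zero[of "- u z"] by linarith
      then show ?thesis by simp
    qed
    then show ?thesis using Y2.solid[OF expY2] um by (auto intro!: AE_I2)
  qed
  have split: "complex_of_real (u z) = of_real (max 0 (u z)) + (-1) * of_real (max 0 (- u z))" for z
    by (simp add: max_def)
  have upv: "pv_exists (\<lambda>z. complex_of_real (u z))"
    unfolding split by (intro pv_exists_add pv_exists_cmult pv[OF p] Y2.pv[OF q])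
  have upv': "pv_exists (\<lambda>z. complex_of_real (- u z))"
    using pv_exists_cmult(1)[OF upv, of "-1"] by simp
  \<comment> \<open>\<open>u\<close> need not lie in either space, so measurability of
    \<open>P u\<close> is not at hand. \<open>h\<close> is assembled from projections of the two
    parts, each measurable as an element of its own space.\<close>
  define h where "h z = 2 * (riesz_projection (\<lambda>z. of_real (max 0 (u z))) z + (-1) * riesz_projection (\<lambda>z. of_real (max 0 (- u z))) z)
    - (\<integral>z. complex_of_real (u z) \<partial>\<mu>)" for z
  have hm: "h \<in> borel_measurable \<mu>"
    unfolding h_def[abs_def] using meas[OF riesz_in[OF p]] Y2.meas[OF Y2.riesz_in[OF q]] by measurable
  have h: "AE z in \<mu>. h z = outer_log u z"
  proof -
    have "AE z in \<mu>. riesz_projection (\<lambda>z. complex_of_real (u z)) z =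
        riesz_projection (\<lambda>z. of_real (max 0 (u z))) z + riesz_projection (\<lambda>z. (-1) * of_real (max 0 (- u z))) z"
      unfolding split by (intro pv_exists_add pv_exists_cmult pv[OF p] Y2.pv[OF q])
    moreover have "AE z in \<mu>. riesz_projection (\<lambda>z. (-1) * of_real (max 0 (- u z))) z =
        (-1) * riesz_projection (\<lambda>z. complex_of_real (max 0 (- u z))) z"
      by (intro pv_exists_cmult Y2.pv[OF q])
    ultimately show ?thesis by eventually_elim (simp only: h_def outer_log_def)
  qed
  have h': "AE z in \<mu>. - h z = outer_log (\<lambda>z. - u z) z"
    using h outer_log_uminus[OF upv] by eventually_elim simp
  define W where "W z = exp (h z)" for z
  have Wm: "W \<in> borel_measurable \<mu>" unfolding W_def[abs_def] using hm by measurable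
  have normW: "AE z in \<mu>. norm (W z) = v z"
  proof -
    have "AE z in \<mu>. Re (outer_log u z) = u z"
      using outer_log_limit[OF upv] by auto
    then show ?thesis using h eu by eventually_elim (simp add: W_def norm_exp_eq_Re)
  qed
  have W0: "W z \<noteq> 0" for z by (simp add: W_def)
  have iso: "(\<lambda>z. W z * x z) \<in> Y \<and> N (\<lambda>z. W z * x z) = N2 x" if x: "x \<in> Y2" for x
  proof -
    have xv: "(\<lambda>z. x z * of_real (v z)) \<in> Y" and xm: "x \<in> borel_measurable \<mu>" using x by (auto simp: Y2_def)
    have m: "(\<lambda>z. W z * x z) \<in> borel_measurable \<mu>" using Wm xm by measurable
    have eq: "AE z in \<mu>. norm (W z * x z) = norm (x z * of_real (v z))"
      using normW v(2) by eventually_elim (simp add: norm_mult)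
    have "AE z in \<mu>. norm (W z * x z) \<le> norm (x z * of_real (v z))" using eq by eventually_elim simp
    note 1 = solid[OF xv m this]
    have "AE z in \<mu>. norm (x z * of_real (v z)) \<le> norm (W z * x z)" using eq by eventually_elim simp
    from solid[OF conjunct1[OF 1] meas[OF xv] this] 1 show ?thesis by (auto simp: N2_def)
  qed
  have inv: "(\<lambda>z. y z / W z) \<in> Y2" if y: "y \<in> Y" for y
  proof -
    have m: "(\<lambda>z. y z / W z) \<in> borel_measurable \<mu>" using Wm meas[OF y] by measurable
    have "(\<lambda>z. y z / W z * of_real (v z)) \<in> borel_measurable \<mu>" using m v(1) by measurable
    moreover have "AE z in \<mu>. norm (y z / W z * of_real (v z)) \<le> norm (y z)"
      using normW v(2) by eventually_elim (simp add: norm_mult norm_divide)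
    ultimately have "(\<lambda>z. y z / W z * of_real (v z)) \<in> Y" using solid[OF y] by blast
    then show ?thesis using m by (simp add: Y2_def)
  qed
  have hardyW: "(\<lambda>z. W z * x z) \<in> hardy Y" if x: "x \<in> hardy Y2" for x
  proof -
    have xY: "x \<in> Y2" "x \<in> hardy L_one" using x by (auto simp: Y2.hardy_Y)
    have "(\<lambda>z. x z * of_real (v z)) \<in> Y" using xY by (simp add: Y2_def)
    then have "(\<lambda>z. of_real (exp (u z)) * x z) \<in> Y"
      by (rule cong(1)) (use eu in eventually_elim, simp)
    from outer_hardy[OF um upv expY hm h xY(2) integrable[OF this]] iso[OF xY(1)]
    show ?thesis by (simp add: hardy_Y W_def)
  qed
  have hardyV: "(\<lambda>z. y z / W z) \<in> hardy Y2" if y: "y \<in> hardy Y" for y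
  proof -
    have yY: "y \<in> Y" "y \<in> hardy L_one" using y by (auto simp: hardy_Y)
    \<comment> \<open>Division by \<open>W\<close> is the situation of \<open>outer_hardy\<close> in
      \<open>Y2\<close> with \<open>- u\<close>, because \<open>exp (- u)\<close> is an element of
      \<open>Y2\<close>.\<close>
    have "(\<lambda>z. of_real (exp (- u z)) * y z) \<in> Y2"
    proof -
      have "AE z in \<mu>. y z = of_real (exp (- u z)) * y z * of_real (v z)"
        using eu v(2) by eventually_elim (simp add: exp_minus)
      from cong(1)[OF yY(1) this] um meas[OF yY(1)] show ?thesis by (simp add: Y2_def)
    qed
    from Y2.outer_hardy[OF _ upv' expY2 _ h' yY(2) Y2.integrable[OF this]] um hm
    have "(\<lambda>z. exp (- h z) * y z) \<in> hardy L_one" by simp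
    moreover have "(\<lambda>z. exp (- h z) * y z) = (\<lambda>z. y z / W z)" by (simp add: W_def exp_minus field_simps)
    ultimately show ?thesis using inv[OF yY(1)] by (simp add: Y2.hardy_Y)
  qed
  have "riesz_pair Y N Y2 N2 W"
    by unfold_locales (use W0 iso hardyW hardyV in auto)
  moreover have "riesz_pair Y2 N2 Y N (\<lambda>z. 1 / W z)"
  proof unfold_locales
    fix y assume y: "y \<in> Y"
    have "(\<lambda>z. W z * (y z / W z)) = y" using W0 by auto
    then show "(\<lambda>z. 1 / W z * y z) \<in> Y2 \<and> N2 (\<lambda>z. 1 / W z * y z) = N y"
      using inv[OF y] iso[OF inv[OF y]] by simp
  next
    fix y assume "y \<in> hardy Y"
    then show "(\<lambda>z. 1 / W z * y z) \<in> hardy Y2" using hardyV by simp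
  next
    fix x assume "x \<in> hardy Y2"
    from hardyW[OF this] show "(\<lambda>z. x z / (1 / W z)) \<in> hardy Y" by (simp add: mult.commute)
  qed (use W0 in auto)
  ultimately show ?thesis by blast
qed

theorem theorem3p4:
  fixes \<rho> :: "(complex \<Rightarrow> ennreal) \<Rightarrow> ennreal"
    and w :: "complex \<Rightarrow> ennreal"
    and a :: "complex \<Rightarrow> complex"
  assumes "banach_function_norm \<rho>"
    and "weight w"
    and "riesz_bounded_on (bf_space \<rho>) (bf_norm \<rho>)"
    and "riesz_bounded_on (weighted_space \<rho> w) (weighted_norm \<rho> w)"
    and "a \<in> C_plus_H_infty"
  shows "essential_norm (hardy (weighted_space \<rho> w)) (weighted_norm \<rho> w) (toeplitz a) =
         essential_norm (hardy (bf_space \<rho>)) (bf_norm \<rho>) (toeplitz a)"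
proof -
  define v where "v z = enn2real (w z)" for z
  have vm: "v \<in> borel_measurable \<mu>"
    unfolding v_def[abs_def] using assms(2) by (auto simp: weight_def)
  have vpos: "AE z in \<mu>. v z > 0"
  proof -
    have "AE z in \<mu>. 0 < w z \<and> w z < \<infinity>" using assms(2) by (simp add: weight_def)
    then show ?thesis by eventually_elim (simp add: v_def enn2real_positive_iff)
  qed
  have Y2: "weighted_space \<rho> w = {f \<in> borel_measurable \<mu>. (\<lambda>z. f z * of_real (v z)) \<in> bf_space \<rho>}"
    by (simp add: weighted_space_def weight_mult_def v_def)
  have N2: "weighted_norm \<rho> w = (\<lambda>f. bf_norm \<rho> (\<lambda>z. f z * of_real (v z)))"
    by (simp add: weighted_norm_def[abs_def] weight_mult_def v_def)
  \<comment> \<open>Here the constant \<open>1\<close> is available from the finiteness of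
    \<open>\<rho>\<close> at \<open>1\<close>; in the weighted space it comes from
    \<open>weighted_riesz_space\<close>, which presupposes the principal values in X.\<close>
  interpret X: riesz_space "bf_space \<rho>" "bf_norm \<rho>"
    using function_space.riesz_spaceI[OF bf_function_space(1)[OF assms(1)] assms(3) bf_function_space(2)[OF assms(1)]] .
  have "riesz_space (weighted_space \<rho> w) (weighted_norm \<rho> w)"
    using X.weighted_riesz_space[OF vm vpos] assms(4) by (simp only: Y2 N2)
  then obtain W where W: "riesz_pair (bf_space \<rho>) (bf_norm \<rho>) (weighted_space \<rho> w) (weighted_norm \<rho> w) W"
    "riesz_pair (weighted_space \<rho> w) (weighted_norm \<rho> w) (bf_space \<rho>) (bf_norm \<rho>) (\<lambda>z. 1 / W z)"
    using X.weighted_riesz_pair[OF vm vpos] unfolding Y2 N2 by blast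
  show ?thesis
    using riesz_pair.essential_norm_le[OF W(1) assms(5)] riesz_pair.essential_norm_le[OF W(2) assms(5)]
    by (rule antisym[rotated])
qed

end
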